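(* Let $r\ge 0$ be an integer. The following spaces of differential forms on the tetrahedron $T^3$ have bases that are $S_4$-invariant up to sign if and only if the corresponding condition holds: \begin{itemize} \item $\mathcal P_r\Lambda^1(T^3)$: always; \item $\mathcal P_r^-\Lambda^1(T^3)$: if and only if $r\notin 3\mathbb N_0+2$; \item $\mathcal P_r\Lambda^2(T^3)$: always; \item $\mathcal P_r^-\Lambda^2(T^3)$: always; \item $\mathring{\mathcal P}_r\Lambda^1(T^3)$: always; \item $\mathring{\mathcal P}_r^-\Lambda^1(T^3)$: always; \item $\mathring{\mathcal P}_r\Lambda^2(T^3)$: if and only if $r\notin 3\mathbb N_0+3$; \item $\mathring{\mathcal P}_r^-\Lambda^2(T^3)$: always. \end{itemize}
   Context: $T^n\subset\mathbb R^{n+1}$ is the standard simplex $\{(\lambda_0,\dots,\lambda_n):\lambda_i\ge 0,\ \sum_i\lambda_i=1\}$. $\mathcal P_r\Lambda^k(\mathbb R^{n+1})$ denotes the $k$-forms on $\mathbb R^{n+1}$ with polynomial coefficients of degree at most $r$ (zero if $r<0$). With $X$ the position vector field on $\mathbb R^{n+1}$ and $i_X$ contraction with $X$, $\mathcal P_r^-\Lambda^k(\mathbb R^{n+1}):=i_X\bigl(\mathcal P_{r-1}\Lambda^{k+1}(\mathbb R^{n+1})\bigr)$. The spaces $\mathcal P_r\Lambda^k(T^n)$ and $\mathcal P_r^-\Lambda^k(T^n)$ are the images of these spaces under restriction (pullback) to $T^n$. $\mathring{\mathcal P}_r\Lambda^k(T^n)$, $\mathring{\mathcal P}_r^-\Lambda^k(T^n)$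 denote the subspaces of forms whose trace (pullback) vanishes on every $(n-1)$-dimensional face of $T^n$. The symmetric group $S_{n+1}$ (permutations of $\{0,\dots,n\}$) acts on these spaces as follows: for $\pi\in S_{n+1}$ let $S_\pi(\lambda_0,\dots,\lambda_n)=(\lambda_{\pi(0)},\dots,\lambda_{\pi(n)})$, and let $\pi$ act on forms by the pullback $S_\pi^*$. A basis $\xi_1,\dots,\xi_m$ of a representation $V$ of a group $G$ is $G$-invariant up to sign if for every $g\in G$ and every $i$ there is $i'$ with $g\xi_i=\pm\xi_{i'}$. $\mathbb N_0=\{0,1,2,\dots\}$ and $3\mathbb N_0+a=\{3m+a:m\in\mathbb N_0\}$. *)

theory Defs
  imports "HOL-Analysis.Analysis" "HOL-Combinatorics.Permutations"
begin

text \<open>Points of R^4 = R^{n+1} with n = 3; coordinates lambda_0..lambda_3 are indexed by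
  the numeral type 4.  A k-form (field) on R^4 is represented by its values:
  omega x vs is omega at the point x evaluated on the vectors vs 0, ..., vs (k-1).\<close>

type_synonym form = "real^4 \<Rightarrow> (nat \<Rightarrow> real^4) \<Rightarrow> real"

definition exps_upto :: "int \<Rightarrow> (4 \<Rightarrow> nat) set" where
  "exps_upto r = {\<alpha>. int (\<Sum>i\<in>UNIV. \<alpha> i) \<le> r}"

text \<open>Polynomial functions on R^4 of degree at most r (only 0 if r < 0).\<close>
definition poly_fun :: "int \<Rightarrow> (real^4 \<Rightarrow> real) set" where
  "poly_fun r = {p. \<exists>c. p = (\<lambda>x. \<Sum>\<alpha>\<in>exps_upto r. c \<alpha> * (\<Prod>i\<in>UNIV. (x$i) ^ (\<alpha> i)))}"

text \<open>The constant k-form d lambda_{I 0} wedge ... wedge d lambda_{I (k-1)} (Leibniz determinant).\<close>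
definition dlam :: "nat \<Rightarrow> (nat \<Rightarrow> 4) \<Rightarrow> (nat \<Rightarrow> real^4) \<Rightarrow> real" where
  "dlam k I vs = (\<Sum>\<sigma>\<in>{\<sigma>. \<sigma> permutes {..<k}}. of_int (sign \<sigma>) * (\<Prod>j<k. vs j $ I (\<sigma> j)))"

definition PLam_R :: "int \<Rightarrow> nat \<Rightarrow> form set" where
  "PLam_R r k = {\<omega>. \<exists>a. (\<forall>I. a I \<in> poly_fun r) \<and>
      \<omega> = (\<lambda>x vs. \<Sum>I\<in>PiE {..<k} (\<lambda>_. UNIV). a I x * dlam k I vs)}"

definition contrX :: "form \<Rightarrow> form" where
  "contrX \<omega> = (\<lambda>x vs. \<omega> x (\<lambda>j. if j = 0 then x else vs (j - 1)))"

definition PmLam_R :: "int \<Rightarrow> nat \<Rightarrow> form set" where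
  "PmLam_R r k = contrX ` PLam_R (r - 1) (k + 1)"

definition simplex3 :: "(real^4) set" where
  "simplex3 = {x. (\<forall>i. 0 \<le> x$i) \<and> (\<Sum>i\<in>UNIV. x$i) = 1}"

definition tangent3 :: "(real^4) set" where
  "tangent3 = {v. (\<Sum>i\<in>UNIV. v$i) = 0}"

definition restr :: "nat \<Rightarrow> form \<Rightarrow> form" where
  "restr k \<omega> = (\<lambda>x vs. if x \<in> simplex3 \<and> (\<forall>j<k. vs j \<in> tangent3) then \<omega> x vs else 0)"

definition PLam :: "nat \<Rightarrow> nat \<Rightarrow> form set" where
  "PLam r k = restr k ` PLam_R (int r) k"

definition PmLam :: "nat \<Rightarrow> nat \<Rightarrow> form set" where
  "PmLam r k = restr k ` PmLam_R (int r) k"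

definition trace_free :: "nat \<Rightarrow> form \<Rightarrow> bool" where
  "trace_free k f \<longleftrightarrow> (\<forall>i x vs. x \<in> simplex3 \<and> x$i = 0 \<and>
      (\<forall>j<k. vs j \<in> tangent3 \<and> vs j $ i = 0) \<longrightarrow> f x vs = 0)"

definition PLam0 :: "nat \<Rightarrow> nat \<Rightarrow> form set" where
  "PLam0 r k = {f \<in> PLam r k. trace_free k f}"

definition PmLam0 :: "nat \<Rightarrow> nat \<Rightarrow> form set" where
  "PmLam0 r k = {f \<in> PmLam r k. trace_free k f}"

definition act :: "(4 \<Rightarrow> 4) \<Rightarrow> form \<Rightarrow> form" where
  "act \<pi> f = (\<lambda>x vs. f (\<chi> i. x $ \<pi> i) (\<lambda>j. \<chi> i. vs j $ \<pi> i))"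

definition inv_basis_up_to_sign :: "form set \<Rightarrow> bool" where
  "inv_basis_up_to_sign S \<longleftrightarrow> (\<exists>B. finite B \<and> B \<subseteq> S \<and>
     (\<forall>c. (\<lambda>x vs. \<Sum>b\<in>B. c b * b x vs) = (\<lambda>x vs. 0) \<longrightarrow> (\<forall>b\<in>B. c b = 0)) \<and>
     S = {(\<lambda>x vs. \<Sum>b\<in>B. c b * b x vs) | c. True} \<and>
     (\<forall>\<pi>. \<pi> permutes (UNIV :: 4 set) \<longrightarrow>
        (\<forall>b\<in>B. act \<pi> b \<in> B \<or> (\<lambda>x vs. - act \<pi> b x vs) \<in> B)))"

end

theory Submission
  imports Defs "HOL-Library.Function_Algebras"
begin

text \<open>
  A finite-dimensional representation V of the symmetric group on {0, 1, 2, 3} has a basis that is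
  invariant up to sign if and only if the 3-cycle c = (1 2 3) has nonnegative trace on V. The
  condition is necessary because c has order 3, so a basis vector that c maps to its own multiple
  by a sign is fixed. For sufficiency, let K be the Klein four-group. The isotypic components of
  the three nontrivial characters of K are permuted by c, and translating an eigenbasis of a
  transposition on one of them gives a signed basis of their sum. On the K-invariants only
  \<open>S\<^sub>3\<close> acts; each copy of its two-dimensional representation is combined with a trivial or
  sign representation to a signed permutation module of dimension 3, and the trace of c is the
  number of the latter minus the number of the former.

  The trace is then read off from explicit bases. In six of the eight cases c permutes a basis of
  monomial forms \<open>\<lambda>\<^sup>\<alpha> \<eta>\<close>. The spaces \<open>P\<^sub>r\<^sup>- \<Lambda>\<^sup>1\<close> and trace-free
  \<open>P\<^sub>r \<Lambda>\<^sup>2\<close> are both spaces of linear syzygies of the four coordinates, in total degree r + 1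
  and r respectively, and there the trace is -1 if that degree is a positive multiple of 3 and 0 otherwise.
\<close>

section \<open>Frames and traces\<close>

text \<open>The criterion concerns a single 3-cycle, and that cycle fixes the index 0. No basis
  below therefore has to look symmetric under all permutations: linear relations between natural
  generators (the differentials add up to zero on tangent vectors; the multiples of the Whitney
  2-forms by coordinates add up to zero with signs) are solved for the index 0, which the cycle
  respects. Because the coordinates add up to 1 on the simplex, a polynomial of degree at most r has
  exactly one homogeneous representative of degree r there. Coefficients thus live on exponents of
  exact degree, vanishing on a face becomes divisibility by a coordinate, and independence of forms
  reduces to independence of monomials. The value -1 has a simple source. For a monomial fixed by
  the cycle, with support S, the syzygies are the sum-zero vectors of R^S, so the trace on them is
  the number of fixed points of the cycle in S minus 1. This is 0 if 0 lies in S, and -1 for S = {1,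
  2, 3}. Monomials that the cycle moves contribute nothing.\<close>

instantiation "fun" :: (type, real_vector) real_vector
begin

text \<open>Forms are curried functions. With this scaling and the pointwise addition of
  \<open>Function_Algebras\<close> they are a real vector space, so that \<open>span\<close>,
  \<open>independent\<close> and \<open>linear\<close> apply to them directly.\<close>

definition scaleR_fun :: "real \<Rightarrow> ('a \<Rightarrow> 'b) \<Rightarrow> 'a \<Rightarrow> 'b" where
  "scaleR_fun c f = (\<lambda>x. c *\<^sub>R f x)"

instance
  by standard (auto simp: scaleR_fun_def fun_eq_iff algebra_simps)

end

lemma scaleR_fun_apply [simp]: "(c *\<^sub>R f) x = c *\<^sub>R f x"
  by (simp add: scaleR_fun_def)

lemma sum_fun_apply [simp]: "(\<Sum>a\<in>A. f a) x = (\<Sum>a\<in>A. f a x)"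
  by (induction A rule: infinite_finite_induct) auto

lemma fun_uminus_apply [simp]: "(- f) x = - f x"
  by (simp add: fun_Compl_def)

text \<open>A frame need not consist of independent vectors: reproducing every vector from linear
  coordinates already makes the trace independent of the frame.\<close>

definition frame :: "'v::real_vector set \<Rightarrow> 'i set \<Rightarrow> ('i \<Rightarrow> 'v) \<Rightarrow> ('i \<Rightarrow> 'v \<Rightarrow> real) \<Rightarrow> bool" where
  "frame V A e \<epsilon> \<longleftrightarrow> finite A \<and> subspace V \<and> e ` A \<subseteq> V \<and>
     (\<forall>v\<in>V. v = (\<Sum>a\<in>A. \<epsilon> a v *\<^sub>R e a)) \<and>
     (\<forall>a\<in>A. \<forall>u\<in>V. \<forall>v\<in>V. \<epsilon> a (u + v) = \<epsilon> a u + \<epsilon> a v) \<and>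
     (\<forall>a\<in>A. \<forall>k. \<forall>v\<in>V. \<epsilon> a (k *\<^sub>R v) = k * \<epsilon> a v)"

lemma frame_coord_sum:
  assumes "frame V A e \<epsilon>" "a \<in> A" "\<And>i. i \<in> I \<Longrightarrow> v i \<in> V"
  shows "\<epsilon> a (\<Sum>i\<in>I. k i *\<^sub>R v i) = (\<Sum>i\<in>I. k i * \<epsilon> a (v i))"
proof -
  have sV: "subspace V" using assms(1) by (simp add: frame_def)
  have zero: "\<epsilon> a 0 = 0"
  proof -
    have "\<epsilon> a (0 *\<^sub>R 0) = 0 * \<epsilon> a 0"
      using assms(1,2) subspace_0[OF sV] unfolding frame_def by blast
    then show ?thesis by simp
  qed
  show ?thesis using assms(3)
  proof (induction I rule: infinite_finite_induct)
    case (insert i I)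
    have "k i *\<^sub>R v i \<in> V" "(\<Sum>i\<in>I. k i *\<^sub>R v i) \<in> V" "v i \<in> V"
      using insert.prems sV by (auto intro!: subspace_sum subspace_scale)
    then have "\<epsilon> a (k i *\<^sub>R v i + (\<Sum>i\<in>I. k i *\<^sub>R v i)) = k i * \<epsilon> a (v i) + \<epsilon> a (\<Sum>i\<in>I. k i *\<^sub>R v i)"
      using assms(1,2) unfolding frame_def by simp
    then show ?case using insert by simp
  qed (auto simp: zero)
qed

text \<open>This is tr(PQ) = tr(QP): expanding \<open>e a\<close> in the second frame and
  \<open>f (d b)\<close> in the first turns both traces into the same double sum of
  \<open>\<delta> b (e a) * \<epsilon> a (f (d b))\<close>.\<close>

lemma frame_trace_unique:
  assumes 1: "frame V A e \<epsilon>" and 2: "frame V B d \<delta>"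
    and f: "linear f" "\<And>v. v \<in> V \<Longrightarrow> f v \<in> V"
  shows "(\<Sum>a\<in>A. \<epsilon> a (f (e a))) = (\<Sum>b\<in>B. \<delta> b (f (d b)))"
proof -
  have eV: "\<And>a. a \<in> A \<Longrightarrow> e a \<in> V" and dV: "\<And>b. b \<in> B \<Longrightarrow> d b \<in> V"
    using 1 2 by (auto simp: frame_def)
  have "(\<Sum>a\<in>A. \<epsilon> a (f (e a))) = (\<Sum>a\<in>A. \<Sum>b\<in>B. \<delta> b (e a) * \<epsilon> a (f (d b)))"
  proof (rule sum.cong[OF refl])
    fix a assume a: "a \<in> A"
    have "e a = (\<Sum>b\<in>B. \<delta> b (e a) *\<^sub>R d b)"
      using 2 eV[OF a] by (auto simp: frame_def)
    from arg_cong[OF this, of f] have "f (e a) = (\<Sum>b\<in>B. \<delta> b (e a) *\<^sub>R f (d b))"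
      unfolding linear_sum[OF f(1)] linear_scale[OF f(1)] .
    then show "\<epsilon> a (f (e a)) = (\<Sum>b\<in>B. \<delta> b (e a) * \<epsilon> a (f (d b)))"
      by (metis (no_types) frame_coord_sum[OF 1 a, of B "\<lambda>b. f (d b)" "\<lambda>b. \<delta> b (e a)"] f(2) dV)
  qed
  also have "\<dots> = (\<Sum>b\<in>B. \<Sum>a\<in>A. \<epsilon> a (f (d b)) * \<delta> b (e a))"
    by (subst sum.swap) (simp add: mult.commute)
  also have "\<dots> = (\<Sum>b\<in>B. \<delta> b (f (d b)))"
  proof (rule sum.cong[OF refl])
    fix b assume b: "b \<in> B"
    have "f (d b) = (\<Sum>a\<in>A. \<epsilon> a (f (d b)) *\<^sub>R e a)"
      using 1 f(2)[OF dV[OF b]] by (auto simp: frame_def)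
    then show "(\<Sum>a\<in>A. \<epsilon> a (f (d b)) * \<delta> b (e a)) = \<delta> b (f (d b))"
      by (metis (no_types) frame_coord_sum[OF 2 b, of A e "\<lambda>a. \<epsilon> a (f (d b))"] eV)
  qed
  finally show ?thesis .
qed

lemma frame_independent:
  assumes "finite B" "independent B"
  shows "frame (span B) B (\<lambda>b. b) (\<lambda>b v. representation B v b)"
  using assms unfolding frame_def
  by (auto simp: real_vector.sum_representation_eq real_vector.representation_add real_vector.representation_scale span_base
      subspace_span)

text \<open>\<open>g j\<close> places a copy of \<open>span (B j)\<close> into V, and
  \<open>p j\<close> reads that component off again. Several summands can be translates of one space
  and share its basis.\<close>

lemma frame_direct_sum:
  fixes g p :: "'j \<Rightarrow> 'v::real_vector \<Rightarrow> 'v"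
  assumes "finite J" "subspace V"
    and B: "\<And>j. j \<in> J \<Longrightarrow> finite (B j)" "\<And>j. j \<in> J \<Longrightarrow> independent (B j)"
    and g: "\<And>j. j \<in> J \<Longrightarrow> linear (g j)" "\<And>j v. j \<in> J \<Longrightarrow> v \<in> B j \<Longrightarrow> g j v \<in> V"
    and p: "\<And>j. j \<in> J \<Longrightarrow> linear (p j)" "\<And>j v. j \<in> J \<Longrightarrow> v \<in> V \<Longrightarrow> p j v \<in> span (B j)"
    and dec: "\<And>v. v \<in> V \<Longrightarrow> v = (\<Sum>j\<in>J. g j (p j v))"
  shows "frame V (Sigma J B) (\<lambda>(j, b). g j b) (\<lambda>(j, b) v. representation (B j) (p j v) b)"
  unfolding frame_def
proof (intro conjI ballI allI)
  show "finite (Sigma J B)" using assms by auto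
  show "(\<lambda>(j, b). g j b) ` Sigma J B \<subseteq> V" using g by auto
  show "subspace V" by fact
  fix v assume v: "v \<in> V"
  have "g j (p j v) = (\<Sum>b\<in>B j. representation (B j) (p j v) b *\<^sub>R g j b)" if "j \<in> J" for j
  proof -
    have "p j v = (\<Sum>b\<in>B j. representation (B j) (p j v) b *\<^sub>R b)"
      using real_vector.sum_representation_eq[of "B j" "p j v" "B j"] B p that v by simp
    from arg_cong[OF this, of "g j"] show ?thesis
      unfolding linear_sum[OF g(1)[OF that]] linear_scale[OF g(1)[OF that]] .
  qed
  then have "v = (\<Sum>j\<in>J. \<Sum>b\<in>B j. representation (B j) (p j v) b *\<^sub>R g j b)"
    by (subst dec[OF v]) (rule sum.cong[OF refl])
  also have "\<dots> = (\<Sum>(j, b)\<in>Sigma J B. representation (B j) (p j v) b *\<^sub>R g j b)"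
    using assms by (subst sum.Sigma) auto
  finally show "v = (\<Sum>a\<in>Sigma J B. (case a of (j, b) \<Rightarrow> \<lambda>v. representation (B j) (p j v) b) v *\<^sub>R
      (case a of (j, b) \<Rightarrow> g j b))"
    by (simp add: case_prod_unfold)
next
  fix a u v assume "a \<in> Sigma J B" "u \<in> V" "v \<in> V"
  then show "(case a of (j, b) \<Rightarrow> \<lambda>v. representation (B j) (p j v) b) (u + v) =
     (case a of (j, b) \<Rightarrow> \<lambda>v. representation (B j) (p j v) b) u +
     (case a of (j, b) \<Rightarrow> \<lambda>v. representation (B j) (p j v) b) v"
    using p B by (auto simp: linear_add real_vector.representation_add)
next
  fix a and k :: real and v assume "a \<in> Sigma J B" "v \<in> V"
  then show "(case a of (j, b) \<Rightarrow> \<lambda>v. representation (B j) (p j v) b) (k *\<^sub>R v) =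
     k * (case a of (j, b) \<Rightarrow> \<lambda>v. representation (B j) (p j v) b) v"
    using p B by (auto simp: linear_scale real_vector.representation_scale)
qed

text \<open>Only the diagonal blocks \<open>p j \<circ> f \<circ> g j\<close> enter the trace, and
  each is a scalar. This is used for the 3-cycle and, with \<open>f\<close> the identity, for
  counting dimensions.\<close>

lemma trace_direct_sum:
  fixes g p :: "'j \<Rightarrow> 'v::real_vector \<Rightarrow> 'v"
  assumes fin: "finite J"
    and B: "\<And>j. j \<in> J \<Longrightarrow> finite (B j)" "\<And>j. j \<in> J \<Longrightarrow> independent (B j)"
    and \<mu>: "\<And>j b. j \<in> J \<Longrightarrow> b \<in> B j \<Longrightarrow> p j (f (g j b)) = \<mu> j *\<^sub>R b"
  shows "(\<Sum>a\<in>Sigma J B. (case a of (j, b) \<Rightarrow> \<lambda>v. representation (B j) (p j v) b)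
      (f (case a of (j, b) \<Rightarrow> g j b))) = (\<Sum>j\<in>J. \<mu> j * card (B j))"
proof -
  have *: "representation (B j) (\<mu> j *\<^sub>R b) b = \<mu> j" if "j \<in> J" "b \<in> B j" for j b
    using B that by (simp add: real_vector.representation_scale real_vector.representation_basis span_base)
  have "(\<Sum>a\<in>Sigma J B. (case a of (j, b) \<Rightarrow> \<lambda>v. representation (B j) (p j v) b)
      (f (case a of (j, b) \<Rightarrow> g j b))) = (\<Sum>(j, b)\<in>Sigma J B. \<mu> j)"
    by (rule sum.cong) (auto simp: \<mu> *)
  also have "\<dots> = (\<Sum>j\<in>J. \<Sum>b\<in>B j. \<mu> j)"
    using assms by (subst sum.Sigma) auto
  finally show ?thesis by (simp add: mult.commute)
qed

section \<open>Representations of the symmetric group on four letters\<close>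

text \<open>A, B, C, T are the actions of (0 1)(2 3), (0 2)(1 3), (1 2 3) and (2 3). The vectors are
  real-valued functions, so that linear identities between them can be checked pointwise.\<close>

locale s4_rep =
  fixes V :: "('a \<Rightarrow> 'b \<Rightarrow> real) set" and A B C T :: "('a \<Rightarrow> 'b \<Rightarrow> real) \<Rightarrow> 'a \<Rightarrow> 'b \<Rightarrow> real"
  assumes subspace_V: "subspace V" and finite_dim: "\<exists>S. finite S \<and> V \<subseteq> span S"
    and lin: "linear A" "linear B" "linear C" "linear T"
    and stable: "v \<in> V \<Longrightarrow> A v \<in> V" "v \<in> V \<Longrightarrow> B v \<in> V" "v \<in> V \<Longrightarrow> C v \<in> V" "v \<in> V \<Longrightarrow> T v \<in> V"
    and rel: "A (A v) = v" "B (B v) = v" "B (A v) = A (B v)" "C (C (C v)) = v" "T (T v) = v"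
      "C (A v) = B (C v)" "C (B v) = A (B (C v))"
      "T (A v) = A (T v)" "T (B v) = A (B (T v))" "T (C v) = C (C (T v))"
begin

lemmas lins =
  lin[THEN linear_add] lin[THEN linear_diff] lin[THEN linear_scale] lin[THEN linear_neg]
text \<open>As rewrite rules these bring every word in the four operators to the normal form A^i B^j
  C^k T^l, so an identity in the group algebra becomes linear arithmetic.\<close>

lemmas push = lins rel

text \<open>\<open>Ys\<close> is the isotypic component of one nontrivial character of the Klein four-group.
  \<open>Us\<close> has half the dimension of the isotypic component of the two-dimensional representation.\<close>

definition "Zs = {v \<in> V. A v = v \<and> B v = v \<and> C v = v}"
definition "Us = {v \<in> V. A v = v \<and> B v = v \<and> v + C v + C (C v) = 0 \<and> T v = v}"
definition "Ys = {v \<in> V. A v = v \<and> B v = - v}"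

section \<open>Projections in the group algebra and the decomposition of V\<close>

definition "mV v = (1/4) *\<^sub>R (v + A v + B v + A (B v))"
definition "pZ v = (1/3) *\<^sub>R (mV v + C (mV v) + C (C (mV v)))"
definition "pU v = mV v - pZ v"
definition "sU v = pU v + T (pU v)"
definition "sU' v = C (C (pU v)) + T (C (C (pU v)))"
text \<open>The coefficients solve u = u1 + C u2 for u = \<open>pU v\<close> with u1 and u2 fixed by
  T. On this component 1 + C + C^2 = 0, hence \<open>sU v\<close> = 2 u1 - u2 and
  \<open>sU' v\<close> = - u1 + 2 u2; inverting this system gives u1 and u2.\<close>

definition "pU1 v = (1/3) *\<^sub>R (2 *\<^sub>R sU v + sU' v)"
definition "pU2 v = (1/3) *\<^sub>R (sU v + 2 *\<^sub>R sU' v)"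
definition "pY v = (1/4) *\<^sub>R (v + A v - B v - A (B v))"

lemmas proj_defs = pU1_def pU2_def sU_def sU'_def pU_def pZ_def mV_def pY_def

lemma linear_proj: "linear pZ" "linear pU1" "linear pU2" "linear pY"
  by (rule linearI; simp add: proj_defs push fun_eq_iff algebra_simps)+

lemma proj_stable:
  assumes "v \<in> V"
  shows "pZ v \<in> V" "pU1 v \<in> V" "pU2 v \<in> V" "pY v \<in> V"
  using assms subspace_V stable unfolding proj_defs
  by (simp_all add: subspace_add subspace_diff subspace_scale)

text \<open>The whole isotypic component of the two-dimensional representation. It is stable under C
  and T, whereas its half \<open>Us\<close>, the vectors fixed by T, is not stable under C.\<close>

definition "Ws = {v \<in> V. A v = v \<and> B v = v \<and> v + C v + C (C v) = 0}"

lemma Us_eq: "Us = {v \<in> Ws. T v = v}"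
  by (auto simp: Us_def Ws_def)

lemma subspaces: "subspace Zs" "subspace Ws" "subspace Us" "subspace Ys"
proof -
  have 0: "A 0 = 0" "B 0 = 0" "C 0 = 0" "T 0 = 0"
    by (simp_all add: lin linear_0)
  show "subspace Zs" "subspace Ys"
    using subspace_V unfolding Zs_def Ys_def subspace_def by (auto simp: push 0)
  have U: "x + y + C (x + y) + C (C (x + y)) = (x + C x + C (C x)) + (y + C y + C (C y))" for x y
    by (simp add: push)
  have U': "c *\<^sub>R x + C (c *\<^sub>R x) + C (C (c *\<^sub>R x)) = c *\<^sub>R (x + C x + C (C x))" for x c
    by (simp add: push scaleR_add_right)
  show "subspace Ws"
    using subspace_V unfolding Ws_def subspace_def mem_Collect_eq U U'
    by (auto simp: 0 lin(1,2)[THEN linear_add] lin(1,2)[THEN linear_scale])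
  then show "subspace Us"
    unfolding Us_eq subspace_def by (auto simp: 0 push)
qed

lemma Ws_closed:
  assumes "v \<in> Ws"
  shows "C v \<in> Ws" "T v \<in> Ws"
proof -
  have v: "v \<in> V" "A v = v" "B v = v" and s: "v + C v + C (C v) = 0"
    using assms by (auto simp: Ws_def)
  have AB: "A (C v) = C v" "B (C v) = C v"
    using rel(6)[of v] rel(7)[of v] v by simp_all
  show "C v \<in> Ws" using v s AB unfolding Ws_def by (auto simp: stable rel algebra_simps)
  have AT: "A (T v) = T v" "B (T v) = T v"
    using rel(8)[of v] rel(9)[of v] v by (simp, metis rel(1) rel(3) rel(8) v(2,3))
  have "T v + C (T v) + C (C (T v)) = T (v + C v + C (C v))"
    by (simp add: push algebra_simps)
  also have "\<dots> = 0" using s by (simp add: lin linear_0)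
  finally show "T v \<in> Ws" using v AT unfolding Ws_def by (auto simp: stable)
qed

lemma pU_in: "v \<in> V \<Longrightarrow> pU v \<in> Ws"
proof -
  assume v: "v \<in> V"
  have m: "A (mV v) = mV v" "B (mV v) = mV v"
    unfolding mV_def push by (simp_all add: algebra_simps)
  have Cm: "A (C (mV v)) = C (mV v)" "B (C (mV v)) = C (mV v)"
    using rel(6,7)[of "mV v"] m by simp_all
  have CCm: "A (C (C (mV v))) = C (C (mV v))" "B (C (C (mV v))) = C (C (mV v))"
    using rel(6,7)[of "C (mV v)"] Cm by simp_all
  have "pU v + C (pU v) + C (C (pU v)) = 0"
    unfolding pU_def pZ_def lins rel by (intro ext) (simp add: field_simps)
  moreover have "A (pU v) = pU v" "B (pU v) = pU v"
    unfolding pU_def pZ_def lins m Cm CCm by simp_all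
  moreover have "pU v \<in> V"
    using v subspace_V stable unfolding pU_def pZ_def mV_def
    by (simp add: subspace_add subspace_diff subspace_scale)
  ultimately show ?thesis by (simp add: Ws_def)
qed

lemma proj_in:
  assumes "v \<in> V"
  shows "pZ v \<in> Zs" "pU1 v \<in> Us" "pU2 v \<in> Us" "pY v \<in> Ys"
proof -
  show "pZ v \<in> Zs" "pY v \<in> Ys"
    using proj_stable[OF assms] unfolding Zs_def Ys_def
    by (auto simp: proj_defs push fun_eq_iff algebra_simps)
  have W: "pU v \<in> Ws" by (rule pU_in[OF assms])
  have "sU v \<in> Us" "sU' v \<in> Us"
    unfolding Us_eq sU_def sU'_def using W Ws_closed subspaces(2)
    by (auto intro: subspace_add simp: lins rel(5) add.commute)
  then show "pU1 v \<in> Us" "pU2 v \<in> Us"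
    unfolding pU1_def pU2_def using subspaces(3) by (auto intro: subspace_add subspace_scale)
qed

lemma Ws_decomposition:
  assumes "v \<in> V"
  shows "pU v = pU1 v + C (pU2 v)"
proof -
  define u t where "u = pU v" and "t = T u"
  have "u \<in> Ws" "t \<in> Ws" using pU_in[OF assms] Ws_closed by (auto simp: u_def t_def)
  \<comment> \<open>Eliminating C^2 leaves an identity in the four vectors u, C u, t and C
    t.\<close>
  then have CC: "C (C u) = - u - C u" "C (C t) = - t - C t"
    by (auto simp: Ws_def fun_eq_iff algebra_simps) (metis add.assoc add_eq_0_iff)+
  have "T (C (C u)) = C t"
    by (simp add: t_def rel)
  then have "pU1 v = (1/3) *\<^sub>R (2 *\<^sub>R (u + t) + (C (C u) + C t))"
    "pU2 v = (1/3) *\<^sub>R ((u + t) + 2 *\<^sub>R (C (C u) + C t))"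
    by (simp_all add: pU1_def pU2_def sU_def sU'_def u_def t_def)
  then show ?thesis
    unfolding u_def[symmetric] by (simp only: lins rel(4) CC) (auto intro!: ext simp: field_simps)
qed

text \<open>A vector is the sum of its components for the four characters of the Klein group. C
  permutes the nontrivial ones, so their projections are the conjugates of \<open>pY\<close> by C
  and C^2; recall that C^2 is the inverse of C.\<close>

lemma mV_decomposition: "v = mV v + pY v + C (pY (C (C v))) + C (C (pY (C v)))"
  unfolding mV_def pY_def push by (intro ext) (simp add: field_simps)

lemma decomposition:
  assumes "v \<in> V"
  shows "v = pZ v + pU1 v + C (pU2 v) + pY v + C (pY (C (C v))) + C (C (pY (C v)))"
proof -
  have "mV v = pZ v + (pU1 v + C (pU2 v))"
    using Ws_decomposition[OF assms] by (simp add: pU_def algebra_simps)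
  then show ?thesis
    using mV_decomposition[of v] by (simp add: add.assoc)
qed

lemma proj_Zs:
  assumes "v \<in> Zs" shows "pZ v = v" "pZ (C v) = v"
proof -
  have "A v = v" "B v = v" "C v = v" using assms by (auto simp: Zs_def)
  note e = this
  show "pZ v = v" "pZ (C v) = v"
    unfolding proj_defs lins e by (auto intro!: ext)
qed

text \<open>These are the entries needed on \<open>Us\<close> and its translate by C. The last one
  is the source of the negative trace: C maps C v to C (C v) = - v - C v, whose component in the
  translate is - v.\<close>

lemma proj_Us:
  assumes "v \<in> Us"
  shows "pU1 v = v" "pU2 (C v) = v" "pU1 (C v) = 0" "pU2 (C (C v)) = - v"
proof -
  have v: "A v = v" "B v = v" "T v = v" and s: "v + C v + C (C v) = 0"
    using assms by (auto simp: Us_def)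
  have CC: "C (C v) = - v - C v" using s by (simp add: fun_eq_iff algebra_simps) (metis add.assoc add_eq_0_iff)
  have AB: "A (C v) = C v" "B (C v) = C v"
    using rel(6)[of v] rel(7)[of v] v by simp_all
  have TC: "T (C v) = - v - C v" using rel(10)[of v] v CC by simp
  note e = v CC AB TC
  show "pU1 v = v" "pU2 (C v) = v" "pU1 (C v) = 0" "pU2 (C (C v)) = - v"
    unfolding proj_defs lins e by (auto intro!: ext simp: field_simps)
qed

text \<open>The three nontrivial characters, as pairs of eigenvalues of A and B, form one orbit
  under C: (1, -1), then (-1, 1), then (-1, -1).\<close>

lemma character_translates:
  assumes v: "A v = v" "B v = - v"
  shows "A (C v) = - C v" "B (C v) = C v" "A (C (C v)) = - C (C v)" "B (C (C v)) = - C (C v)"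
proof -
  show B: "B (C v) = C v" using rel(6)[of v] v by simp
  then show A: "A (C v) = - C v" using rel(7)[of v] v by (simp add: lins)
  show BB: "B (C (C v)) = - C (C v)" using rel(6)[of "C v"] A by (simp add: lins)
  show "A (C (C v)) = - C (C v)"
    using rel(7)[of "C v"] B BB by (metis add.inverse_inverse lin(1) linear_neg)
qed

lemma proj_Ys:
  assumes "v \<in> Ys"
  shows "pY v = v" "pY (C v) = 0" "pY (C (C v)) = 0"
proof -
  have v: "A v = v" "B v = - v" using assms by (auto simp: Ys_def)
  note e = v character_translates[OF v]
  show "pY v = v" "pY (C v) = 0" "pY (C (C v)) = 0"
    by (simp_all add: proj_defs lin[THEN linear_neg] e fun_eq_iff)
qed

section \<open>Adapted bases and the construction of a signed basis\<close>

lemma finite_basis: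
  assumes "S \<subseteq> V" "span S = W"
  obtains X where "X \<subseteq> S" "finite X" "independent X" "span X = W"
proof -
  obtain X where X: "X \<subseteq> S" "independent X" "S \<subseteq> span X"
    using real_vector.maximal_independent_subset by blast
  have "finite X"
    using finite_dim X assms(1) real_vector.independent_span_bound by (metis order_trans)
  moreover have "span X = W"
    using X assms(2) by (metis span_eq span_superset subset_trans)
  ultimately show ?thesis using that X by blast
qed

lemma eigenbasis:
  assumes W: "subspace W" "W \<subseteq> V" "\<And>v. v \<in> W \<Longrightarrow> T v \<in> W"
  obtains X where "finite X" "independent X" "span X = W" "\<And>v. v \<in> X \<Longrightarrow> T v = v \<or> T v = - v"
proof -
  define S where "S = {v \<in> W. T v = v \<or> T v = - v}"
  have "span S = W"
  proof
    show "span S \<subseteq> W" by (rule span_minimal) (use W in \<open>auto simp: S_def\<close>)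
    show "W \<subseteq> span S"
    proof
      fix v assume v: "v \<in> W"
      have "v + T v \<in> S" "v - T v \<in> S"
        using v W by (auto simp: S_def lins rel subspace_add subspace_diff)
      then have "(1/2) *\<^sub>R (v + T v) + (1/2) *\<^sub>R (v - T v) \<in> span S"
        by (intro span_add span_scale span_base)
      also have "(1/2) *\<^sub>R (v + T v) + (1/2) *\<^sub>R (v - T v) = v"
        by (intro ext) (simp add: field_simps)
      finally show "v \<in> span S" .
    qed
  qed
  moreover have "S \<subseteq> V" using W by (auto simp: S_def)
  ultimately obtain X where "X \<subseteq> S" "finite X" "independent X" "span X = W"
    using finite_basis by blast
  then show ?thesis using that by (auto simp: S_def)
qed

lemma adapted_basis:
  obtains BZ BU BY and I :: "(nat \<times> ('a \<Rightarrow> 'b \<Rightarrow> real)) set" and e \<epsilon> where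
    "finite BZ" "finite BU" "finite BY" "span BZ = Zs" "span BU = Us" "span BY = Ys"
    "\<And>v. v \<in> BZ \<Longrightarrow> T v = v \<or> T v = - v" "\<And>v. v \<in> BY \<Longrightarrow> T v = v \<or> T v = - v"
    "frame V I e \<epsilon>"
    "(\<Sum>a\<in>I. \<epsilon> a (C (e a))) = real (card BZ) - card BU"
    "(\<Sum>a\<in>I. \<epsilon> a (e a)) = real (card BZ) + 2 * card BU + 3 * card BY"
proof -
  have TZ: "T v \<in> Zs" if "v \<in> Zs" for v
  proof -
    have v: "v \<in> V" "A v = v" "B v = v" "C v = v" using that by (auto simp: Zs_def)
    have "C (T v) = C (C (C (T v)))"
      using v rel(10)[of v] by simp
    then show ?thesis using v rel(8,9)[of v] unfolding Zs_def
      by (simp add: stable) (metis rel(3,4,8) v(2,3))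
  qed
  have TY: "T v \<in> Ys" if "v \<in> Ys" for v
  proof -
    have v: "v \<in> V" "A v = v" "B v = - v" using that by (auto simp: Ys_def)
    have "A (T v) = T v" using rel(8)[of v] v by simp
    moreover have "B (T v) = - T v"
      using rel(9)[of v] v \<open>A (T v) = T v\<close> by (metis lin(4) linear_neg rel(1,3))
    ultimately show ?thesis using v by (simp add: Ys_def stable)
  qed
  have V: "Zs \<subseteq> V" "Us \<subseteq> V" "Ys \<subseteq> V" by (auto simp: Zs_def Us_def Ys_def)
  obtain BZ where BZ: "finite BZ" "independent BZ" "span BZ = Zs" "\<And>v. v \<in> BZ \<Longrightarrow> T v = v \<or> T v = - v"
    by (rule eigenbasis[of Zs]) (use TZ in \<open>auto simp: subspaces V\<close>)
  obtain BY where BY: "finite BY" "independent BY" "span BY = Ys" "\<And>v. v \<in> BY \<Longrightarrow> T v = v \<or> T v = - v"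
    by (rule eigenbasis[of Ys]) (use TY in \<open>auto simp: subspaces V\<close>)
  obtain BU where BU: "finite BU" "independent BU" "span BU = Us"
    by (rule finite_basis[OF V(2), of Us]) (use subspaces in \<open>auto intro: that\<close>)
  have inZ: "v \<in> Zs" if "v \<in> BZ" for v using that BZ span_base by blast
  have inU: "v \<in> Us" if "v \<in> BU" for v using that BU span_base by blast
  have inY: "v \<in> Ys" if "v \<in> BY" for v using that BY span_base by blast
  \<comment> \<open>Six summands: \<open>Zs\<close>, \<open>Us\<close> and its translate by C,
    \<open>Ys\<close> and its translates by C and C^2.\<close>
  define J :: "nat set" where "J = {0, 1, 2, 3, 4, 5}"
  define X where "X = (\<lambda>j::nat. [BZ, BU, BU, BY, BY, BY] ! j)"
  define g where "g = (\<lambda>j::nat. [\<lambda>v. v, \<lambda>v. v, C, \<lambda>v. v, C, \<lambda>v. C (C v)] ! j)"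
  define p where "p = (\<lambda>j::nat. [pZ, pU1, pU2, pY, \<lambda>v. pY (C (C v)), \<lambda>v. pY (C v)] ! j)"
  \<comment> \<open>C fixes \<open>Zs\<close> pointwise, has diagonal blocks 0 and -1 on the two
    copies of \<open>Us\<close>, and moves the three copies of \<open>Ys\<close> cyclically.\<close>
  define \<mu> :: "nat \<Rightarrow> real" where "\<mu> = (\<lambda>j. [1, 0, -1, 0, 0, 0] ! j)"
  have linC: "linear (\<lambda>v. C (C v))" "linear (\<lambda>v. pY (C v))" "linear (\<lambda>v. pY (C (C v)))"
    using linear_compose[OF lin(3) lin(3)] linear_compose[OF lin(3) linear_proj(4)]
      linear_compose[OF linear_compose[OF lin(3) lin(3)] linear_proj(4)] by (simp_all add: o_def)
  have id: "linear (\<lambda>v. v)" by (simp add: linear_iff)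
  have fr: "frame V (Sigma J X) (\<lambda>(j, b). g j b) (\<lambda>(j, b) v. representation (X j) (p j v) b)"
  proof (rule frame_direct_sum)
    show "finite J" by (simp add: J_def)
    show "subspace V" by (rule subspace_V)
    fix j assume j: "j \<in> J"
    then show "finite (X j)" "independent (X j)" "linear (g j)" "linear (p j)"
      using BZ BU BY linC id lin linear_proj by (auto simp: J_def X_def g_def p_def)
    fix v
    show "v \<in> X j \<Longrightarrow> g j v \<in> V"
      using j inZ[of v] inU[of v] inY[of v] V stable(3) by (auto simp: J_def X_def g_def subset_iff)
    show "v \<in> V \<Longrightarrow> p j v \<in> span (X j)"
      using j BZ BU BY proj_in stable by (auto simp: J_def X_def p_def)
  next
    fix v assume "v \<in> V"
    then show "v = (\<Sum>j\<in>J. g j (p j v))"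
      using decomposition[of v] by (simp add: J_def g_def p_def add.assoc)
  qed
  have t1: "(\<Sum>a\<in>Sigma J X. (case a of (j, b) \<Rightarrow> \<lambda>v. representation (X j) (p j v) b)
      (C (case a of (j, b) \<Rightarrow> g j b))) = (\<Sum>j\<in>J. \<mu> j * card (X j))"
  proof (rule trace_direct_sum)
    fix j b assume "j \<in> J" "b \<in> X j"
    then show "p j (C (g j b)) = \<mu> j *\<^sub>R b"
      using inZ inU inY proj_Zs proj_Us proj_Ys rel(4)
      by (auto simp: J_def X_def g_def p_def \<mu>_def)
  qed (use BZ BU BY in \<open>auto simp: J_def X_def\<close>)
  have t2: "(\<Sum>a\<in>Sigma J X. (case a of (j, b) \<Rightarrow> \<lambda>v. representation (X j) (p j v) b)
      ((case a of (j, b) \<Rightarrow> g j b))) = (\<Sum>j\<in>J. 1 * real (card (X j)))"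
  proof (rule trace_direct_sum[where f = "\<lambda>v. v" and \<mu> = "\<lambda>_. 1"])
    fix j b assume "j \<in> J" "b \<in> X j"
    then show "p j ((g j b)) = 1 *\<^sub>R b"
      using inZ inU inY proj_Zs proj_Us proj_Ys rel(4)
      by (auto simp: J_def X_def g_def p_def)
  qed (use BZ BU BY in \<open>auto simp: J_def X_def\<close>)
  show ?thesis
    by (rule that[OF BZ(1) BU(1) BY(1) BZ(3) BU(3) BY(3) BZ(4) BY(4) fr])
      (use t1 t2 in \<open>auto simp: J_def X_def \<mu>_def\<close>)
qed

lemma signed_basis_exists:
  assumes fr: "frame V I e \<epsilon>" and tr: "0 \<le> (\<Sum>a\<in>I. \<epsilon> a (C (e a)))"
  shows "\<exists>N. finite N \<and> independent N \<and> span N = V \<and>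
    (\<forall>g\<in>{A, B, C, T}. \<forall>b\<in>N. g b \<in> N \<or> - g b \<in> N)"
proof -
  obtain BZ BU BY and I' :: "(nat \<times> ('a \<Rightarrow> 'b \<Rightarrow> real)) set" and e' \<epsilon>' where
    fin: "finite BZ" "finite BU" "finite BY"
    and sp: "span BZ = Zs" "span BU = Us" "span BY = Ys"
    and TZ: "\<And>v. v \<in> BZ \<Longrightarrow> T v = v \<or> T v = - v" and TY: "\<And>v. v \<in> BY \<Longrightarrow> T v = v \<or> T v = - v"
    and fr': "frame V I' e' \<epsilon>'"
    and tr': "(\<Sum>a\<in>I'. \<epsilon>' a (C (e' a))) = real (card BZ) - card BU"
    and dim: "(\<Sum>a\<in>I'. \<epsilon>' a (e' a)) = real (card BZ) + 2 * card BU + 3 * card BY"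
    by (rule adapted_basis) (rule that)
  have "(\<Sum>a\<in>I. \<epsilon> a (C (e a))) = real (card BZ) - card BU"
    using frame_trace_unique[OF fr fr' lin(3) stable(3)] tr' by simp
  then have "card BU \<le> card BZ" using tr by simp
  \<comment> \<open>Nonnegative trace is used exactly here: each copy of the two-dimensional
    representation gets its own one-dimensional partner in \<open>BZ\<close>.\<close>
  then obtain h where h: "inj_on h BU" "h ` BU \<subseteq> BZ"
    using fin by (meson card_le_inj)
  have inZ: "v \<in> V \<and> A v = v \<and> B v = v \<and> C v = v" if "v \<in> BZ" for v
    using that sp span_base[of v BZ] by (auto simp: Zs_def)
  have inU: "v \<in> V \<and> A v = v \<and> B v = v \<and> v + C v + C (C v) = 0 \<and> T v = v" if "v \<in> BU" for v
    using that sp span_base[of v BU] by (auto simp: Us_def)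
  have inY: "v \<in> V \<and> A v = v \<and> B v = - v" if "v \<in> BY" for v
    using that sp span_base[of v BY] by (auto simp: Ys_def)
  \<comment> \<open>\<open>f' f\<close> lies in the copy generated by f and has the same
    T-eigenvalue as its partner \<open>h f\<close>. In the sign case C f - C (C f) works, because T
    fixes f and exchanges C f with C (C f). Hence T maps \<open>w f\<close> to itself up to sign and
    the orbit of \<open>w f\<close> under C is a signed permutation module.\<close>
  define f' where "f' f = (if T (h f) = h f then f else C f - C (C f))" for f
  define w where "w f = h f + f' f" for f
  define N where "N = (BZ - h ` BU) \<union> (w ` BU \<union> C ` w ` BU \<union> (\<lambda>v. C (C v)) ` w ` BU) \<union>
    (BY \<union> C ` BY \<union> (\<lambda>v. C (C v)) ` BY)"
  have finN: "finite N" using fin by (auto simp: N_def)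
  have ABC: "A (C v) = C v" "B (C v) = C v" if "A v = v" "B v = v" for v
    using rel(6,7)[of v] that by simp_all
  have f': "f' f \<in> V" "A (f' f) = f' f" "B (f' f) = f' f" "f' f + C (f' f) + C (C (f' f)) = 0"
    "T (h f) = h f \<Longrightarrow> T (f' f) = f' f" "T (h f) \<noteq> h f \<Longrightarrow> T (f' f) = - f' f" if "f \<in> BU" for f
  proof -
    note f = inU[OF that]
    note g = ABC[of f] ABC[of "C f"]
    show "f' f \<in> V" using f stable subspace_V by (simp add: f'_def subspace_diff)
    show "A (f' f) = f' f" "B (f' f) = f' f" using f g by (simp_all add: f'_def lins)
    show "f' f + C (f' f) + C (C (f' f)) = 0"
      using f by (auto simp: f'_def lins rel)
    show "T (h f) = h f \<Longrightarrow> T (f' f) = f' f" using f by (simp add: f'_def)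
    show "T (h f) \<noteq> h f \<Longrightarrow> T (f' f) = - f' f" using f by (simp add: f'_def lins rel)
  qed
  have w: "w f \<in> V" "A (w f) = w f" "B (w f) = w f" "T (w f) = w f \<or> T (w f) = - w f"
    if "f \<in> BU" for f
  proof -
    have hf: "h f \<in> BZ" using that h(2) by blast
    show "w f \<in> V" "A (w f) = w f" "B (w f) = w f"
      using f'(1-3)[OF that] inZ[OF hf] subspace_V by (simp_all add: w_def lins subspace_add)
    show "T (w f) = w f \<or> T (w f) = - w f"
      using f'(5,6)[OF that] TZ[OF hf] by (cases "T (h f) = h f") (auto simp: w_def lins)
  qed
  have NV: "N \<subseteq> V" using inZ inY w stable by (auto simp: N_def)
  have "span N = V"
  proof
    show "span N \<subseteq> V" using NV subspace_V by (rule span_minimal)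
    have base: "v \<in> span N" if "v \<in> N" for v using that by (rule span_base)
    have hw: "h f \<in> span N" "f \<in> span N" "C f \<in> span N" if f: "f \<in> BU" for f
    proof -
      have wN: "w f \<in> span N" "C (w f) \<in> span N" "C (C (w f)) \<in> span N"
        using f unfolding N_def by (intro span_base; blast)+
      have Ch: "C (h f) = h f" using inZ h(2) f by blast
      \<comment> \<open>Averaging over C isolates \<open>h f\<close>, because the orbit of
        \<open>f' f\<close> under C sums to zero; \<open>f' f\<close> and its translates then follow
        by subtraction.\<close>
      have "w f + C (w f) + C (C (w f)) = 3 *\<^sub>R h f + (f' f + C (f' f) + C (C (f' f)))"
        by (intro ext) (simp add: w_def lins Ch)
      then have "h f = (1/3) *\<^sub>R (w f + C (w f) + C (C (w f)))"
        using f'(4)[OF f] by simp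
      also have "\<dots> \<in> span N" by (intro span_scale span_add wN)
      finally show hN: "h f \<in> span N" .
      have f'N: "f' f \<in> span N" "C (f' f) \<in> span N"
        using span_diff[OF wN(1) hN] span_diff[OF wN(2) hN] by (simp_all add: w_def lins Ch)
      have CC: "C (C f) = - f - C f"
        using inU[OF f] by (auto simp: fun_eq_iff algebra_simps) (metis add.assoc add_eq_0_iff)
      show "f \<in> span N" "C f \<in> span N"
      proof -
        have "f \<in> span N \<and> C f \<in> span N"
        proof (cases "T (h f) = h f")
          case True then show ?thesis using f'N by (simp add: f'_def)
        next
          case False
          then have g: "f' f = C f - C (C f)" "C (f' f) = C (C f) - f"
            by (simp_all add: f'_def lins rel)
          \<comment> \<open>With C^2 f = - f - C f one has \<open>f' f\<close> = f + 2 C f and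
            \<open>C (f' f)\<close> = - 2 f - C f; the coefficients invert this system.\<close>
          have "(-1/3) *\<^sub>R (f' f + 2 *\<^sub>R C (f' f)) \<in> span N" "(1/3) *\<^sub>R (2 *\<^sub>R f' f + C (f' f)) \<in> span N"
            by (intro span_scale span_add f'N)+
          moreover have "(-1/3) *\<^sub>R (f' f + 2 *\<^sub>R C (f' f)) = f" "(1/3) *\<^sub>R (2 *\<^sub>R f' f + C (f' f)) = C f"
            unfolding g(1) lins rel(4) CC by (auto intro!: ext simp: field_simps)
          ultimately show ?thesis by simp
        qed
        then show "f \<in> span N" "C f \<in> span N" by auto
      qed
    qed
    have Z: "Zs \<subseteq> span N"
    proof -
      have "v \<in> span N" if "v \<in> BZ" for v
        using that hw(1) base[of v] by (cases "v \<in> h ` BU") (auto simp: N_def)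
      then show ?thesis unfolding sp(1)[symmetric] by (intro span_minimal) auto
    qed
    have U: "Us \<subseteq> span N"
      unfolding sp(2)[symmetric] by (rule span_minimal) (auto intro: hw)
    have CU: "C v \<in> span N" if "v \<in> Us" for v
    proof -
      have "C v \<in> span (C ` BU)" using that sp(2) linear_span_image[OF lin(3)] by blast
      also have "\<dots> \<subseteq> span N" by (rule span_minimal) (auto intro: hw)
      finally show ?thesis .
    qed
    have Y: "v \<in> span N" "C v \<in> span N" "C (C v) \<in> span N" if "v \<in> Ys" for v
    proof -
      have "v \<in> span BY" "C v \<in> span (C ` BY)" "C (C v) \<in> span (C ` C ` BY)"
        using that sp(3) linear_span_image[OF lin(3)] by blast+
      moreover have "BY \<subseteq> N" "C ` BY \<subseteq> N" "C ` C ` BY \<subseteq> N" by (auto simp: N_def)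
      ultimately show "v \<in> span N" "C v \<in> span N" "C (C v) \<in> span N"
        using span_mono by blast+
    qed
    show "V \<subseteq> span N"
    proof
      fix v assume v: "v \<in> V"
      show "v \<in> span N"
        by (subst decomposition[OF v], intro span_add)
          (use proj_in v stable Z U CU Y in auto)
    qed
  qed
  then obtain N' where N': "N' \<subseteq> N" "finite N'" "independent N'" "span N' = V"
    using finite_basis[OF NV] by metis
  have "frame V N' (\<lambda>b. b) (\<lambda>b v. representation N' v b)"
    using frame_independent[OF N'(2,3)] N'(4) by simp
  \<comment> \<open>The trace of the identity serves as the dimension. Independence of N is not
    checked by hand: N spans V and has at most dim V elements, so the basis N' extracted from it is
    all of N.\<close>
  from frame_trace_unique[OF this fr' linear_id]
  have "real (card N') = real (card BZ) + 2 * card BU + 3 * card BY"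
    using dim N' by (simp add: real_vector.representation_basis)
  then have cN': "card N' = card BZ + 2 * card BU + 3 * card BY" by linarith
  have "card N \<le> card (BZ - h ` BU) + (card BU + card BU + card BU) + (card BY + card BY + card BY)"
    unfolding N_def
    by (intro order_trans[OF card_Un_le] add_mono order_refl)
      (auto intro!: card_image_le order_trans[OF card_image_le] simp: fin)
  also have "card (BZ - h ` BU) = card BZ - card BU"
    using h fin by (simp add: card_Diff_subset card_image)
  finally have "card N \<le> card N'" using cN' \<open>card BU \<le> card BZ\<close> by linarith
  then have "N' = N" using N'(1) finN by (simp add: card_seteq)
  have TC: "T (C v) = C (C (T v))" "T (C (C v)) = C (T v)" for v by (simp_all add: rel)
  have "g b \<in> N \<or> - g b \<in> N" if "g \<in> {A, B, C, T}" "b \<in> N" for g b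
  proof -
    consider (z) "b \<in> BZ - h ` BU" | (w) v where "v \<in> w ` BU" "b \<in> {v, C v, C (C v)}"
      | (y) v where "v \<in> BY" "b \<in> {v, C v, C (C v)}"
      using \<open>b \<in> N\<close> unfolding N_def by blast
    then show ?thesis
    proof cases
      case z
      then show ?thesis using inZ[of b] TZ[of b] \<open>g \<in> _\<close> \<open>b \<in> N\<close> by auto
    next
      case w
      then have v: "A v = v" "B v = v" "T v = v \<or> T v = - v" using \<open>\<And>f. f \<in> BU \<Longrightarrow> A (w f) = w f\<close>
         \<open>\<And>f. f \<in> BU \<Longrightarrow> B (w f) = w f\<close> \<open>\<And>f. f \<in> BU \<Longrightarrow> T (w f) = w f \<or> T (w f) = - w f\<close> by auto
      have N: "v \<in> N" "C v \<in> N" "C (C v) \<in> N" using w unfolding N_def by blast+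
      show ?thesis using v N ABC[of v] ABC[of "C v"] \<open>g \<in> _\<close> w(2) by (auto simp: TC rel(4) lins)
    next
      case y
      have v: "A v = v" "B v = - v" "T v = v \<or> T v = - v" using inY TY y by auto
      have N: "v \<in> N" "C v \<in> N" "C (C v) \<in> N" using y unfolding N_def by blast+
      show ?thesis using v N character_translates[OF v(1,2)] \<open>g \<in> _\<close> y(2) by (auto simp: TC rel(4) lins)
    qed
  qed
  then show ?thesis using N' \<open>N' = N\<close> by blast
qed

end

section \<open>A trace criterion for signed bases\<close>

lemma all_4: "(\<forall>i::4. P i) \<longleftrightarrow> P 0 \<and> P 1 \<and> P 2 \<and> P 3"
proof -
  \<comment> \<open>\<open>exhaust_4\<close> lists 1, 2, 3 and 4, and numerals of this type are read
    modulo 4.\<close>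
  have "(4::4) = 0" by simp
  then show ?thesis by (metis (full_types) exhaust_4)
qed

lemma UNIV_4': "(UNIV :: 4 set) = {0, 1, 2, 3}"
  by (rule set_eqI) (use all_4[of "\<lambda>i. i \<in> {0, 1, 2, 3}"] in auto)

lemma sum_4': "(\<Sum>i\<in>UNIV. f i) = f 0 + f 1 + f 2 + f (3::4)"
  unfolding UNIV_4' by (simp add: ac_simps)

lemma act_act: "act \<pi> (act \<sigma> f) = act (\<pi> \<circ> \<sigma>) f"
  by (simp add: act_def fun_eq_iff o_def)

lemma act_id: "act id f = f"
  by (simp add: act_def fun_eq_iff)

lemma linear_act: "linear (act \<pi>)"
  by (rule linearI) (auto simp: act_def fun_eq_iff)

definition cyc :: "4 \<Rightarrow> 4" where "cyc = Transposition.transpose 1 2 \<circ> Transposition.transpose 2 3"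

lemma cyc_simps [simp]: "cyc 0 = 0" "cyc 1 = 2" "cyc 2 = 3" "cyc 3 = 1"
  by (simp_all add: cyc_def Transposition.transpose_def)

lemma cyc_cyc_cyc [simp]: "cyc (cyc (cyc i)) = i"
  using all_4[of "\<lambda>i. cyc (cyc (cyc i)) = i"] by simp

lemma cyc_permutes: "cyc permutes UNIV"
  unfolding cyc_def by (intro permutes_compose permutes_swap_id) auto

lemma inv_basis_iff_independent:
  "inv_basis_up_to_sign S \<longleftrightarrow> (\<exists>B. finite B \<and> independent B \<and> span B = S \<and>
    (\<forall>\<pi>. \<pi> permutes UNIV \<longrightarrow> (\<forall>b\<in>B. act \<pi> b \<in> B \<or> - act \<pi> b \<in> B)))"
proof -
  have s: "(\<lambda>x vs. \<Sum>b\<in>B. c b * b x vs) = (\<Sum>b\<in>B. c b *\<^sub>R b)" for B c and b :: form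
    by (auto simp: fun_eq_iff)
  have z: "(\<lambda>x vs. 0) = (0 :: form)" by (auto simp: fun_eq_iff)
  have m: "(\<lambda>x vs. - f x vs) = - f" for f :: form by (auto simp: fun_eq_iff)
  have sp: "span B = {\<Sum>b\<in>B. c b *\<^sub>R b | c. True}" if "finite B" for B :: "form set"
    using real_vector.span_finite[OF that] by auto
  have ind: "independent B \<longleftrightarrow> (\<forall>c. (\<Sum>b\<in>B. c b *\<^sub>R b) = 0 \<longrightarrow> (\<forall>b\<in>B. c b = 0))"
    if "finite B" for B :: "form set"
    using real_vector.dependent_finite[OF that] by auto
  have "(finite B \<and> B \<subseteq> S \<and> (\<forall>c. (\<Sum>b\<in>B. c b *\<^sub>R b) = 0 \<longrightarrow> (\<forall>b\<in>B. c b = 0)) \<and>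
      S = {\<Sum>b\<in>B. c b *\<^sub>R b | c. True} \<and> R) \<longleftrightarrow> (finite B \<and> independent B \<and> span B = S \<and> R)"
    for B and R :: bool
  proof (cases "finite B")
    case True
    show ?thesis
      unfolding ind[OF True, symmetric] sp[OF True, symmetric] using span_superset[of B] by blast
  qed simp
  then show ?thesis unfolding inv_basis_up_to_sign_def s z m by (simp only:)
qed

text \<open>The permutations that preserve B up to sign are closed under composition, so it suffices
  to reach all transpositions: (0 1) is a product of two of the given permutations, and conjugation
  by \<open>cyc\<close> produces the others from (0 1) and (2 3).\<close>

lemma signed_closed_all:
  fixes B :: "form set"
  assumes gen: "\<And>\<pi>. \<pi> \<in> {Transposition.transpose 0 1 \<circ> Transposition.transpose 2 3, Transposition.transpose 0 2 \<circ> Transposition.transpose 1 3, cyc, Transposition.transpose 2 3} \<Longrightarrow>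
      \<forall>b\<in>B. act \<pi> b \<in> B \<or> - act \<pi> b \<in> B"
    and "\<pi> permutes UNIV"
  shows "\<forall>b\<in>B. act \<pi> b \<in> B \<or> - act \<pi> b \<in> B"
proof -
  define P where "P \<pi> \<longleftrightarrow> (\<forall>b\<in>B. act \<pi> b \<in> B \<or> - act \<pi> b \<in> B)" for \<pi>
  have comp: "P (\<pi> \<circ> \<sigma>)" if "P \<pi>" "P \<sigma>" for \<pi> \<sigma>
  proof -
    have "act (\<pi> \<circ> \<sigma>) b \<in> B \<or> - act (\<pi> \<circ> \<sigma>) b \<in> B" if "b \<in> B" for b
    proof -
      have *: "act (\<pi> \<circ> \<sigma>) b = act \<pi> (act \<sigma> b)" "act (\<pi> \<circ> \<sigma>) b = - act \<pi> (- act \<sigma> b)"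
        by (simp_all add: act_act[symmetric] linear_neg[OF linear_act])
      have "act \<sigma> b \<in> B \<or> - act \<sigma> b \<in> B" using \<open>P \<sigma>\<close> that by (simp add: P_def)
      then show ?thesis using \<open>P \<pi>\<close> * unfolding P_def by (metis add.inverse_inverse)
    qed
    then show ?thesis by (simp add: P_def)
  qed
  let ?a = "Transposition.transpose 0 1 \<circ> Transposition.transpose 2 3 :: 4 \<Rightarrow> 4"
  let ?t = "Transposition.transpose 2 3 :: 4 \<Rightarrow> 4"
  have g: "P ?a" "P cyc" "P ?t" using gen by (simp_all add: P_def)
  have cc: "P (cyc \<circ> cyc)" using comp g by blast
  have t01: "P (Transposition.transpose 0 1)"
  proof -
    have "?a \<circ> ?t = Transposition.transpose 0 1" by (auto simp: fun_eq_iff)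
    then show ?thesis using comp[OF g(1,3)] by simp
  qed
  \<comment> \<open>\<open>cyc \<circ> cyc\<close> is the inverse of \<open>cyc\<close>, so this is
    conjugation.\<close>
  have conj: "P (cyc \<circ> (Transposition.transpose i j \<circ> (cyc \<circ> cyc)))" if "P (Transposition.transpose i j)" for i j
    using comp g cc that by blast
  have c1: "cyc \<circ> (Transposition.transpose i j \<circ> (cyc \<circ> cyc)) = Transposition.transpose (cyc i) (cyc j)" for i j
  proof
    fix k
    have "cyc x = y \<longleftrightarrow> x = cyc (cyc y)" for x y by auto
    then show "(cyc \<circ> (Transposition.transpose i j \<circ> (cyc \<circ> cyc))) k = Transposition.transpose (cyc i) (cyc j) k"
      by (auto simp: Transposition.transpose_def)
  qed
  have cj: "P (Transposition.transpose (cyc i) (cyc j))" if "P (Transposition.transpose i j)" for i j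
    using conj[OF that] c1 by simp
  have "P (Transposition.transpose 0 2)" using cj[OF t01] by simp
  moreover from cj[OF this] have "P (Transposition.transpose 0 3)" by simp
  moreover have "P (Transposition.transpose 3 1)" using cj[OF g(3)] by simp
  moreover from cj[OF this] have "P (Transposition.transpose 1 2)" by simp
  moreover have "P id" by (simp add: P_def act_id)
  ultimately have "\<forall>i j. P (Transposition.transpose i j)"
    using t01 g(3) unfolding all_4 by (simp add: Transposition.transpose_commute)
  then have tr: "P (Transposition.transpose i j)" for i j by blast
  from assms(2) finite_class.finite_UNIV have "P \<pi>"
  proof (induction \<pi> rule: permutes_induct)
    case id show ?case by (fact \<open>P id\<close>)
  next
    case (swap i j p) then show ?case using comp tr by blast
  qed
  then show ?thesis by (simp add: P_def)
qed

lemma inv_basis_iff_trace: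
  assumes fr: "frame V I e \<epsilon>"
    and stable: "\<And>\<pi> v. \<pi> permutes UNIV \<Longrightarrow> v \<in> V \<Longrightarrow> act \<pi> v \<in> V"
  shows "inv_basis_up_to_sign V \<longleftrightarrow> 0 \<le> (\<Sum>a\<in>I. \<epsilon> a (act cyc (e a)))"
proof
  assume "inv_basis_up_to_sign V"
  then obtain B where B: "finite B" "independent B" "span B = V"
    and sg: "\<And>b. b \<in> B \<Longrightarrow> act cyc b \<in> B \<or> - act cyc b \<in> B"
    unfolding inv_basis_iff_independent using cyc_permutes by blast
  have "frame V B (\<lambda>b. b) (\<lambda>b v. representation B v b)"
    using frame_independent[OF B(1,2)] B(3) by simp
  from frame_trace_unique[OF fr this linear_act stable[OF cyc_permutes]]
  have "(\<Sum>a\<in>I. \<epsilon> a (act cyc (e a))) = (\<Sum>b\<in>B. representation B (act cyc b) b)" .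
  also have "\<dots> \<ge> 0"
  proof (rule sum_nonneg)
    fix b assume b: "b \<in> B"
    have c3: "act cyc (act cyc (act cyc b)) = b"
      by (simp add: act_act o_def act_id[unfolded id_def])
    show "0 \<le> representation B (act cyc b) b"
    proof (cases "act cyc b \<in> B")
      case True
      then show ?thesis using B by (simp add: real_vector.representation_basis)
    next
      case False
      then have m: "- act cyc b \<in> B" using sg b by blast
      have "representation B (act cyc b) b = - representation B (- act cyc b) b"
        using real_vector.representation_neg[OF B(2), of "- act cyc b"] m span_base by fastforce
      moreover have "- act cyc b \<noteq> b"
      proof
        assume *: "- act cyc b = b"
        then have "act cyc b = - b" by (metis add.inverse_inverse)
        then have "b = - b" using c3 by (simp add: linear_neg[OF linear_act])
        then have "b = 0" by (auto simp: fun_eq_iff)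
        then show False using B(2) b real_vector.dependent_zero by blast
      qed
      ultimately show ?thesis using B m by (simp add: real_vector.representation_basis)
    qed
  qed
  finally show "0 \<le> (\<Sum>a\<in>I. \<epsilon> a (act cyc (e a)))" .
next
  assume tr: "0 \<le> (\<Sum>a\<in>I. \<epsilon> a (act cyc (e a)))"
  define a b t :: "4 \<Rightarrow> 4" where "a = Transposition.transpose 0 1 \<circ> Transposition.transpose 2 3"
    and "b = Transposition.transpose 0 2 \<circ> Transposition.transpose 1 3" and "t = Transposition.transpose 2 3"
  have perm: "a permutes UNIV" "b permutes UNIV" "t permutes UNIV"
    unfolding a_def b_def t_def by (intro permutes_compose permutes_swap_id; simp)+
  have abt: "a 0 = 1" "a 1 = 0" "a 2 = 3" "a 3 = 2" "b 0 = 2" "b 1 = 3" "b 2 = 0" "b 3 = 1"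
    "t 0 = 0" "t 1 = 1" "t 2 = 3" "t 3 = 2"
    by (simp_all add: a_def b_def t_def Transposition.transpose_def)
  have "\<forall>v\<in>V. v \<in> span (e ` I)"
    using fr unfolding frame_def by (metis (no_types, lifting) imageI span_base span_scale span_sum)
  then have fd: "\<exists>S. finite S \<and> V \<subseteq> span S"
    using fr unfolding frame_def by (intro exI[of _ "e ` I"]) auto
  \<comment> \<open>By \<open>act_act\<close> the relations of the locale become equations between
    permutations, which are checked at the four points.\<close>
  have rels: "a \<circ> a = id" "b \<circ> b = id" "b \<circ> a = a \<circ> b" "cyc \<circ> (cyc \<circ> cyc) = id" "t \<circ> t = id"
    "cyc \<circ> a = b \<circ> cyc" "cyc \<circ> b = a \<circ> (b \<circ> cyc)" "t \<circ> a = a \<circ> t" "t \<circ> b = a \<circ> (b \<circ> t)"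
    "t \<circ> cyc = cyc \<circ> (cyc \<circ> t)"
    unfolding fun_eq_iff all_4 by (simp_all add: abt)
  have sV: "subspace V" using fr by (simp add: frame_def)
  have R: "act a (act a v) = v" "act b (act b v) = v" "act b (act a v) = act a (act b v)"
    "act cyc (act cyc (act cyc v)) = v" "act t (act t v) = v" "act cyc (act a v) = act b (act cyc v)"
    "act cyc (act b v) = act a (act b (act cyc v))" "act t (act a v) = act a (act t v)"
    "act t (act b v) = act a (act b (act t v))" "act t (act cyc v) = act cyc (act cyc (act t v))" for v
    by (simp_all only: act_act rels act_id)
  have "s4_rep V (act a) (act b) (act cyc) (act t)"
    by (rule s4_rep.intro) (rule sV fd linear_act stable[OF perm(1)] stable[OF perm(2)]
        stable[OF cyc_permutes] stable[OF perm(3)] R; assumption?)+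
  then interpret s4_rep V "act a" "act b" "act cyc" "act t" .
  obtain N where N: "finite N" "independent N" "span N = V"
    and sg: "\<forall>g\<in>{act a, act b, act cyc, act t}. \<forall>b\<in>N. g b \<in> N \<or> - g b \<in> N"
    using signed_basis_exists[OF fr tr] by blast
  have "\<forall>b\<in>N. act \<pi> b \<in> N \<or> - act \<pi> b \<in> N" if "\<pi> permutes UNIV" for \<pi>
    by (rule signed_closed_all[OF _ that]) (use sg in \<open>auto simp: a_def b_def t_def\<close>)
  then show "inv_basis_up_to_sign V"
    unfolding inv_basis_iff_independent using N by blast
qed

section \<open>The criterion for explicitly indexed bases\<close>

lemma span_family_coords:
  assumes "finite A" "v \<in> span (e ` A)"
  shows "\<exists>k. v = (\<Sum>a\<in>A. k a *\<^sub>R e a)"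
  using assms(2)
proof (induction rule: span_induct_alt)
  case base show ?case by (intro exI[of _ "\<lambda>_. 0"]) simp
next
  case (step c x y)
  then obtain a k where a: "a \<in> A" "x = e a" and k: "y = (\<Sum>a\<in>A. k a *\<^sub>R e a)" by blast
  have "c *\<^sub>R x + y = (\<Sum>i\<in>A. (k i + (if i = a then c else 0)) *\<^sub>R e i)"
    using a assms(1) by (simp add: k scaleR_add_left sum.distrib if_distrib[of "\<lambda>r. r *\<^sub>R _"] cong: if_cong)
  then show ?case by (intro exI[of _ "\<lambda>i. k i + (if i = a then c else 0)"])
qed

lemma inv_basis_iff_family:
  fixes e :: "'i \<Rightarrow> form"
  assumes fin: "finite A" and V: "span (e ` A) = V"
    and indep: "\<And>k. (\<Sum>a\<in>A. k a *\<^sub>R e a) = 0 \<Longrightarrow> \<forall>a\<in>A. k a = 0"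
    and stable: "\<And>\<pi> v. \<pi> permutes UNIV \<Longrightarrow> v \<in> V \<Longrightarrow> act \<pi> v \<in> V"
    and M: "\<And>a. a \<in> A \<Longrightarrow> act cyc (e a) = (\<Sum>b\<in>A. M b a *\<^sub>R e b)"
  shows "inv_basis_up_to_sign V \<longleftrightarrow> 0 \<le> (\<Sum>a\<in>A. M a a)"
proof -
  \<comment> \<open>Coefficients are chosen arbitrarily; independence makes them unique, and
    uniqueness makes them linear.\<close>
  define coords where "coords v = (SOME k. v = (\<Sum>a\<in>A. k a *\<^sub>R e a))" for v
  have uniq: "coords (\<Sum>a\<in>A. k a *\<^sub>R e a) a = k a" if "a \<in> A" for k a
  proof -
    have "(\<Sum>a\<in>A. k a *\<^sub>R e a) = (\<Sum>a\<in>A. coords (\<Sum>a\<in>A. k a *\<^sub>R e a) a *\<^sub>R e a)"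
      unfolding coords_def[of "\<Sum>a\<in>A. k a *\<^sub>R e a"]
      by (rule someI[of "\<lambda>l. (\<Sum>a\<in>A. k a *\<^sub>R e a) = (\<Sum>a\<in>A. l a *\<^sub>R e a)" k]) (rule refl)
    then have "(\<Sum>a\<in>A. (coords (\<Sum>a\<in>A. k a *\<^sub>R e a) a - k a) *\<^sub>R e a) = 0"
      by (simp add: scaleR_diff_left sum_subtractf)
    from indep[OF this] that show ?thesis by simp
  qed
  have rep: "\<exists>k. v = (\<Sum>a\<in>A. k a *\<^sub>R e a)" if "v \<in> V" for v
    using span_family_coords[OF fin] that V by blast
  have "frame V A e (\<lambda>a v. coords v a)"
    unfolding frame_def
  proof (intro conjI ballI allI)
    show "finite A" "subspace V" "e ` A \<subseteq> V" using fin V span_superset[of "e ` A"] by auto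
    show "v = (\<Sum>a\<in>A. coords v a *\<^sub>R e a)" if "v \<in> V" for v
      unfolding coords_def using someI_ex[OF rep[OF that]] .
    fix a u v assume a: "a \<in> A" and "u \<in> V" "v \<in> V"
    from rep[OF \<open>u \<in> V\<close>] obtain k where k: "u = (\<Sum>a\<in>A. k a *\<^sub>R e a)" ..
    from rep[OF \<open>v \<in> V\<close>] obtain l where l: "v = (\<Sum>a\<in>A. l a *\<^sub>R e a)" ..
    note kl = k l
    have "u + v = (\<Sum>a\<in>A. (k a + l a) *\<^sub>R e a)"
      by (simp add: kl scaleR_add_left sum.distrib)
    then show "coords (u + v) a = coords u a + coords v a"
      using uniq[OF a, of k] uniq[OF a, of l] uniq[OF a, of "\<lambda>a. k a + l a"] by (simp add: kl)
  next
    fix a c v assume a: "a \<in> A" and "v \<in> V"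
    from rep[OF \<open>v \<in> V\<close>] obtain k where k: "v = (\<Sum>a\<in>A. k a *\<^sub>R e a)" ..
    have "c *\<^sub>R v = (\<Sum>a\<in>A. (c * k a) *\<^sub>R e a)"
      by (simp add: k scaleR_sum_right)
    then show "coords (c *\<^sub>R v) a = c * coords v a"
      using uniq[OF a, of k] uniq[OF a, of "\<lambda>a. c * k a"] by (simp add: k)
  qed
  from inv_basis_iff_trace[OF this stable] show ?thesis
    using M uniq by simp
qed

text \<open>A permutation matrix has nonnegative trace. Only \<open>cyc\<close> has to permute the
  family, so its members may treat the index 0 differently from 1, 2, 3.\<close>

lemma inv_basis_permuted_family:
  fixes e :: "'i \<Rightarrow> form"
  assumes "finite A" "span (e ` A) = V"
    and "\<And>k. (\<Sum>a\<in>A. k a *\<^sub>R e a) = 0 \<Longrightarrow> \<forall>a\<in>A. k a = 0"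
    and "\<And>\<pi> v. \<pi> permutes UNIV \<Longrightarrow> v \<in> V \<Longrightarrow> act \<pi> v \<in> V"
    and \<sigma>: "\<And>a. a \<in> A \<Longrightarrow> \<sigma> a \<in> A \<and> act cyc (e a) = e (\<sigma> a)"
  shows "inv_basis_up_to_sign V"
proof -
  have "act cyc (e a) = (\<Sum>b\<in>A. (if b = \<sigma> a then 1 else 0) *\<^sub>R e b)" if "a \<in> A" for a
    using \<sigma>[OF that] assms(1) by (simp add: if_distrib[of "\<lambda>r. r *\<^sub>R _"] cong: if_cong)
  from inv_basis_iff_family[OF assms(1-4) this] show ?thesis
    by (simp add: sum_nonneg)
qed

section \<open>Homogeneous polynomials on the simplex\<close>

definition mnm :: "(4 \<Rightarrow> nat) \<Rightarrow> real^4 \<Rightarrow> real" where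
  "mnm \<alpha> x = (\<Prod>i\<in>UNIV. (x$i) ^ \<alpha> i)"

text \<open>Degrees are integers so that a shifted degree such as r - 3 gives the empty set when it
  is negative, instead of being cut off at 0.\<close>

definition degs :: "int \<Rightarrow> (4 \<Rightarrow> nat) set" where
  "degs z = {\<alpha>. int (\<Sum>i\<in>UNIV. \<alpha> i) = z}"

definition incr :: "4 \<Rightarrow> (4 \<Rightarrow> nat) \<Rightarrow> 4 \<Rightarrow> nat" where
  "incr i \<alpha> = \<alpha>(i := Suc (\<alpha> i))"

lemma mnm_4: "mnm \<alpha> x = x$0 ^ \<alpha> 0 * x$1 ^ \<alpha> 1 * x$2 ^ \<alpha> 2 * x$3 ^ \<alpha> 3"
  unfolding mnm_def UNIV_4' by (simp add: ac_simps)

lemma incr_apply: "incr i \<alpha> j = (if j = i then Suc (\<alpha> i) else \<alpha> j)"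
  by (simp add: incr_def)

lemma mnm_incr: "mnm (incr i \<alpha>) x = x$i * mnm \<alpha> x"
proof -
  have "mnm (incr i \<alpha>) x = (x$i) ^ Suc (\<alpha> i) * (\<Prod>j\<in>UNIV - {i}. (x$j) ^ incr i \<alpha> j)"
    unfolding mnm_def by (subst prod.remove[of UNIV i]) (auto simp: incr_apply)
  also have "(\<Prod>j\<in>UNIV - {i}. (x$j) ^ incr i \<alpha> j) = (\<Prod>j\<in>UNIV - {i}. (x$j) ^ \<alpha> j)"
    by (rule prod.cong) (auto simp: incr_apply)
  also have "(x$i) ^ Suc (\<alpha> i) * \<dots> = x$i * mnm \<alpha> x"
    unfolding mnm_def by (subst prod.remove[of UNIV i]) auto
  finally show ?thesis .
qed

lemma sum_incr: "(\<Sum>j\<in>UNIV. incr i \<alpha> j) = Suc (\<Sum>j\<in>UNIV. \<alpha> j)"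
proof -
  have "(\<Sum>j\<in>UNIV. incr i \<alpha> j) = (\<Sum>j\<in>UNIV. \<alpha> j + (if j = i then 1 else 0))"
    by (rule sum.cong) (auto simp: incr_apply)
  then show ?thesis by (simp add: sum.distrib)
qed

lemma incr_degs: "incr i \<alpha> \<in> degs z \<longleftrightarrow> \<alpha> \<in> degs (z - 1)"
  by (auto simp: degs_def sum_incr simp del: of_nat_sum)

lemma inj_incr: "inj (incr i)"
proof (rule injI, rule ext)
  fix x y j assume "incr i x = incr i y"
  then have "incr i x j = incr i y j" by simp
  then show "x j = y j" by (auto simp: incr_apply split: if_splits)
qed

lemma ex_incr: "\<alpha> i \<noteq> 0 \<Longrightarrow> \<exists>\<beta>. \<alpha> = incr i \<beta>"
  by (rule exI[of _ "\<alpha>(i := \<alpha> i - 1)"]) (auto simp: incr_apply fun_eq_iff)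

lemma degs_image_incr: "{\<alpha> \<in> degs z. \<alpha> i \<noteq> 0} = incr i ` degs (z - 1)"
proof -
  have "\<alpha> \<in> incr i ` degs (z - 1)" if "\<alpha> \<in> degs z" "\<alpha> i \<noteq> 0" for \<alpha>
    using ex_incr[of \<alpha> i] that by (auto simp: incr_degs)
  then show ?thesis by (auto simp: incr_degs incr_apply)
qed

lemma finite_degs: "finite (degs z)"
proof (rule finite_subset)
  show "degs z \<subseteq> PiE UNIV (\<lambda>_. {..nat z})"
  proof
    fix \<alpha> assume "\<alpha> \<in> degs z"
    then have "\<alpha> i \<le> nat z" for i
      using member_le_sum[of i UNIV \<alpha>] by (auto simp: degs_def simp del: of_nat_sum)
    then show "\<alpha> \<in> PiE UNIV (\<lambda>_. {..nat z})" by auto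
  qed
qed (simp add: finite_PiE)

lemma finite_exps_upto: "finite (exps_upto z)"
proof -
  have "exps_upto z = (\<Union>n\<in>{0..z}. degs n)" by (auto simp: exps_upto_def degs_def sum_nonneg)
  then show ?thesis by (simp add: finite_degs)
qed

lemma mnm_scale:
  assumes "\<alpha> \<in> degs z"
  shows "mnm \<alpha> (c *\<^sub>R x) = c ^ nat z * mnm \<alpha> x"
proof -
  have "mnm \<alpha> (c *\<^sub>R x) = c ^ (\<Sum>i\<in>UNIV. \<alpha> i) * mnm \<alpha> x"
    unfolding mnm_def by (simp add: power_mult_distrib prod.distrib power_sum)
  moreover have "(\<Sum>i\<in>UNIV. \<alpha> i) = nat z" using assms by (auto simp: degs_def simp del: of_nat_sum)
  ultimately show ?thesis by simp
qed

lemma radix_inj: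
  fixes a b a' b' N :: nat
  assumes "a + N * b = a' + N * b'" "a < N" "a' < N"
  shows "a = a' \<and> b = b'"
proof -
  have "(a + N * b) mod N = a" "(a + N * b) div N = b" "(a' + N * b') mod N = a'" "(a' + N * b') div N = b'"
    using assms(2,3) by simp_all
  then show ?thesis using assms(1) by metis
qed

text \<open>Kronecker substitution: on the curve with coordinates t to the powers 1, N, N^2, N^3
  distinct monomials of degree below N become distinct powers of t.\<close>

lemma mnm_independent_pos:
  assumes zero: "\<And>y :: real^4. (\<And>i. 0 < y$i) \<Longrightarrow> (\<Sum>\<alpha>\<in>degs z. k \<alpha> * mnm \<alpha> y) = 0"
    and \<beta>: "\<beta> \<in> degs z"
  shows "k \<beta> = 0"
proof -
  \<comment> \<open>No exponent exceeds the total degree, so every exponent is a valid digit in base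
    N.\<close>
  define N where "N = Suc (nat z)"
  define code where "code \<alpha> = \<alpha> 0 + N * (\<alpha> 1 + N * (\<alpha> 2 + N * \<alpha> 3))" for \<alpha> :: "4 \<Rightarrow> nat"
  have bound: "\<alpha> i < N" if "\<alpha> \<in> degs z" for \<alpha> i
    using that member_le_sum[of i UNIV \<alpha>] by (auto simp: degs_def N_def simp del: of_nat_sum)
  have inj: "\<alpha> = \<gamma>" if "\<alpha> \<in> degs z" "\<gamma> \<in> degs z" "code \<alpha> = code \<gamma>" for \<alpha> \<gamma>
  proof -
    note b = bound[OF that(1)] bound[OF that(2)]
    have 0: "\<alpha> 0 = \<gamma> 0" and r: "\<alpha> 1 + N * (\<alpha> 2 + N * \<alpha> 3) = \<gamma> 1 + N * (\<gamma> 2 + N * \<gamma> 3)"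
      using radix_inj[OF that(3)[unfolded code_def] b] by auto
    have 1: "\<alpha> 1 = \<gamma> 1" and r: "\<alpha> 2 + N * \<alpha> 3 = \<gamma> 2 + N * \<gamma> 3"
      using radix_inj[OF r b] by auto
    have "\<alpha> 2 = \<gamma> 2" "\<alpha> 3 = \<gamma> 3" using radix_inj[OF r b] by auto
    then show ?thesis using 0 1 unfolding fun_eq_iff all_4 by simp
  qed
  define p where "p = (\<Sum>\<alpha>\<in>degs z. monom (k \<alpha>) (code \<alpha>))"
  have "poly p t = 0" if t: "t > 0" for t
  proof -
    define y :: "real^4" where
      "y = (\<chi> i. if i = 0 then t else if i = 1 then t ^ N else if i = 2 then t ^ (N * N) else t ^ (N * N * N))"
    have "mnm \<alpha> y = t ^ code \<alpha>" for \<alpha>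
      by (simp add: mnm_4 y_def code_def algebra_simps flip: power_mult power_add)
    then have "poly p t = (\<Sum>\<alpha>\<in>degs z. k \<alpha> * mnm \<alpha> y)"
      by (simp add: p_def poly_sum poly_monom)
    also have "\<dots> = 0" by (rule zero) (use t in \<open>auto simp: y_def\<close>)
    finally show ?thesis .
  qed
  then have "{0<..} \<subseteq> {t. poly p t = 0}" by auto
  then have "infinite {t. poly p t = 0}"
    using infinite_Ioi[of "0::real"] finite_subset by blast
  then have "p = 0" using poly_roots_finite by blast
  then have "0 = coeff p (code \<beta>)" by simp
  also have "\<dots> = (\<Sum>\<alpha>\<in>degs z. if \<alpha> = \<beta> then k \<alpha> else 0)"
    unfolding p_def coeff_sum by (rule sum.cong) (use inj \<beta> in auto)
  also have "\<dots> = k \<beta>" using \<beta> finite_degs by simp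
  finally show ?thesis by simp
qed

text \<open>All monomials here have the same degree, so vanishing on the open simplex extends by
  scaling to the open orthant.\<close>

lemma mnm_independent:
  assumes zero: "\<And>x. x \<in> simplex3 \<Longrightarrow> (\<And>i. 0 < x$i) \<Longrightarrow> (\<Sum>\<alpha>\<in>degs z. k \<alpha> * mnm \<alpha> x) = 0"
    and "\<beta> \<in> degs z"
  shows "k \<beta> = 0"
proof (rule mnm_independent_pos[OF _ assms(2)])
  fix y :: "real^4" assume y: "\<And>i. 0 < y$i"
  define S where "S = (\<Sum>i\<in>UNIV. y$i)"
  have S: "S > 0" unfolding S_def using y by (intro sum_pos) auto
  define x where "x = (1 / S) *\<^sub>R y"
  have "x \<in> simplex3" "\<And>i. 0 < x$i"
    using y S by (auto simp: simplex3_def x_def less_imp_le S_def simp flip: sum_divide_distrib)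
  then have "0 = (\<Sum>\<alpha>\<in>degs z. k \<alpha> * mnm \<alpha> x)" using zero by simp
  moreover have "y = S *\<^sub>R x" using S by (simp add: x_def)
  then have "(\<Sum>\<alpha>\<in>degs z. k \<alpha> * mnm \<alpha> y) = S ^ nat z * (\<Sum>\<alpha>\<in>degs z. k \<alpha> * mnm \<alpha> x)"
    by (simp add: mnm_scale sum_distrib_left mult.left_commute)
  ultimately show "(\<Sum>\<alpha>\<in>degs z. k \<alpha> * mnm \<alpha> y) = 0" by simp
qed

text \<open>On the face only monomials free of the i-th coordinate survive. They ignore that
  coordinate, so it may be given any positive value, which reduces the claim to the open
  orthant.\<close>

lemma mnm_independent_face:
  assumes zero: "\<And>x. x \<in> simplex3 \<Longrightarrow> x$i = 0 \<Longrightarrow> (\<And>j. j \<noteq> i \<Longrightarrow> 0 < x$j) \<Longrightarrow>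
      (\<Sum>\<alpha>\<in>degs z. k \<alpha> * mnm \<alpha> x) = 0"
    and \<beta>: "\<beta> \<in> degs z" "\<beta> i = 0"
  shows "k \<beta> = 0"
proof -
  define k' where "k' \<alpha> = (if \<alpha> i = 0 then k \<alpha> else 0)" for \<alpha>
  have "k' \<beta> = 0"
  proof (rule mnm_independent_pos[OF _ \<beta>(1)])
    fix y :: "real^4" assume y: "\<And>i. 0 < y$i"
    define y' where "y' = (\<chi> j. if j = i then 0 else y$j)"
    define S where "S = (\<Sum>j\<in>UNIV. y'$j)"
    obtain j :: 4 where j: "j \<noteq> i" by (metis zero_neq_one)
    have S: "S > 0" unfolding S_def
      by (rule sum_pos2[of _ j]) (use y j in \<open>auto simp: y'_def less_imp_le\<close>)
    define x where "x = (1 / S) *\<^sub>R y'"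
    have "x \<in> simplex3" "x$i = 0" "\<And>j. j \<noteq> i \<Longrightarrow> 0 < x$j"
      using y S by (auto simp: simplex3_def x_def less_imp_le S_def y'_def simp flip: sum_divide_distrib)
    then have z: "0 = (\<Sum>\<alpha>\<in>degs z. k \<alpha> * mnm \<alpha> x)" using zero by simp
    have "k' \<alpha> * mnm \<alpha> y = k \<alpha> * mnm \<alpha> y'" for \<alpha>
    proof (cases "\<alpha> i = 0")
      case True
      have "mnm \<alpha> y = mnm \<alpha> y'" unfolding mnm_def
        by (rule prod.cong) (use True in \<open>auto simp: y'_def\<close>)
      then show ?thesis using True by (simp add: k'_def)
    next
      case False
      then have "mnm \<alpha> y' = 0" unfolding mnm_def by (intro prod_zero) (auto simp: y'_def)
      then show ?thesis using False by (simp add: k'_def)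
    qed
    then have "(\<Sum>\<alpha>\<in>degs z. k' \<alpha> * mnm \<alpha> y) = (\<Sum>\<alpha>\<in>degs z. k \<alpha> * mnm \<alpha> y')" by simp
    also have "y' = S *\<^sub>R x" using S by (simp add: x_def)
    also have "(\<Sum>\<alpha>\<in>degs z. k \<alpha> * mnm \<alpha> (S *\<^sub>R x)) = S ^ nat z * (\<Sum>\<alpha>\<in>degs z. k \<alpha> * mnm \<alpha> x)"
      by (simp add: mnm_scale sum_distrib_left mult.left_commute)
    finally show "(\<Sum>\<alpha>\<in>degs z. k' \<alpha> * mnm \<alpha> y) = 0" using z by simp
  qed
  then show ?thesis using \<beta>(2) by (simp add: k'_def)
qed

definition hom :: "int \<Rightarrow> (real^4 \<Rightarrow> real) \<Rightarrow> bool" where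
  "hom z p \<longleftrightarrow> (\<exists>k. \<forall>x\<in>simplex3. p x = (\<Sum>\<alpha>\<in>degs z. k \<alpha> * mnm \<alpha> x))"

lemma hom_zero: "hom z (\<lambda>x. 0)"
  unfolding hom_def by (rule exI[of _ "\<lambda>_. 0"]) simp

lemma hom_add: "hom z p \<Longrightarrow> hom z q \<Longrightarrow> hom z (\<lambda>x. p x + q x)"
  unfolding hom_def
proof (elim exE)
  fix k l assume "\<forall>x\<in>simplex3. p x = (\<Sum>\<alpha>\<in>degs z. k \<alpha> * mnm \<alpha> x)"
    "\<forall>x\<in>simplex3. q x = (\<Sum>\<alpha>\<in>degs z. l \<alpha> * mnm \<alpha> x)"
  then show "\<exists>k. \<forall>x\<in>simplex3. p x + q x = (\<Sum>\<alpha>\<in>degs z. k \<alpha> * mnm \<alpha> x)"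
    by (intro exI[of _ "\<lambda>\<alpha>. k \<alpha> + l \<alpha>"]) (simp add: distrib_right sum.distrib)
qed

lemma hom_scale: "hom z p \<Longrightarrow> hom z (\<lambda>x. c * p x)"
  unfolding hom_def
proof (elim exE)
  fix k assume "\<forall>x\<in>simplex3. p x = (\<Sum>\<alpha>\<in>degs z. k \<alpha> * mnm \<alpha> x)"
  then show "\<exists>k. \<forall>x\<in>simplex3. c * p x = (\<Sum>\<alpha>\<in>degs z. k \<alpha> * mnm \<alpha> x)"
    by (intro exI[of _ "\<lambda>\<alpha>. c * k \<alpha>"]) (simp add: sum_distrib_left mult.assoc)
qed

lemma hom_sum: "(\<And>i. i \<in> I \<Longrightarrow> hom z (p i)) \<Longrightarrow> hom z (\<lambda>x. \<Sum>i\<in>I. p i x)"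
  by (induction I rule: infinite_finite_induct) (auto intro: hom_zero hom_add)

lemma hom_mnm: "\<alpha> \<in> degs z \<Longrightarrow> hom z (mnm \<alpha>)"
  unfolding hom_def
  by (rule exI[of _ "\<lambda>\<beta>. if \<beta> = \<alpha> then 1 else 0"])
    (simp add: finite_degs if_distrib[of "\<lambda>c. c * _"] cong: if_cong)

lemma hom_cong: "hom z p \<Longrightarrow> (\<And>x. x \<in> simplex3 \<Longrightarrow> p x = q x) \<Longrightarrow> hom z q"
  unfolding hom_def by auto

text \<open>Multiplying by the sum of the coordinates, which is 1 on the simplex, raises the degree
  by one; this is done n times.\<close>

lemma hom_mnm_le:
  assumes "int (\<Sum>i\<in>UNIV. \<alpha> i) + int n = z"
  shows "hom z (mnm \<alpha>)"
  using assms
proof (induction n arbitrary: \<alpha>)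
  case 0 then show ?case by (intro hom_mnm) (simp add: degs_def)
next
  case (Suc n)
  have "hom z (\<lambda>x. \<Sum>i\<in>UNIV. mnm (incr i \<alpha>) x)"
    by (rule hom_sum, rule Suc.IH) (use Suc.prems in \<open>simp add: sum_incr del: of_nat_sum\<close>)
  then show ?case
    by (rule hom_cong) (simp add: mnm_incr simplex3_def flip: sum_distrib_right)
qed

lemma hom_poly_fun:
  assumes "p \<in> poly_fun z"
  shows "hom z p"
proof -
  obtain c where p: "p = (\<lambda>x. \<Sum>\<alpha>\<in>exps_upto z. c \<alpha> * mnm \<alpha> x)"
    using assms by (auto simp: poly_fun_def mnm_def)
  have "hom z (mnm \<alpha>)" if "\<alpha> \<in> exps_upto z" for \<alpha>
    by (rule hom_mnm_le[of _ "nat (z - int (\<Sum>i\<in>UNIV. \<alpha> i))"]) (use that in \<open>simp add: exps_upto_def del: of_nat_sum\<close>)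
  then show ?thesis unfolding p by (intro hom_sum hom_scale)
qed

text \<open>Independence on the face removes every monomial without the i-th coordinate, so the
  remaining ones can be divided term by term.\<close>

lemma hom_divide_coordinate:
  assumes "hom z p"
    and zero: "\<And>x. x \<in> simplex3 \<Longrightarrow> x$i = 0 \<Longrightarrow> (\<And>j. j \<noteq> i \<Longrightarrow> 0 < x$j) \<Longrightarrow> p x = 0"
  obtains q where "hom (z - 1) q" "\<And>x. x \<in> simplex3 \<Longrightarrow> p x = x$i * q x"
proof -
  obtain k where k: "\<And>x. x \<in> simplex3 \<Longrightarrow> p x = (\<Sum>\<alpha>\<in>degs z. k \<alpha> * mnm \<alpha> x)"
    using assms(1) by (auto simp: hom_def)
  have k0: "k \<alpha> = 0" if "\<alpha> \<in> degs z" "\<alpha> i = 0" for \<alpha>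
    by (rule mnm_independent_face[OF _ that]) (use k zero in auto)
  have eq: "p x = x$i * (\<Sum>\<beta>\<in>degs (z - 1). k (incr i \<beta>) * mnm \<beta> x)" if "x \<in> simplex3" for x
  proof -
    have "p x = (\<Sum>\<alpha>\<in>{\<alpha> \<in> degs z. \<alpha> i \<noteq> 0}. k \<alpha> * mnm \<alpha> x)"
      unfolding k[OF that] by (rule sum.mono_neutral_right) (auto simp: finite_degs k0)
    also have "\<dots> = (\<Sum>\<beta>\<in>degs (z - 1). k (incr i \<beta>) * mnm (incr i \<beta>) x)"
      unfolding degs_image_incr by (subst sum.reindex) (auto intro: inj_on_subset[OF inj_incr])
    finally show ?thesis by (simp add: mnm_incr sum_distrib_left mult.left_commute)
  qed
  show ?thesis
    by (rule that[OF _ eq]) (auto simp: hom_def)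
qed

section \<open>Permutations acting on exponents\<close>

definition rot :: "(4 \<Rightarrow> nat) \<Rightarrow> 4 \<Rightarrow> nat" where
  "rot \<alpha> = \<alpha> \<circ> inv cyc"

lemma inv_cyc: "inv cyc i = cyc (cyc i)"
  by (rule inv_f_eq) (use permutes_inj[OF cyc_permutes] in auto)

lemma rot_cyc [simp]: "rot \<alpha> (cyc i) = \<alpha> i"
  by (simp add: rot_def inv_cyc)

lemma rot_simps [simp]: "rot \<alpha> 0 = \<alpha> 0" "rot \<alpha> 1 = \<alpha> 3" "rot \<alpha> 2 = \<alpha> 1" "rot \<alpha> 3 = \<alpha> 2"
  by (simp_all add: rot_def inv_cyc)

lemma rot_incr: "rot (incr i \<alpha>) = incr (cyc i) (rot \<alpha>)"
proof -
  have "cyc (cyc j) = i \<longleftrightarrow> j = cyc i" for j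
    by (metis cyc_cyc_cyc)
  then show ?thesis by (auto simp: rot_def inv_cyc incr_apply fun_eq_iff)
qed

lemma sum_perm_comp: "\<pi> permutes UNIV \<Longrightarrow> (\<Sum>i\<in>UNIV. (\<alpha> \<circ> inv \<pi>) (i::4)) = (\<Sum>i\<in>UNIV. \<alpha> i :: nat)"
  by (simp add: o_def sum.permute[OF permutes_inv, symmetric, unfolded o_def])

lemma degs_perm: "\<pi> permutes UNIV \<Longrightarrow> \<alpha> \<circ> inv \<pi> \<in> degs z \<longleftrightarrow> \<alpha> \<in> degs z"
  unfolding degs_def by (simp only: mem_Collect_eq sum_perm_comp)

lemma rot_degs [simp]: "rot \<alpha> \<in> degs z \<longleftrightarrow> \<alpha> \<in> degs z"
  by (simp add: rot_def degs_perm[OF cyc_permutes])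

lemma mnm_perm:
  assumes "\<pi> permutes UNIV"
  shows "mnm \<alpha> (\<chi> i. x $ \<pi> i) = mnm (\<alpha> \<circ> inv \<pi>) x"
proof -
  have "mnm (\<alpha> \<circ> inv \<pi>) x = (\<Prod>i\<in>UNIV. (x $ \<pi> i) ^ (\<alpha> \<circ> inv \<pi>) (\<pi> i))"
    unfolding mnm_def using prod.permute[OF assms, of "\<lambda>i. (x$i) ^ (\<alpha> \<circ> inv \<pi>) i"] by (simp add: o_def)
  then show ?thesis
    using permutes_inverses[OF assms] by (simp add: mnm_def)
qed

section \<open>Spanning sets of the form spaces\<close>

text \<open>Below, \<open>d1\<close> and \<open>d2\<close> are \<open>d\<lambda>\<^sub>i\<close> and \<open>d\<lambda>\<^sub>i \<and> d\<lambda>\<^sub>j\<close>, while \<open>whit1\<close> and \<open>whit2\<close> are the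
  Whitney forms, the contractions with X of \<open>d\<lambda>\<^sub>i \<and> d\<lambda>\<^sub>j\<close> and \<open>d\<lambda>\<^sub>i \<and> d\<lambda>\<^sub>j \<and> d\<lambda>\<^sub>k\<close>.\<close>

definition d1 :: "4 \<Rightarrow> form" where
  "d1 i = (\<lambda>x vs. vs 0 $ i)"

definition d2 :: "4 \<Rightarrow> 4 \<Rightarrow> form" where
  "d2 i j = (\<lambda>x vs. vs 0 $ i * vs 1 $ j - vs 0 $ j * vs 1 $ i)"

definition whit1 :: "4 \<Rightarrow> 4 \<Rightarrow> form" where
  "whit1 i j = (\<lambda>x vs. x $ i * vs 0 $ j - x $ j * vs 0 $ i)"

definition whit2 :: "4 \<Rightarrow> 4 \<Rightarrow> 4 \<Rightarrow> form" where
  "whit2 i j k = (\<lambda>x vs. x $ i * d2 j k x vs - x $ j * d2 i k x vs + x $ k * d2 i j x vs)"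

lemmas form_defs = d1_def d2_def whit1_def whit2_def

definition mform :: "nat \<Rightarrow> (4 \<Rightarrow> nat) \<Rightarrow> form \<Rightarrow> form" where
  "mform k \<alpha> \<eta> = restr k (\<lambda>x vs. mnm \<alpha> x * \<eta> x vs)"

lemma mform_apply:
  "mform k \<alpha> \<eta> x vs = (if x \<in> simplex3 \<and> (\<forall>j<k. vs j \<in> tangent3) then mnm \<alpha> x * \<eta> x vs else 0)"
  by (simp add: mform_def restr_def)

lemma dlam_1: "dlam 1 I vs = vs 0 $ I 0"
proof -
  have "{..<1::nat} = {0}" by auto
  then show ?thesis by (simp add: dlam_def permutes_sing sign_id)
qed

lemma dlam_2: "dlam 2 I vs = vs 0 $ I 0 * vs 1 $ I 1 - vs 0 $ I 1 * vs 1 $ I 0"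
proof -
  have S: "{..<2::nat} = {0, 1}" by auto
  have f: "finite {1::nat}" "0 \<notin> {1::nat}" by auto
  show ?thesis
    unfolding dlam_def S sum_over_permutations_insert[OF f] permutes_sing
    by (simp add: sign_swap_id sign_id)
qed

lemma dlam_3: "dlam 3 I vs =
    vs 0 $ I 0 * (vs 1 $ I 1 * vs 2 $ I 2 - vs 1 $ I 2 * vs 2 $ I 1)
  - vs 0 $ I 1 * (vs 1 $ I 0 * vs 2 $ I 2 - vs 1 $ I 2 * vs 2 $ I 0)
  + vs 0 $ I 2 * (vs 1 $ I 0 * vs 2 $ I 1 - vs 1 $ I 1 * vs 2 $ I 0)"
proof -
  have S: "{..<3::nat} = {0, 1, 2}" by auto
  have f: "finite {1::nat, 2}" "0 \<notin> {1::nat, 2}" by auto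
  have g: "finite {2::nat}" "1 \<notin> {2::nat}" by auto
  show ?thesis
    unfolding dlam_def S sum_over_permutations_insert[OF f] sum_over_permutations_insert[OF g] permutes_sing
    by (simp add: sign_swap_id permutation_swap_id sign_compose sign_id)
      (simp add: Transposition.transpose_def algebra_simps)
qed

lemma poly_fun_add: "p \<in> poly_fun z \<Longrightarrow> q \<in> poly_fun z \<Longrightarrow> (\<lambda>x. p x + q x) \<in> poly_fun z"
  unfolding poly_fun_def mem_Collect_eq
proof (elim exE)
  fix c d assume *: "p = (\<lambda>x. \<Sum>\<alpha>\<in>exps_upto z. c \<alpha> * (\<Prod>i\<in>UNIV. x $ i ^ \<alpha> i))"
    "q = (\<lambda>x. \<Sum>\<alpha>\<in>exps_upto z. d \<alpha> * (\<Prod>i\<in>UNIV. x $ i ^ \<alpha> i))"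
  show "\<exists>c. (\<lambda>x. p x + q x) = (\<lambda>x. \<Sum>\<alpha>\<in>exps_upto z. c \<alpha> * (\<Prod>i\<in>UNIV. x $ i ^ \<alpha> i))"
    unfolding * by (rule exI[of _ "\<lambda>\<alpha>. c \<alpha> + d \<alpha>"]) (simp add: distrib_right sum.distrib)
qed

lemma poly_fun_scale: "p \<in> poly_fun z \<Longrightarrow> (\<lambda>x. c * p x) \<in> poly_fun z"
  unfolding poly_fun_def mem_Collect_eq
proof (elim exE)
  fix d assume *: "p = (\<lambda>x. \<Sum>\<alpha>\<in>exps_upto z. d \<alpha> * (\<Prod>i\<in>UNIV. x $ i ^ \<alpha> i))"
  show "\<exists>d. (\<lambda>x. c * p x) = (\<lambda>x. \<Sum>\<alpha>\<in>exps_upto z. d \<alpha> * (\<Prod>i\<in>UNIV. x $ i ^ \<alpha> i))"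
    unfolding * by (rule exI[of _ "\<lambda>\<alpha>. c * d \<alpha>"]) (simp add: sum_distrib_left mult.assoc)
qed

lemma poly_fun_zero: "(\<lambda>x. 0) \<in> poly_fun z"
  unfolding poly_fun_def mem_Collect_eq by (rule exI[of _ "\<lambda>_. 0"]) simp

lemma poly_fun_mnm:
  assumes "\<alpha> \<in> degs z"
  shows "mnm \<alpha> \<in> poly_fun z"
proof -
  have "\<alpha> \<in> exps_upto z" using assms by (simp add: degs_def exps_upto_def)
  then show ?thesis unfolding poly_fun_def mem_Collect_eq
    by (intro exI[of _ "\<lambda>\<beta>. if \<beta> = \<alpha> then 1 else 0"] ext)
      (simp add: finite_exps_upto mnm_def if_distrib[of "\<lambda>c. c * _"] cong: if_cong)
qed

text \<open>The coefficients on the left have degree at most z, yet the generators on the right have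
  exact degree z: after restriction to the simplex each coefficient can be made homogeneous.\<close>

lemma restr_poly_span:
  fixes F :: "'i \<Rightarrow> form"
  assumes "finite X"
  shows "restr k ` {\<omega>. \<exists>a. (\<forall>I. a I \<in> poly_fun z) \<and> \<omega> = (\<lambda>x vs. \<Sum>I\<in>X. a I x * F I x vs)}
    = span ((\<lambda>(\<alpha>, I). mform k \<alpha> (F I)) ` (degs z \<times> X))" (is "?L = span ?G")
proof
  show "?L \<subseteq> span ?G"
  proof clarify
    fix a :: "'i \<Rightarrow> real^4 \<Rightarrow> real" assume a: "\<forall>I. a I \<in> poly_fun z"
    then have "\<forall>I. \<exists>k. \<forall>x\<in>simplex3. a I x = (\<Sum>\<alpha>\<in>degs z. k \<alpha> * mnm \<alpha> x)"
      using hom_poly_fun unfolding hom_def by blast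
    then obtain c where c: "\<And>I x. x \<in> simplex3 \<Longrightarrow> a I x = (\<Sum>\<alpha>\<in>degs z. c I \<alpha> * mnm \<alpha> x)"
      by (auto dest!: choice)
    have "restr k (\<lambda>x vs. \<Sum>I\<in>X. a I x * F I x vs) = (\<Sum>I\<in>X. \<Sum>\<alpha>\<in>degs z. c I \<alpha> *\<^sub>R mform k \<alpha> (F I))"
    proof (intro ext)
      fix x vs
      show "restr k (\<lambda>x vs. \<Sum>I\<in>X. a I x * F I x vs) x vs =
          (\<Sum>I\<in>X. \<Sum>\<alpha>\<in>degs z. c I \<alpha> *\<^sub>R mform k \<alpha> (F I)) x vs"
        by (cases "x \<in> simplex3 \<and> (\<forall>j<k. vs j \<in> tangent3)")
          (simp_all only: restr_def mform_apply if_True if_False sum_fun_apply scaleR_fun_apply,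
           simp_all add: c sum_distrib_right mult.assoc)
    qed
    also have "\<dots> \<in> span ?G"
      by (intro span_sum span_scale span_base) auto
    finally show "restr k (\<lambda>x vs. \<Sum>I\<in>X. a I x * F I x vs) \<in> span ?G" .
  qed
  have "subspace ?L"
    unfolding subspace_def
  proof (intro conjI ballI allI)
    show "0 \<in> ?L"
    proof (rule image_eqI)
      show "0 = restr k (\<lambda>x vs. \<Sum>I\<in>X. 0 * F I x vs)" by (auto simp: restr_def fun_eq_iff)
    qed (use poly_fun_zero in \<open>auto intro!: exI[of _ "\<lambda>_ _. 0"]\<close>)
  next
    fix u v assume "u \<in> ?L" "v \<in> ?L"
    then obtain a b where ab: "\<forall>I. a I \<in> poly_fun z" "\<forall>I. b I \<in> poly_fun z"
      "u = restr k (\<lambda>x vs. \<Sum>I\<in>X. a I x * F I x vs)" "v = restr k (\<lambda>x vs. \<Sum>I\<in>X. b I x * F I x vs)" by blast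
    show "u + v \<in> ?L"
    proof (rule image_eqI)
      show "u + v = restr k (\<lambda>x vs. \<Sum>I\<in>X. (a I x + b I x) * F I x vs)"
        unfolding ab by (intro ext) (simp add: restr_def distrib_right sum.distrib, blast)
    qed (use ab poly_fun_add in \<open>auto intro!: exI[of _ "\<lambda>I x. a I x + b I x"]\<close>)
  next
    fix c v assume "v \<in> ?L"
    then obtain a where a: "\<forall>I. a I \<in> poly_fun z"
      "v = restr k (\<lambda>x vs. \<Sum>I\<in>X. a I x * F I x vs)" by blast
    show "c *\<^sub>R v \<in> ?L"
    proof (rule image_eqI)
      show "c *\<^sub>R v = restr k (\<lambda>x vs. \<Sum>I\<in>X. (c * a I x) * F I x vs)"
        unfolding a by (intro ext) (simp add: restr_def sum_distrib_left mult.assoc, blast)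
    qed (use a poly_fun_scale in \<open>auto intro!: exI[of _ "\<lambda>I x. c * a I x"]\<close>)
  qed
  moreover have "?G \<subseteq> ?L"
  proof clarify
    fix \<alpha> I assume \<alpha>: "\<alpha> \<in> degs z" and I: "I \<in> X"
    have "(\<lambda>x. if J = I then mnm \<alpha> x else 0) \<in> poly_fun z" for J
      using poly_fun_mnm[OF \<alpha>] poly_fun_zero by (cases "J = I") auto
    note pf = this
    show "mform k \<alpha> (F I) \<in> ?L"
    proof (rule image_eqI)
      show "mform k \<alpha> (F I) = restr k (\<lambda>x vs. \<Sum>J\<in>X. (if J = I then mnm \<alpha> x else 0) * F J x vs)"
        unfolding mform_def using I assms by (simp add: if_distrib[of "\<lambda>c. c * _"] cong: if_cong)
    qed (use pf in \<open>auto intro!: exI[of _ "\<lambda>J x. if J = I then mnm \<alpha> x else 0"]\<close>)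
  qed
  ultimately show "span ?G \<subseteq> ?L" by (intro span_minimal)
qed

lemma PLam_span_dlam:
  "PLam r k = span ((\<lambda>(\<alpha>, I). mform k \<alpha> (\<lambda>x vs. dlam k I vs)) ` (degs (int r) \<times> PiE {..<k} (\<lambda>_. UNIV)))"
  unfolding PLam_def PLam_R_def by (rule restr_poly_span) (simp add: finite_PiE)

lemma PmLam_span_dlam:
  "PmLam r k = span ((\<lambda>(\<alpha>, I). mform k \<alpha> (contrX (\<lambda>x vs. dlam (k + 1) I vs))) `
     (degs (int r - 1) \<times> PiE {..<k + 1} (\<lambda>_. UNIV)))"
proof -
  have "PmLam r k = restr k ` {\<omega>. \<exists>a. (\<forall>I. a I \<in> poly_fun (int r - 1)) \<and>
     \<omega> = (\<lambda>x vs. \<Sum>I\<in>PiE {..<k + 1} (\<lambda>_. UNIV). a I x * contrX (\<lambda>x vs. dlam (k + 1) I vs) x vs)}"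
  proof -
    have c: "contrX (\<lambda>x vs. \<Sum>I\<in>X. a I x * dlam (k + 1) I vs) =
        (\<lambda>x vs. \<Sum>I\<in>X. a I x * contrX (\<lambda>x vs. dlam (k + 1) I vs) x vs)" for X and a :: "(nat \<Rightarrow> 4) \<Rightarrow> _"
      by (simp add: contrX_def)
    have "contrX ` PLam_R (int r - 1) (k + 1) = {\<omega>. \<exists>a. (\<forall>I. a I \<in> poly_fun (int r - 1)) \<and>
       \<omega> = (\<lambda>x vs. \<Sum>I\<in>PiE {..<k + 1} (\<lambda>_. UNIV). a I x * contrX (\<lambda>x vs. dlam (k + 1) I vs) x vs)}"
      unfolding PLam_R_def c[symmetric] by blast
    then show ?thesis unfolding PmLam_def PmLam_R_def by (simp only:)
  qed
  also have "\<dots> = span ((\<lambda>(\<alpha>, I). mform k \<alpha> (contrX (\<lambda>x vs. dlam (k + 1) I vs))) `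
     (degs (int r - 1) \<times> PiE {..<k + 1} (\<lambda>_. UNIV)))"
    by (rule restr_poly_span) (simp add: finite_PiE)
  finally show ?thesis .
qed

lemma PLam_1: "PLam r 1 = span {mform 1 \<alpha> (d1 i) | \<alpha> i. \<alpha> \<in> degs (int r)}"
proof -
  have "(\<lambda>(\<alpha>, I). mform 1 \<alpha> (\<lambda>x vs. dlam 1 I vs)) ` (degs (int r) \<times> PiE {..<1} (\<lambda>_. UNIV))
    = {mform 1 \<alpha> (d1 i) | \<alpha> i. \<alpha> \<in> degs (int r)}" (is "?L = ?R")
  proof
    show "?L \<subseteq> ?R" by (auto simp: dlam_1[unfolded One_nat_def] d1_def)
    show "?R \<subseteq> ?L"
    proof clarify
      fix \<alpha> i assume "\<alpha> \<in> degs (int r)"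
      then show "mform 1 \<alpha> (d1 i) \<in> ?L"
        by (intro image_eqI[of _ _ "(\<alpha>, restrict (\<lambda>_. i) {..<1})"]) (auto simp: dlam_1[unfolded One_nat_def] d1_def)
    qed
  qed
  then show ?thesis unfolding PLam_span_dlam by (simp only:)
qed

lemma PLam_2: "PLam r 2 = span {mform 2 \<alpha> (d2 i j) | \<alpha> i j. \<alpha> \<in> degs (int r)}"
proof -
  have "(\<lambda>(\<alpha>, I). mform 2 \<alpha> (\<lambda>x vs. dlam 2 I vs)) ` (degs (int r) \<times> PiE {..<2} (\<lambda>_. UNIV))
    = {mform 2 \<alpha> (d2 i j) | \<alpha> i j. \<alpha> \<in> degs (int r)}" (is "?L = ?R")
  proof
    show "?L \<subseteq> ?R" by (auto simp: dlam_2 d2_def)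
    show "?R \<subseteq> ?L"
    proof clarify
      fix \<alpha> i j assume "\<alpha> \<in> degs (int r)"
      then show "mform 2 \<alpha> (d2 i j) \<in> ?L"
        by (intro image_eqI[of _ _ "(\<alpha>, restrict (\<lambda>n. if n = 0 then i else j) {..<2})"]) (auto simp: dlam_2 d2_def)
    qed
  qed
  then show ?thesis unfolding PLam_span_dlam by (simp only:)
qed

lemma PmLam_1: "PmLam r 1 = span {mform 1 \<alpha> (whit1 i j) | \<alpha> i j. \<alpha> \<in> degs (int r - 1)}"
proof -
  have w: "contrX (\<lambda>x vs. dlam 2 I vs) = whit1 (I 0) (I 1)" for I
    by (simp add: contrX_def dlam_2 whit1_def fun_eq_iff)
  have "(\<lambda>(\<alpha>, I). mform 1 \<alpha> (contrX (\<lambda>x vs. dlam 2 I vs))) ` (degs (int r - 1) \<times> PiE {..<2} (\<lambda>_. UNIV))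
    = {mform 1 \<alpha> (whit1 i j) | \<alpha> i j. \<alpha> \<in> degs (int r - 1)}" (is "?L = ?R")
  proof
    show "?L \<subseteq> ?R" by (auto simp: w)
    show "?R \<subseteq> ?L"
    proof clarify
      fix \<alpha> i j assume "\<alpha> \<in> degs (int r - 1)"
      then show "mform 1 \<alpha> (whit1 i j) \<in> ?L"
        by (intro image_eqI[of _ _ "(\<alpha>, restrict (\<lambda>n. if n = 0 then i else j) {..<2})"]) (auto simp: w)
    qed
  qed
  then show ?thesis unfolding PmLam_span_dlam one_add_one by (simp only:)
qed

lemma PmLam_2: "PmLam r 2 = span {mform 2 \<alpha> (whit2 i j k) | \<alpha> i j k. \<alpha> \<in> degs (int r - 1)}"
proof -
  have w: "contrX (\<lambda>x vs. dlam 3 I vs) = whit2 (I 0) (I 1) (I 2)" for I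
    by (simp add: contrX_def dlam_3 whit2_def d2_def fun_eq_iff)
  have "(\<lambda>(\<alpha>, I). mform 2 \<alpha> (contrX (\<lambda>x vs. dlam 3 I vs))) ` (degs (int r - 1) \<times> PiE {..<3} (\<lambda>_. UNIV))
    = {mform 2 \<alpha> (whit2 i j k) | \<alpha> i j k. \<alpha> \<in> degs (int r - 1)}" (is "?L = ?R")
  proof
    show "?L \<subseteq> ?R" by (auto simp: w)
    show "?R \<subseteq> ?L"
    proof clarify
      fix \<alpha> i j k assume "\<alpha> \<in> degs (int r - 1)"
      then show "mform 2 \<alpha> (whit2 i j k) \<in> ?L"
        by (intro image_eqI[of _ _ "(\<alpha>, restrict (\<lambda>n. if n = 0 then i else if n = 1 then j else k) {..<3})"])
          (auto simp: w)
    qed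
  qed
  moreover have "(2::nat) + 1 = 3" by simp
  ultimately show ?thesis unfolding PmLam_span_dlam by (simp only:)
qed

section \<open>Stability of the spaces under permutations\<close>

lemma simplex3_perm:
  assumes "\<pi> permutes UNIV"
  shows "(\<chi> i. x $ \<pi> i) \<in> simplex3 \<longleftrightarrow> x \<in> simplex3"
proof -
  have "(\<forall>i. 0 \<le> x $ \<pi> i) \<longleftrightarrow> (\<forall>i. 0 \<le> x $ i)" using permutes_surj[OF assms] by (metis surjD)
  then show ?thesis
    using sum.permute[OF assms, of "($) x"] by (simp add: simplex3_def o_def)
qed

lemma tangent3_perm: "\<pi> permutes UNIV \<Longrightarrow> (\<chi> i. v $ \<pi> i) \<in> tangent3 \<longleftrightarrow> v \<in> tangent3"
  using sum.permute[of \<pi> UNIV "($) v"] by (simp add: tangent3_def o_def)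

lemma act_mform:
  assumes "\<pi> permutes UNIV"
  shows "act \<pi> (mform k \<alpha> \<eta>) = mform k (\<alpha> \<circ> inv \<pi>) (act \<pi> \<eta>)"
  by (intro ext) (simp add: act_def mform_apply simplex3_perm[OF assms] tangent3_perm[OF assms] mnm_perm[OF assms], blast)

lemma act_cyc_mform: "act cyc (mform k \<alpha> \<eta>) = mform k (rot \<alpha>) (act cyc \<eta>)"
  by (simp add: act_mform[OF cyc_permutes] rot_def)

lemma act_forms:
  "act \<pi> (d1 i) = d1 (\<pi> i)" "act \<pi> (d2 i j) = d2 (\<pi> i) (\<pi> j)"
  "act \<pi> (whit1 i j) = whit1 (\<pi> i) (\<pi> j)" "act \<pi> (whit2 i j k) = whit2 (\<pi> i) (\<pi> j) (\<pi> k)"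
  by (simp_all add: act_def form_defs fun_eq_iff)

lemma act_span:
  assumes "v \<in> span G" "\<And>g. g \<in> G \<Longrightarrow> act \<pi> g \<in> G"
  shows "act \<pi> v \<in> span G"
proof -
  have "act \<pi> v \<in> span (act \<pi> ` G)"
    using assms(1) linear_span_image[OF linear_act] by blast
  also have "\<dots> \<subseteq> span G" using assms(2) by (intro span_mono) auto
  finally show ?thesis .
qed

lemma act_stable:
  assumes "\<pi> permutes UNIV"
  shows "v \<in> PLam r 1 \<Longrightarrow> act \<pi> v \<in> PLam r 1" "v \<in> PLam r 2 \<Longrightarrow> act \<pi> v \<in> PLam r 2"
    "v \<in> PmLam r 1 \<Longrightarrow> act \<pi> v \<in> PmLam r 1" "v \<in> PmLam r 2 \<Longrightarrow> act \<pi> v \<in> PmLam r 2"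
  unfolding PLam_1 PLam_2 PmLam_1 PmLam_2
  by (erule act_span, use degs_perm[OF assms] in \<open>force simp: act_mform[OF assms] act_forms\<close>)+

lemma trace_free_act:
  assumes "\<pi> permutes UNIV" "trace_free k f"
  shows "trace_free k (act \<pi> f)"
  unfolding trace_free_def
proof (intro allI impI, elim conjE)
  fix i x vs assume x: "x \<in> simplex3" "x $ i = 0" and vs: "\<forall>j<k. vs j \<in> tangent3 \<and> vs j $ i = 0"
  have "\<pi> (inv \<pi> i) = i" using permutes_inverses[OF assms(1)] by simp
  then show "act \<pi> f x vs = 0"
    unfolding act_def using assms(2) x vs
    by (auto simp: trace_free_def simplex3_perm[OF assms(1)] tangent3_perm[OF assms(1)]
        intro!: assms(2)[unfolded trace_free_def, rule_format, of _ "inv \<pi> i"])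
qed

lemma act_stable_trace_free:
  assumes "\<pi> permutes UNIV"
  shows "v \<in> PLam0 r 1 \<Longrightarrow> act \<pi> v \<in> PLam0 r 1" "v \<in> PLam0 r 2 \<Longrightarrow> act \<pi> v \<in> PLam0 r 2"
    "v \<in> PmLam0 r 1 \<Longrightarrow> act \<pi> v \<in> PmLam0 r 1" "v \<in> PmLam0 r 2 \<Longrightarrow> act \<pi> v \<in> PmLam0 r 2"
  using act_stable[OF assms] trace_free_act[OF assms] by (auto simp: PLam0_def PmLam0_def)

lemma subspace_trace_free: "subspace {f. trace_free k f}"
proof -
  define Q where "Q = {(x, vs). \<exists>i. x \<in> simplex3 \<and> x$i = 0 \<and> (\<forall>j<k. vs j \<in> tangent3 \<and> vs j $ i = 0)}"
  have "{f. trace_free k f} = {f. \<forall>q\<in>Q. f (fst q) (snd q) = 0}"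
    unfolding trace_free_def Q_def by fastforce
  moreover have "subspace {f :: form. \<forall>q\<in>Q. f (fst q) (snd q) = 0}"
    by (auto simp: subspace_def)
  ultimately show ?thesis by simp
qed

section \<open>Full polynomial forms\<close>

text \<open>The vectors from vertex 0 to the other vertices are the basis of the tangent space dual
  to \<open>d1 1\<close>, \<open>d1 2\<close>, \<open>d1 3\<close>.\<close>

definition edge :: "4 \<Rightarrow> real^4" where
  "edge i = axis i 1 - axis 0 1"

text \<open>Forms take infinite sequences of vectors; this packs the two arguments that a 2-form
  reads.\<close>

definition pr :: "'a \<Rightarrow> 'a \<Rightarrow> nat \<Rightarrow> 'a" where
  "pr v w = (\<lambda>j. if j = 0 then v else w)"

lemma pr_simps [simp]: "pr v w 0 = v" "pr v w 1 = w" "pr v w (Suc 0) = w"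
  by (simp_all add: pr_def)

lemma axis_nth': "(axis i 1 :: real^4) $ j = (if i = j then 1 else 0)"
  by (simp add: axis_def)

lemma edge_nth: "edge i $ j = (if i = j then 1 else 0) - (if j = 0 then 1 else 0)"
  by (simp add: edge_def axis_nth')

lemma edge_tangent [simp]: "edge i \<in> tangent3"
  by (simp add: tangent3_def edge_def axis_nth' sum_subtractf)

lemma simplex3_sum: "x \<in> simplex3 \<Longrightarrow> x$0 + x$1 + x$2 + x$3 = 1"
  by (simp add: simplex3_def sum_4')

lemma tangent3_sum: "v \<in> tangent3 \<Longrightarrow> v$0 = - v$1 - v$2 - v$3"
  by (simp add: tangent3_def sum_4')

lemma tangent_towards_vertex [simp]: "x \<in> simplex3 \<Longrightarrow> axis i 1 - x \<in> tangent3"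
  by (simp add: tangent3_def simplex3_def sum_subtractf axis_nth')

lemma mform_2: "x \<in> simplex3 \<Longrightarrow> v \<in> tangent3 \<Longrightarrow> w \<in> tangent3 \<Longrightarrow>
    mform 2 \<alpha> \<eta> x (pr v w) = mnm \<alpha> x * \<eta> x (pr v w)"
  by (simp add: mform_apply pr_def)

lemma mform_eqI:
  assumes "\<And>x vs. x \<in> simplex3 \<Longrightarrow> \<forall>j<k. vs j \<in> tangent3 \<Longrightarrow> mform k \<alpha> \<eta> x vs = f x vs"
    and "\<And>x vs. \<not> (x \<in> simplex3 \<and> (\<forall>j<k. vs j \<in> tangent3)) \<Longrightarrow> f x vs = 0"
  shows "mform k \<alpha> \<eta> = f"
proof (intro ext)
  fix x vs
  show "mform k \<alpha> \<eta> x vs = f x vs"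
    using assms(1)[of x vs] assms(2)[of x vs] mform_apply[of k \<alpha> \<eta> x vs] by metis
qed

abbreviation vertices :: "4 set" where "vertices \<equiv> {1, 2, 3}"

lemma vertices_iff: "i \<in> vertices \<longleftrightarrow> i \<noteq> 0"
  using all_4[of "\<lambda>i. i \<in> vertices \<longleftrightarrow> i \<noteq> 0"] by simp

lemma cyc_eq_0 [simp]: "cyc i = 0 \<longleftrightarrow> i = 0"
  by (metis cyc_cyc_cyc cyc_simps(1))

lemma sum_vertices: "(\<Sum>i\<in>vertices. f i) = f 1 + f 2 + f 3"
  by (simp add: add.assoc)

text \<open>The test vectors and the weight w may depend on the point x and on l, but not on the
  exponent. Evaluating a vanishing combination therefore isolates the coefficients with index l as
  one polynomial that is zero on the open simplex.\<close>

lemma independent_diagonal: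
  fixes e :: "(4 \<Rightarrow> nat) \<times> 4 \<Rightarrow> form"
  assumes ev: "\<And>x l. x \<in> simplex3 \<Longrightarrow> (\<And>i. 0 < x$i) \<Longrightarrow> l \<noteq> 0 \<Longrightarrow>
      \<exists>vs w. w \<noteq> 0 \<and> (\<forall>\<gamma> i. i \<noteq> 0 \<longrightarrow> e (\<gamma>, i) x vs = mnm \<gamma> x * (if i = l then w else 0))"
    and zero: "\<And>x vs. x \<in> simplex3 \<Longrightarrow> (\<And>i. 0 < x$i) \<Longrightarrow>
      (\<Sum>a\<in>degs z \<times> vertices. k a *\<^sub>R e a) x vs = 0"
  shows "\<forall>a\<in>degs z \<times> vertices. k a = 0"
proof clarify
  fix \<gamma> :: "4 \<Rightarrow> nat" and l assume \<gamma>: "\<gamma> \<in> degs z" and l: "l \<in> vertices"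
  show "k (\<gamma>, l) = 0"
  proof (rule mnm_independent[OF _ \<gamma>, of "\<lambda>\<gamma>. k (\<gamma>, l)"])
    fix x :: "real^4" assume x: "x \<in> simplex3" "\<And>i. 0 < x$i"
    from l have l0: "l \<noteq> 0" by (rule vertices_iff[THEN iffD1])
    from ev[OF x l0] obtain vs w where w: "w \<noteq> 0"
      and e: "\<And>\<gamma> i. i \<noteq> 0 \<Longrightarrow> e (\<gamma>, i) x vs = mnm \<gamma> x * (if i = l then w else 0)" by blast
    have "0 = (\<Sum>a\<in>degs z \<times> vertices. k a * e a x vs)"
      using zero[OF x, of vs] by simp
    also have "\<dots> = (\<Sum>\<gamma>\<in>degs z. \<Sum>i\<in>vertices. k (\<gamma>, i) * e (\<gamma>, i) x vs)"
      by (simp only: sum.cartesian_product split_def prod.collapse)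
    also have "\<dots> = (\<Sum>\<gamma>\<in>degs z. k (\<gamma>, l) * (mnm \<gamma> x * w))"
    proof (rule sum.cong[OF refl])
      fix \<gamma>
      have "(\<Sum>i\<in>vertices. k (\<gamma>, i) * e (\<gamma>, i) x vs) = (\<Sum>i\<in>vertices. if i = l then k (\<gamma>, l) * (mnm \<gamma> x * w) else 0)"
        by (rule sum.cong[OF refl]) (auto simp: e)
      then show "(\<Sum>i\<in>vertices. k (\<gamma>, i) * e (\<gamma>, i) x vs) = k (\<gamma>, l) * (mnm \<gamma> x * w)"
        using l by (simp only: sum.delta finite.intros if_True)
    qed
    also have "\<dots> = w * (\<Sum>\<gamma>\<in>degs z. k (\<gamma>, l) * mnm \<gamma> x)"
      by (simp add: sum_distrib_left ac_simps)
    finally show "(\<Sum>\<gamma>\<in>degs z. k (\<gamma>, l) * mnm \<gamma> x) = 0" using w by simp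
  qed
qed

definition e1 :: "(4 \<Rightarrow> nat) \<times> 4 \<Rightarrow> form" where
  "e1 = (\<lambda>(\<gamma>, i). mform 1 \<gamma> (d1 i))"

text \<open>Labelled by the index missing from {1, 2, 3} and oriented along \<open>cyc\<close>, so
  that \<open>cyc\<close> permutes these forms without signs. As \<open>cyc\<close> fixes 0,
  \<open>om 0\<close> vanishes; this convention pays off for the syzygies.\<close>

definition om :: "4 \<Rightarrow> form" where
  "om i = d2 (cyc i) (cyc (cyc i))"

definition e2 :: "(4 \<Rightarrow> nat) \<times> 4 \<Rightarrow> form" where
  "e2 = (\<lambda>(\<gamma>, i). mform 2 \<gamma> (om i))"

lemma om_0: "om 0 = 0"
  by (simp add: om_def d2_def fun_eq_iff)

lemma act_om: "act cyc (om i) = om (cyc i)"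
  by (simp add: om_def act_forms)

lemma e1_edge: "x \<in> simplex3 \<Longrightarrow> e1 (\<gamma>, i) x (\<lambda>_. edge l) = mnm \<gamma> x * edge l $ i"
  by (simp add: e1_def mform_apply d1_def)

lemma om_edge: "l \<noteq> 0 \<Longrightarrow> om i x (pr (edge (cyc l)) (edge (cyc (cyc l)))) = (if i = l then 1 else 0)"
proof -
  have "\<forall>l i. l \<noteq> 0 \<longrightarrow> om i x (pr (edge (cyc l)) (edge (cyc (cyc l)))) = (if i = l then 1 else 0)"
    unfolding all_4 om_def d2_def by (simp add: edge_nth)
  then show "l \<noteq> 0 \<Longrightarrow> ?thesis" by blast
qed

lemma e2_edge:
  "x \<in> simplex3 \<Longrightarrow> l \<noteq> 0 \<Longrightarrow> e2 (\<gamma>, i) x (pr (edge (cyc l)) (edge (cyc (cyc l)))) = mnm \<gamma> x * (if i = l then 1 else 0)"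
  by (simp add: e2_def mform_2 om_edge del: mult_cancel_left)

lemma d1_0: "mform 1 \<gamma> (d1 0) = - e1 (\<gamma>, 1) - e1 (\<gamma>, 2) - e1 (\<gamma>, 3)"
proof (rule mform_eqI)
  fix x vs assume x: "x \<in> simplex3" "\<forall>j<1::nat. vs j \<in> tangent3"
  then have "vs 0 $ 0 = - vs 0 $ 1 - vs 0 $ 2 - vs 0 $ 3" by (intro tangent3_sum) simp
  with x show "mform 1 \<gamma> (d1 0) x vs = (- e1 (\<gamma>, 1) - e1 (\<gamma>, 2) - e1 (\<gamma>, 3)) x vs"
    by (simp add: e1_def mform_apply d1_def right_diff_distrib)
qed (auto simp: e1_def mform_apply)

lemma PLam_1_basis: "PLam r 1 = span (e1 ` (degs (int r) \<times> vertices))"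
  unfolding PLam_1 span_eq
proof (intro conjI subsetI)
  let ?S = "span (e1 ` (degs (int r) \<times> vertices))"
  fix f assume "f \<in> {mform 1 \<alpha> (d1 i) | \<alpha> i. \<alpha> \<in> degs (int r)}"
  then obtain \<alpha> i where f: "f = mform 1 \<alpha> (d1 i)" and \<alpha>: "\<alpha> \<in> degs (int r)" by blast
  have b: "e1 (\<alpha>, j) \<in> ?S" if "j \<in> vertices" for j
    using \<alpha> that by (intro span_base imageI) auto
  show "f \<in> ?S"
  proof (cases "i = 0")
    case True
    show ?thesis unfolding f True d1_0 by (intro span_diff span_neg b) auto
  next
    case False
    then have "i \<in> vertices" by (rule vertices_iff[THEN iffD2])
    from b[OF this] show ?thesis by (simp add: f e1_def)
  qed
next
  fix f assume "f \<in> e1 ` (degs (int r) \<times> vertices)"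
  then have "f \<in> {mform 1 \<alpha> (d1 i) | \<alpha> i. \<alpha> \<in> degs (int r)}" by (auto simp: e1_def)
  then show "f \<in> span {mform 1 \<alpha> (d1 i) | \<alpha> i. \<alpha> \<in> degs (int r)}" by (rule span_base)
qed

text \<open>An alternating form on the tangent space is determined by its values on pairs of dual
  basis vectors; the first factor on the right is such a value, the second is
  \<open>om l\<close>.\<close>

lemma d2_expand:
  assumes "v \<in> tangent3" "w \<in> tangent3"
  shows "v $ i * w $ j - v $ j * w $ i = (\<Sum>l\<in>vertices. (edge (cyc l) $ i * edge (cyc (cyc l)) $ j -
    edge (cyc l) $ j * edge (cyc (cyc l)) $ i) * (v $ cyc l * w $ cyc (cyc l) - v $ cyc (cyc l) * w $ cyc l))"
proof -
  have "\<forall>i j. v $ i * w $ j - v $ j * w $ i = (\<Sum>l\<in>vertices. (edge (cyc l) $ i * edge (cyc (cyc l)) $ j -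
    edge (cyc l) $ j * edge (cyc (cyc l)) $ i) * (v $ cyc l * w $ cyc (cyc l) - v $ cyc (cyc l) * w $ cyc l))"
    unfolding all_4 sum_vertices
    by (simp add: edge_nth tangent3_sum[OF assms(1)] tangent3_sum[OF assms(2)]) (simp add: algebra_simps)
  then show ?thesis by blast
qed

lemma PLam_2_basis: "PLam r 2 = span (e2 ` (degs (int r) \<times> vertices))"
  unfolding PLam_2 span_eq
proof (intro conjI subsetI)
  let ?S = "span (e2 ` (degs (int r) \<times> vertices))"
  fix f assume "f \<in> {mform 2 \<alpha> (d2 i j) | \<alpha> i j. \<alpha> \<in> degs (int r)}"
  then obtain \<alpha> i j where f: "f = mform 2 \<alpha> (d2 i j)" and \<alpha>: "\<alpha> \<in> degs (int r)" by blast
  define c where "c l = edge (cyc l) $ i * edge (cyc (cyc l)) $ j - edge (cyc l) $ j * edge (cyc (cyc l)) $ i" for l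
  have "f = (\<Sum>l\<in>vertices. c l *\<^sub>R e2 (\<alpha>, l))"
    unfolding f
  proof (rule mform_eqI)
    fix x vs assume x: "x \<in> simplex3" and vs: "\<forall>j<2::nat. vs j \<in> tangent3"
    then have t: "vs 0 \<in> tangent3" "vs 1 \<in> tangent3" by auto
    have "mform 2 \<alpha> (d2 i j) x vs = mnm \<alpha> x * (\<Sum>l\<in>vertices. c l *
        (vs 0 $ cyc l * vs 1 $ cyc (cyc l) - vs 0 $ cyc (cyc l) * vs 1 $ cyc l))"
      using x vs unfolding c_def d2_expand[OF t, symmetric] by (simp add: mform_apply d2_def)
    also have "\<dots> = (\<Sum>l\<in>vertices. c l *\<^sub>R e2 (\<alpha>, l)) x vs"
      using x vs by (simp only: sum_fun_apply scaleR_fun_apply e2_def prod.case mform_apply om_def d2_def)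
        (simp add: sum_distrib_left algebra_simps)
    finally show "mform 2 \<alpha> (d2 i j) x vs = (\<Sum>l\<in>vertices. c l *\<^sub>R e2 (\<alpha>, l)) x vs" .
  qed (simp only: sum_fun_apply scaleR_fun_apply e2_def prod.case mform_apply if_False, simp)
  also have "\<dots> \<in> ?S" using \<alpha> by (intro span_sum span_scale span_base imageI) auto
  finally show "f \<in> ?S" .
next
  fix f assume "f \<in> e2 ` (degs (int r) \<times> vertices)"
  then have "f \<in> {mform 2 \<alpha> (d2 i j) | \<alpha> i j. \<alpha> \<in> degs (int r)}" by (auto simp: e2_def om_def)
  then show "f \<in> span {mform 2 \<alpha> (d2 i j) | \<alpha> i j. \<alpha> \<in> degs (int r)}" by (rule span_base)
qed

lemma independent_e1:
  assumes "\<And>x vs. x \<in> simplex3 \<Longrightarrow> (\<And>i. 0 < x$i) \<Longrightarrow> (\<Sum>a\<in>degs z \<times> vertices. k a *\<^sub>R e1 a) x vs = 0"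
  shows "\<forall>a\<in>degs z \<times> vertices. k a = 0"
proof (rule independent_diagonal[OF _ assms])
  fix x :: "real^4" and l :: 4 assume "x \<in> simplex3" "l \<noteq> 0"
  then show "\<exists>vs w. w \<noteq> 0 \<and> (\<forall>\<gamma> i. i \<noteq> 0 \<longrightarrow> e1 (\<gamma>, i) x vs = mnm \<gamma> x * (if i = l then w else 0))"
    by (intro exI[of _ "\<lambda>_. edge l"] exI[of _ 1]) (auto simp: e1_edge edge_nth)
qed

lemma independent_e2:
  assumes "\<And>x vs. x \<in> simplex3 \<Longrightarrow> (\<And>i. 0 < x$i) \<Longrightarrow> (\<Sum>a\<in>degs z \<times> vertices. k a *\<^sub>R e2 a) x vs = 0"
  shows "\<forall>a\<in>degs z \<times> vertices. k a = 0"
proof (rule independent_diagonal[OF _ assms])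
  fix x :: "real^4" and l :: 4 assume "x \<in> simplex3" "l \<noteq> 0"
  then show "\<exists>vs w. w \<noteq> 0 \<and> (\<forall>\<gamma> i. i \<noteq> 0 \<longrightarrow> e2 (\<gamma>, i) x vs = mnm \<gamma> x * (if i = l then w else 0))"
    by (intro exI[of _ "pr (edge (cyc l)) (edge (cyc (cyc l)))"] exI[of _ 1]) (auto simp: e2_edge)
qed

text \<open>Replaces a continuity argument: the coefficients in the basis already vanish. It lets
  identities that need division by coordinates be checked at interior points only.\<close>

lemma zero_interior:
  assumes "f \<in> PLam r 1 \<or> f \<in> PLam r 2" "\<And>x vs. x \<in> simplex3 \<Longrightarrow> (\<And>i. 0 < x$i) \<Longrightarrow> f x vs = 0"
  shows "f = 0"
proof -
  have fin: "finite (degs (int r) \<times> vertices)" by (simp add: finite_degs)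
  from assms(1) show ?thesis
  proof
    assume "f \<in> PLam r 1"
    from span_family_coords[OF fin this[unfolded PLam_1_basis]]
    obtain k where k: "f = (\<Sum>a\<in>degs (int r) \<times> vertices. k a *\<^sub>R e1 a)" ..
    have "\<forall>a\<in>degs (int r) \<times> vertices. k a = 0"
      by (rule independent_e1) (use assms(2) k in blast)
    then show ?thesis unfolding k by (intro sum.neutral) auto
  next
    assume "f \<in> PLam r 2"
    from span_family_coords[OF fin this[unfolded PLam_2_basis]]
    obtain k where k: "f = (\<Sum>a\<in>degs (int r) \<times> vertices. k a *\<^sub>R e2 a)" ..
    have "\<forall>a\<in>degs (int r) \<times> vertices. k a = 0"
      by (rule independent_e2) (use assms(2) k in blast)
    then show ?thesis unfolding k by (intro sum.neutral) auto
  qed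
qed

lemma rot_vertices: "a \<in> degs z \<times> vertices \<Longrightarrow> (rot (fst a), cyc (snd a)) \<in> degs z \<times> vertices"
  unfolding mem_Times_iff vertices_iff by simp

lemma inv_basis_PLam_1: "inv_basis_up_to_sign (PLam r 1)"
proof (rule inv_basis_permuted_family)
  show "finite (degs (int r) \<times> vertices)" by (simp add: finite_degs)
  show "span (e1 ` (degs (int r) \<times> vertices)) = PLam r 1" by (rule PLam_1_basis[symmetric])
  show "\<forall>a\<in>degs (int r) \<times> vertices. k a = 0"
    if "(\<Sum>a\<in>degs (int r) \<times> vertices. k a *\<^sub>R e1 a) = 0" for k
    by (rule independent_e1) (simp only: that zero_fun_apply)
  show "act \<pi> v \<in> PLam r 1" if "\<pi> permutes UNIV" "v \<in> PLam r 1" for \<pi> v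
    using act_stable that by blast
  show "(rot (fst a), cyc (snd a)) \<in> degs (int r) \<times> vertices \<and> act cyc (e1 a) = e1 (rot (fst a), cyc (snd a))"
    if "a \<in> degs (int r) \<times> vertices" for a
    using rot_vertices[OF that] by (simp add: e1_def case_prod_unfold act_cyc_mform act_forms)
qed

lemma inv_basis_PLam_2: "inv_basis_up_to_sign (PLam r 2)"
proof (rule inv_basis_permuted_family)
  show "finite (degs (int r) \<times> vertices)" by (simp add: finite_degs)
  show "span (e2 ` (degs (int r) \<times> vertices)) = PLam r 2" by (rule PLam_2_basis[symmetric])
  show "\<forall>a\<in>degs (int r) \<times> vertices. k a = 0"
    if "(\<Sum>a\<in>degs (int r) \<times> vertices. k a *\<^sub>R e2 a) = 0" for k
    by (rule independent_e2) (simp only: that zero_fun_apply)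
  show "act \<pi> v \<in> PLam r 2" if "\<pi> permutes UNIV" "v \<in> PLam r 2" for \<pi> v
    using act_stable that by blast
  show "(rot (fst a), cyc (snd a)) \<in> degs (int r) \<times> vertices \<and> act cyc (e2 a) = e2 (rot (fst a), cyc (snd a))"
    if "a \<in> degs (int r) \<times> vertices" for a
    using rot_vertices[OF that] by (simp add: e2_def case_prod_unfold act_cyc_mform act_om)
qed

section \<open>Trimmed 2-forms and trace-free 1-forms\<close>

lemma subspace_forms:
  "subspace (PLam r 1)" "subspace (PLam r 2)" "subspace (PmLam r 1)" "subspace (PmLam r 2)"
  unfolding PLam_1 PLam_2 PmLam_1 PmLam_2 by (rule subspace_span)+

lemma subspace_forms0:
  "subspace (PLam0 r 1)" "subspace (PLam0 r 2)" "subspace (PmLam0 r 1)" "subspace (PmLam0 r 2)"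
proof -
  have e: "PLam0 r k = PLam r k \<inter> {f. trace_free k f}" "PmLam0 r k = PmLam r k \<inter> {f. trace_free k f}" for k
    by (auto simp: PLam0_def PmLam0_def)
  show "subspace (PLam0 r 1)" "subspace (PLam0 r 2)" "subspace (PmLam0 r 1)" "subspace (PmLam0 r 2)"
    unfolding e by (rule subspace_inter[OF _ subspace_trace_free], rule subspace_forms)+
qed

lemma mnm_zero: "x $ j = 0 \<Longrightarrow> \<alpha> j \<noteq> 0 \<Longrightarrow> mnm \<alpha> x = 0"
  unfolding mnm_def by (intro prod_zero) auto

lemma cases_cyc:
  assumes "i \<noteq> 0"
  shows "j = 0 \<or> j = i \<or> j = cyc i \<or> j = cyc (cyc i)"
proof -
  have "\<forall>i j. i \<noteq> 0 \<longrightarrow> j = 0 \<or> j = i \<or> j = cyc i \<or> j = cyc (cyc i)" unfolding all_4 by simp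
  then show ?thesis using assms by blast
qed

lemma cyc_neq:
  assumes "i \<noteq> 0"
  shows "cyc i \<noteq> i" "cyc (cyc i) \<noteq> i" "cyc (cyc i) \<noteq> cyc i" "i \<noteq> cyc i" "i \<noteq> cyc (cyc i)" "cyc i \<noteq> cyc (cyc i)"
proof -
  have "\<forall>i. i \<noteq> 0 \<longrightarrow> cyc i \<noteq> i \<and> cyc (cyc i) \<noteq> i \<and> cyc (cyc i) \<noteq> cyc i" unfolding all_4 by simp
  then show "cyc i \<noteq> i" "cyc (cyc i) \<noteq> i" "cyc (cyc i) \<noteq> cyc i" "i \<noteq> cyc i" "i \<noteq> cyc (cyc i)" "cyc i \<noteq> cyc (cyc i)"
    using assms by metis+
qed

lemma sum_vertices_cyc:
  assumes "l \<noteq> 0"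
  shows "(\<Sum>i\<in>vertices. f i) = f l + f (cyc l) + f (cyc (cyc l))"
proof -
  have "\<forall>l. l \<noteq> 0 \<longrightarrow> (\<Sum>i\<in>vertices. f i) = f l + f (cyc l) + f (cyc (cyc l))"
    unfolding all_4 sum_vertices by (simp add: ac_simps)
  then show ?thesis using assms by blast
qed

text \<open>The Whitney 2-form of the face opposite to vertex i, with orientations chosen so that
  \<open>cyc\<close> permutes the four forms without signs.\<close>

definition wh :: "4 \<Rightarrow> form" where
  "wh i = (if i = 0 then whit2 1 2 3 else whit2 0 (cyc i) (cyc (cyc i)))"

lemma act_wh: "act cyc (wh i) = wh (cyc i)"
  by (auto simp: wh_def act_forms) (auto simp: form_defs fun_eq_iff algebra_simps)

text \<open>Contraction with X is linear, so it suffices to expand the constant 3-form; each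
  coefficient is its value on a triple of unit vectors, the first of them inserted as the
  point.\<close>

lemma whit2_expand:
  "whit2 i j k x vs = (\<Sum>l\<in>UNIV. (if l = 0 then whit2 i j k (axis 1 1) (pr (axis 2 1) (axis 3 1))
     else whit2 i j k (axis 0 1) (pr (axis (cyc l) 1) (axis (cyc (cyc l)) 1))) * wh l x vs)"
proof -
  have "\<forall>i j k. whit2 i j k x vs = (\<Sum>l\<in>UNIV. (if l = 0 then whit2 i j k (axis 1 1) (pr (axis 2 1) (axis 3 1))
     else whit2 i j k (axis 0 1) (pr (axis (cyc l) 1) (axis (cyc (cyc l)) 1))) * wh l x vs)"
    unfolding all_4 sum_4' wh_def whit2_def d2_def
    by (simp add: axis_nth') (simp add: algebra_simps)
  then show ?thesis by blast
qed

definition ewh :: "(4 \<Rightarrow> nat) \<times> 4 \<Rightarrow> form" where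
  "ewh = (\<lambda>(\<alpha>, i). mform 2 \<alpha> (wh i))"

text \<open>Contracting the volume form on R^4 twice with X gives zero, that is, the 0-th coordinate
  times \<open>wh 0\<close> equals the sum of the other coordinates times their \<open>wh l\<close>.
  So \<open>wh 0\<close> is needed only with monomials free of coordinate 0.\<close>

lemma ewh_0_incr: "ewh (incr 0 \<beta>, 0) = (\<Sum>l\<in>vertices. ewh (incr l \<beta>, l))"
  unfolding sum_vertices ewh_def prod.case
  by (rule mform_eqI) (auto simp: mform_apply mnm_incr wh_def form_defs algebra_simps)

lemma PmLam_2_basis:
  "PmLam r 2 = span (ewh ` {a \<in> degs (int r - 1) \<times> UNIV. snd a = 0 \<longrightarrow> fst a 0 = 0})"
  unfolding PmLam_2 span_eq
proof (intro conjI subsetI)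
  let ?A = "{a \<in> degs (int r - 1) \<times> UNIV. snd a = (0::4) \<longrightarrow> fst a 0 = 0}"
  have base: "ewh (\<alpha>, i) \<in> span (ewh ` ?A)" if \<alpha>: "\<alpha> \<in> degs (int r - 1)" for \<alpha> i
  proof (cases "i = 0 \<and> \<alpha> 0 \<noteq> 0")
    case False
    then show ?thesis using \<alpha> by (intro span_base imageI) auto
  next
    case True
    then obtain \<beta> where \<beta>: "\<alpha> = incr 0 \<beta>" using ex_incr[of \<alpha> 0] by blast
    have "incr l \<beta> \<in> degs (int r - 1)" for l using \<alpha> unfolding \<beta> incr_degs .
    moreover have "l \<in> vertices \<Longrightarrow> l \<noteq> 0" for l by (rule vertices_iff[THEN iffD1])
    ultimately have "(\<Sum>l\<in>vertices. ewh (incr l \<beta>, l)) \<in> span (ewh ` ?A)"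
      by (intro span_sum span_base imageI) auto
    then show ?thesis using True unfolding \<beta> by (simp only: ewh_0_incr)
  qed
  fix f assume "f \<in> {mform 2 \<alpha> (whit2 i j k) | \<alpha> i j k. \<alpha> \<in> degs (int r - 1)}"
  then obtain \<alpha> i j k where f: "f = mform 2 \<alpha> (whit2 i j k)" and \<alpha>: "\<alpha> \<in> degs (int r - 1)" by blast
  define c where "c l = (if l = 0 then whit2 i j k (axis 1 1) (pr (axis 2 1) (axis 3 1))
     else whit2 i j k (axis 0 1) (pr (axis (cyc l) 1) (axis (cyc (cyc l)) 1)))" for l
  have "f = (\<Sum>l\<in>UNIV. c l *\<^sub>R ewh (\<alpha>, l))"
    unfolding f
  proof (rule mform_eqI)
    fix x vs assume "x \<in> simplex3" and "\<forall>j<2::nat. vs j \<in> tangent3"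
    then show "mform 2 \<alpha> (whit2 i j k) x vs = (\<Sum>l\<in>UNIV. c l *\<^sub>R ewh (\<alpha>, l)) x vs"
      using whit2_expand[of i j k x vs]
      by (simp add: ewh_def mform_apply c_def[symmetric] sum_distrib_left mult.left_commute)
  qed (simp only: sum_fun_apply scaleR_fun_apply ewh_def prod.case mform_apply if_False, simp)
  also have "\<dots> \<in> span (ewh ` ?A)" by (intro span_sum span_scale base \<alpha>)
  finally show "f \<in> span (ewh ` ?A)" .
next
  fix f assume "f \<in> ewh ` {a \<in> degs (int r - 1) \<times> UNIV. snd a = 0 \<longrightarrow> fst a 0 = 0}"
  then have "f \<in> {mform 2 \<alpha> (whit2 i j k) | \<alpha> i j k. \<alpha> \<in> degs (int r - 1)}"
    by (auto simp: ewh_def wh_def; blast)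
  then show "f \<in> span {mform 2 \<alpha> (whit2 i j k) | \<alpha> i j k. \<alpha> \<in> degs (int r - 1)}" by (rule span_base)
qed

text \<open>In a form contracted with X the part of an argument along x drops out. On vectors from x
  towards vertices the values are thus linear in x, and the vectors are still tangent.\<close>

lemma wh_towards_vertices:
  assumes "l \<noteq> 0"
  shows "wh i x (pr (axis (cyc l) 1 - x) (axis (cyc (cyc l)) 1 - x)) = (if i = 0 then x $ l else if i = l then x $ 0 else 0)"
proof -
  have "\<forall>l i. l \<noteq> 0 \<longrightarrow> wh i x (pr (axis (cyc l) 1 - x) (axis (cyc (cyc l)) 1 - x)) =
      (if i = 0 then x $ l else if i = l then x $ 0 else 0)"
    unfolding all_4 wh_def whit2_def d2_def
    by (simp add: axis_nth') (simp add: algebra_simps)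
  then show ?thesis using assms by blast
qed

lemma inv_basis_PmLam_2: "inv_basis_up_to_sign (PmLam r 2)"
proof (rule inv_basis_permuted_family)
  let ?D = "degs (int r - 1)"
  let ?A = "{a \<in> ?D \<times> UNIV. snd a = (0::4) \<longrightarrow> fst a 0 = 0}"
  show fin: "finite ?A" by (simp add: finite_degs)
  show "span (ewh ` ?A) = PmLam r 2" by (rule PmLam_2_basis[symmetric])
  show "act \<pi> v \<in> PmLam r 2" if "\<pi> permutes UNIV" "v \<in> PmLam r 2" for \<pi> v
    using act_stable that by blast
  show "(rot (fst a), cyc (snd a)) \<in> ?A \<and> act cyc (ewh a) = ewh (rot (fst a), cyc (snd a))"
    if "a \<in> ?A" for a
    using that by (auto simp: ewh_def case_prod_unfold act_cyc_mform act_wh)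
  fix k assume zero: "(\<Sum>a\<in>?A. k a *\<^sub>R ewh a) = 0"
  define k' where "k' \<alpha> i = (if (\<alpha>, i) \<in> ?A then k (\<alpha>, i) else 0)" for \<alpha> i
  have ev: "x $ 0 * (\<Sum>\<alpha>\<in>?D. k' \<alpha> l * mnm \<alpha> x) + x $ l * (\<Sum>\<alpha>\<in>?D. k' \<alpha> 0 * mnm \<alpha> x) = 0"
    if x: "x \<in> simplex3" and l: "l \<noteq> 0" for x l
  proof -
    define vs where "vs = pr (axis (cyc l) 1 - x) (axis (cyc (cyc l)) 1 - x)"
    have e: "ewh (\<alpha>, i) x vs = mnm \<alpha> x * (if i = 0 then x $ l else if i = l then x $ 0 else 0)" for \<alpha> i
      unfolding ewh_def prod.case vs_def using x l by (simp add: mform_2 wh_towards_vertices del: mult_cancel_left)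
    have "0 = (\<Sum>a\<in>?A. k a * ewh a x vs)" using fun_cong[OF fun_cong[OF zero], of x vs] by simp
    also have "\<dots> = (\<Sum>a\<in>?D \<times> UNIV. k' (fst a) (snd a) * ewh a x vs)"
      by (rule sum.mono_neutral_cong_left) (auto simp: finite_degs k'_def)
    also have "\<dots> = (\<Sum>\<alpha>\<in>?D. \<Sum>i\<in>UNIV. k' \<alpha> i * ewh (\<alpha>, i) x vs)"
      by (simp only: sum.cartesian_product split_def prod.collapse)
    also have "\<dots> = (\<Sum>\<alpha>\<in>?D. \<Sum>i\<in>UNIV. (if i = 0 then k' \<alpha> 0 * mnm \<alpha> x * x $ l else 0) +
        (if i = l then k' \<alpha> l * mnm \<alpha> x * x $ 0 else 0))"
      by (intro sum.cong refl) (use l in \<open>auto simp: e\<close>)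
    also have "\<dots> = (\<Sum>\<alpha>\<in>?D. k' \<alpha> 0 * mnm \<alpha> x * x $ l + k' \<alpha> l * mnm \<alpha> x * x $ 0)"
      by (simp add: sum.distrib)
    finally show ?thesis by (simp add: sum.distrib sum_distrib_left ac_simps)
  qed
  \<comment> \<open>The face opposite to vertex 0 comes first: there only the \<open>wh 0\<close>
    terms survive in \<open>ev\<close>, and these carry exponents free of coordinate 0. Once they
    are gone, coordinate 0 can be cancelled in the interior.\<close>
  have k0: "k' \<alpha> 0 = 0" if "\<alpha> \<in> ?D" for \<alpha>
  proof (cases "\<alpha> 0 = 0")
    case True
    show ?thesis
    proof (rule mnm_independent_face[OF _ that True, of "\<lambda>\<alpha>. k' \<alpha> 0"])
      fix x :: "real^4" assume x: "x \<in> simplex3" "x $ 0 = 0" "\<And>j. j \<noteq> 0 \<Longrightarrow> 0 < x $ j"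
      have "x $ 1 \<noteq> 0" using x(3)[of 1] by simp
      then show "(\<Sum>\<alpha>\<in>?D. k' \<alpha> 0 * mnm \<alpha> x) = 0" using ev[OF x(1), of 1] x(2) by simp
    qed
  qed (simp add: k'_def)
  have kl: "k' \<alpha> l = 0" if "\<alpha> \<in> ?D" "l \<noteq> 0" for \<alpha> l
  proof (rule mnm_independent[OF _ that(1), of "\<lambda>\<alpha>. k' \<alpha> l"])
    fix x :: "real^4" assume x: "x \<in> simplex3" "\<And>i. 0 < x $ i"
    have "x $ 0 \<noteq> 0" using x(2)[of 0] by simp
    moreover have "(\<Sum>\<alpha>\<in>?D. k' \<alpha> 0 * mnm \<alpha> x) = 0" by (rule sum.neutral) (simp add: k0)
    ultimately show "(\<Sum>\<alpha>\<in>?D. k' \<alpha> l * mnm \<alpha> x) = 0" using ev[OF x(1) that(2)] by simp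
  qed
  show "\<forall>a\<in>?A. k a = 0"
  proof
    fix a assume a: "a \<in> ?A"
    then have "k a = k' (fst a) (snd a)" by (simp add: k'_def)
    also have "\<dots> = 0" using a k0[of "fst a"] kl[of "fst a" "snd a"] by (cases "snd a = 0") auto
    finally show "k a = 0" .
  qed
qed

section \<open>Trace-free 1-forms\<close>

lemma inv_basis_PLam0_1: "inv_basis_up_to_sign (PLam0 r 1)"
proof (rule inv_basis_permuted_family)
  let ?D = "degs (int r)"
  \<comment> \<open>The differential of the i-th coordinate vanishes along face i, so the monomial
    must contain every other coordinate. Monomials containing all four are paired only with i = 1,
    2, 3, because the four differentials add up to zero.\<close>
  let ?A = "{a \<in> ?D \<times> UNIV. (\<forall>j. fst a j = 0 \<longrightarrow> j = snd a) \<and> (snd a = (0::4) \<longrightarrow> fst a 0 = 0)}"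
  show fin: "finite ?A" by (simp add: finite_degs)
  show "act \<pi> v \<in> PLam0 r 1" if "\<pi> permutes UNIV" "v \<in> PLam0 r 1" for \<pi> v
    using act_stable_trace_free that by blast
  show "(rot (fst a), cyc (snd a)) \<in> ?A \<and> act cyc (e1 a) = e1 (rot (fst a), cyc (snd a))"
    if a: "a \<in> ?A" for a
  proof -
    have "j = cyc (snd a)" if "rot (fst a) j = 0" for j
    proof -
      have "fst a (cyc (cyc j)) = 0" using that by (simp add: rot_def inv_cyc)
      then have "cyc (cyc j) = snd a" using a by blast
      then show ?thesis by (metis cyc_cyc_cyc)
    qed
    then show ?thesis using a by (auto simp: e1_def case_prod_unfold act_cyc_mform act_forms)
  qed
  show "span (e1 ` ?A) = PLam0 r 1"
  proof
    have "subspace (PLam0 r 1)" by (rule subspace_forms0)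
    moreover have "e1 ` ?A \<subseteq> PLam0 r 1"
    proof clarify
      fix \<gamma> and i :: 4 assume \<gamma>: "\<gamma> \<in> ?D" and s: "\<forall>j. fst (\<gamma>, i) j = 0 \<longrightarrow> j = snd (\<gamma>, i)"
      have "e1 (\<gamma>, i) \<in> PLam r 1" unfolding PLam_1 using \<gamma> by (intro span_base) (auto simp: e1_def)
      moreover have "trace_free 1 (e1 (\<gamma>, i))"
        unfolding trace_free_def
      proof clarify
        fix j and x :: "real^4" and vs assume j: "x $ j = 0" "\<forall>n<1::nat. vs n \<in> tangent3 \<and> vs n $ j = 0"
        show "e1 (\<gamma>, i) x vs = 0"
          using j s mnm_zero[of x j \<gamma>] by (cases "\<gamma> j = 0") (auto simp: e1_def mform_apply d1_def)
      qed
      ultimately show "e1 (\<gamma>, i) \<in> PLam0 r 1" by (simp add: PLam0_def)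
    qed
    ultimately show "span (e1 ` ?A) \<subseteq> PLam0 r 1" by (intro span_minimal)
    show "PLam0 r 1 \<subseteq> span (e1 ` ?A)"
    proof
      fix f assume "f \<in> PLam0 r 1"
      then have f: "f \<in> PLam r 1" and tf: "trace_free 1 f" by (auto simp: PLam0_def)
      have "finite (?D \<times> vertices)" by (simp add: finite_degs)
      from span_family_coords[OF this f[unfolded PLam_1_basis]]
      obtain k where k: "f = (\<Sum>a\<in>?D \<times> vertices. k a *\<^sub>R e1 a)" ..
      then have fk: "f = (\<Sum>\<gamma>\<in>?D. \<Sum>l\<in>vertices. k (\<gamma>, l) *\<^sub>R e1 (\<gamma>, l))"
        by (simp only: sum.cartesian_product split_def prod.collapse)
      have ev: "f x (\<lambda>_. v) = (\<Sum>\<gamma>\<in>?D. (k (\<gamma>, 1) * v $ 1 + k (\<gamma>, 2) * v $ 2 + k (\<gamma>, 3) * v $ 3) * mnm \<gamma> x)"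
        if "x \<in> simplex3" "v \<in> tangent3" for x v
        unfolding fk sum_vertices using that by (simp add: e1_def mform_apply d1_def algebra_simps)
      \<comment> \<open>For j distinct from 0 and l the vector \<open>edge l\<close> is tangent to
        face j, and on that face it singles out the coefficients with index l.\<close>
      have k1: "k (\<gamma>, l) = 0" if \<gamma>: "\<gamma> \<in> ?D" and "l \<noteq> 0" "j \<noteq> 0" "l \<noteq> j" "\<gamma> j = 0" for \<gamma> l j
      proof (rule mnm_independent_face[OF _ \<gamma> \<open>\<gamma> j = 0\<close>, of "\<lambda>\<gamma>. k (\<gamma>, l)"])
        fix x :: "real^4" assume x: "x \<in> simplex3" "x $ j = 0"
        have "f x (\<lambda>_. edge l) = 0"
          using tf[unfolded trace_free_def, rule_format, of x j] x \<open>l \<noteq> j\<close> \<open>j \<noteq> 0\<close> by (simp add: edge_nth)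
        moreover have "\<forall>l. l \<noteq> 0 \<longrightarrow> f x (\<lambda>_. edge l) = (\<Sum>\<gamma>\<in>?D. k (\<gamma>, l) * mnm \<gamma> x)"
          unfolding all_4 using x by (simp add: ev edge_nth)
        ultimately show "(\<Sum>\<gamma>\<in>?D. k (\<gamma>, l) * mnm \<gamma> x) = 0" using \<open>l \<noteq> 0\<close> by simp
      qed
      \<comment> \<open>Face 0 contains the differences of edges. The three coefficients therefore
        agree, and the three terms combine to a multiple of the form with index 0.\<close>
      have k2: "k (\<gamma>, 1) - k (\<gamma>, l) = 0" if \<gamma>: "\<gamma> \<in> ?D" and l: "l = 2 \<or> l = 3" "\<gamma> 0 = 0" for \<gamma> l
      proof (rule mnm_independent_face[OF _ \<gamma> \<open>\<gamma> 0 = 0\<close>, of "\<lambda>\<gamma>. k (\<gamma>, 1) - k (\<gamma>, l)"])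
        fix x :: "real^4" assume x: "x \<in> simplex3" "x $ 0 = 0"
        have t: "edge 1 - edge l \<in> tangent3" "(edge 1 - edge l) $ 0 = 0"
          using edge_tangent[of 1] edge_tangent[of l] l
          by (auto simp: tangent3_def sum_subtractf edge_nth simp del: edge_tangent)
        have "f x (\<lambda>_. edge 1 - edge l) = 0"
          using tf[unfolded trace_free_def, rule_format, of x 0] x t by simp
        then show "(\<Sum>\<gamma>\<in>?D. (k (\<gamma>, 1) - k (\<gamma>, l)) * mnm \<gamma> x) = 0"
          using l ev[OF x(1) t(1)] by (auto simp: edge_nth)
      qed
      have "(\<Sum>l\<in>vertices. k (\<gamma>, l) *\<^sub>R e1 (\<gamma>, l)) \<in> span (e1 ` ?A)" if \<gamma>: "\<gamma> \<in> ?D" for \<gamma>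
      proof (cases "\<gamma> 0 = 0")
        case False
        have "k (\<gamma>, l) *\<^sub>R e1 (\<gamma>, l) \<in> span (e1 ` ?A)" if "l \<in> vertices" for l
        proof -
          have l0: "l \<noteq> 0" using that by (rule vertices_iff[THEN iffD1])
          show ?thesis
          proof (cases "\<forall>j. \<gamma> j = 0 \<longrightarrow> j = l")
            case True
            then show ?thesis using \<gamma> l0 False by (intro span_scale span_base imageI) auto
          next
            case False
            then obtain j where "\<gamma> j = 0" "j \<noteq> l" by blast
            moreover have "j \<noteq> 0" using \<open>\<gamma> 0 \<noteq> 0\<close> \<open>\<gamma> j = 0\<close> by auto
            ultimately have "k (\<gamma>, l) = 0" using k1[OF \<gamma> l0] by metis
            then show ?thesis by (simp add: span_zero)
          qed
        qed
        then show ?thesis by (rule span_sum)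
      next
        case True
        have eq: "k (\<gamma>, 2) = k (\<gamma>, 1)" "k (\<gamma>, 3) = k (\<gamma>, 1)" using k2[OF \<gamma> _ True, of 2] k2[OF \<gamma> _ True, of 3] by simp_all
        have "(\<Sum>l\<in>vertices. k (\<gamma>, l) *\<^sub>R e1 (\<gamma>, l)) = (- k (\<gamma>, 1)) *\<^sub>R e1 (\<gamma>, 0)"
          unfolding sum_vertices eq e1_def prod.case d1_0 by (simp add: e1_def algebra_simps)
        also have "\<dots> \<in> span (e1 ` ?A)"
        proof (cases "\<exists>j. j \<noteq> 0 \<and> \<gamma> j = 0")
          case True
          then obtain j where j: "j \<noteq> 0" "\<gamma> j = 0" by blast
          have "k (\<gamma>, cyc j) = 0" using k1[OF \<gamma> _ j(1) _ j(2), of "cyc j"] cyc_neq[OF j(1)] j(1) by simp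
          moreover have "cyc j \<in> vertices" by (rule vertices_iff[THEN iffD2]) (simp add: j)
          ultimately have "k (\<gamma>, 1) = 0" using eq by auto
          then show ?thesis by (simp add: span_zero)
        next
          case False
          then show ?thesis using \<gamma> True by (intro span_scale span_base imageI) auto
        qed
        finally show ?thesis .
      qed
      then show "f \<in> span (e1 ` ?A)" unfolding fk by (rule span_sum)
    qed
  qed
  fix k assume zero: "(\<Sum>a\<in>?A. k a *\<^sub>R e1 a) = 0"
  define k' where "k' \<gamma> i = (if (\<gamma>, i) \<in> ?A then k (\<gamma>, i) else 0)" for \<gamma> i
  have kl: "k' \<gamma> l - k' \<gamma> 0 = 0" if "\<gamma> \<in> ?D" "l \<noteq> 0" for \<gamma> l
  proof (rule mnm_independent[OF _ that(1), of "\<lambda>\<gamma>. k' \<gamma> l - k' \<gamma> 0"])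
    fix x :: "real^4" assume x: "x \<in> simplex3"
    have "0 = (\<Sum>a\<in>?A. k a * e1 a x (\<lambda>_. edge l))" using fun_cong[OF fun_cong[OF zero], of x] by simp
    also have "\<dots> = (\<Sum>a\<in>?D \<times> UNIV. k' (fst a) (snd a) * e1 a x (\<lambda>_. edge l))"
      by (rule sum.mono_neutral_cong_left) (auto simp: finite_degs k'_def)
    also have "\<dots> = (\<Sum>\<gamma>\<in>?D. \<Sum>i\<in>UNIV. k' \<gamma> i * e1 (\<gamma>, i) x (\<lambda>_. edge l))"
      by (simp only: sum.cartesian_product split_def prod.collapse)
    also have "\<dots> = (\<Sum>\<gamma>\<in>?D. \<Sum>i\<in>UNIV. (if i = l then k' \<gamma> l * mnm \<gamma> x else 0) - (if i = 0 then k' \<gamma> 0 * mnm \<gamma> x else 0))"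
      by (intro sum.cong refl) (use \<open>l \<noteq> 0\<close> x in \<open>auto simp: e1_edge edge_nth\<close>)
    finally show "(\<Sum>\<gamma>\<in>?D. (k' \<gamma> l - k' \<gamma> 0) * mnm \<gamma> x) = 0"
      by (simp add: sum_subtractf algebra_simps)
  qed
  show "\<forall>a\<in>?A. k a = 0"
  proof
    fix a assume a: "a \<in> ?A"
    then have "k a = k' (fst a) (snd a)" by (simp add: k'_def)
    also have "\<dots> = 0"
    \<comment> \<open>No exponent occurs both with index 0 and with another index: the former needs
      \<open>fst a 0 = 0\<close>, the latter excludes it.\<close>
    proof (cases "snd a = 0")
      case True
      have "(fst a, 1) \<notin> ?A" using a True by (auto intro!: exI[of _ 0])
      then have "k' (fst a) 1 = 0" by (simp only: k'_def if_False)
      then show ?thesis using kl[of "fst a" 1] a True by auto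
    next
      case False
      have "(fst a, 0) \<notin> ?A" using a False by auto
      then have "k' (fst a) 0 = 0" by (simp only: k'_def if_False)
      then show ?thesis using kl[of "fst a" "snd a"] a False by auto
    qed
    finally show "k a = 0" .
  qed
qed

section \<open>Trimmed trace-free forms\<close>

lemma PmLam_subset_PLam: "PmLam r 1 \<subseteq> PLam r 1" "PmLam r 2 \<subseteq> PLam r 2"
proof -
  show "PmLam r 1 \<subseteq> PLam r 1"
    unfolding PmLam_1
  proof (rule span_minimal[OF _ subspace_forms(1)], clarify)
    fix \<alpha> i j assume \<alpha>: "\<alpha> \<in> degs (int r - 1)"
    have "mform 1 (incr i \<alpha>) (d1 j) - mform 1 (incr j \<alpha>) (d1 i) \<in> PLam r 1"
      unfolding PLam_1 using \<alpha> incr_degs by (intro span_diff span_base) blast+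
    moreover have "mform 1 \<alpha> (whit1 i j) = mform 1 (incr i \<alpha>) (d1 j) - mform 1 (incr j \<alpha>) (d1 i)"
      by (rule mform_eqI) (auto simp: mform_apply mnm_incr form_defs algebra_simps)
    ultimately show "mform 1 \<alpha> (whit1 i j) \<in> PLam r 1" by simp
  qed
  show "PmLam r 2 \<subseteq> PLam r 2"
    unfolding PmLam_2
  proof (rule span_minimal[OF _ subspace_forms(2)], clarify)
    fix \<alpha> i j k assume \<alpha>: "\<alpha> \<in> degs (int r - 1)"
    have "mform 2 (incr i \<alpha>) (d2 j k) - mform 2 (incr j \<alpha>) (d2 i k) + mform 2 (incr k \<alpha>) (d2 i j) \<in> PLam r 2"
      unfolding PLam_2 using \<alpha> incr_degs by (intro span_add span_diff span_base) blast+
    moreover have "mform 2 \<alpha> (whit2 i j k) = mform 2 (incr i \<alpha>) (d2 j k) - mform 2 (incr j \<alpha>) (d2 i k) + mform 2 (incr k \<alpha>) (d2 i j)"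
      by (rule mform_eqI) (auto simp: mform_apply mnm_incr whit2_def algebra_simps)
    ultimately show "mform 2 \<alpha> (whit2 i j k) \<in> PLam r 2" by simp
  qed
qed

lemma hom_mform_eval:
  assumes "f \<in> span G"
    and G: "\<And>g. g \<in> G \<Longrightarrow> hom z (\<lambda>x. g x (vs x))"
  shows "hom z (\<lambda>x. f x (vs x))"
  using assms(1)
proof (induction rule: span_induct_alt)
  case base show ?case by (simp add: hom_zero)
next
  case (step c g y)
  then show ?case using hom_add[OF hom_scale[OF G[of g], of c] step(2)] by simp
qed

lemma hom_incr: "\<alpha> \<in> degs (z - 1) \<Longrightarrow> hom z (\<lambda>x. x $ i * mnm \<alpha> x)"
  by (rule hom_cong[OF hom_mnm[of "incr i \<alpha>" z]]) (simp_all add: incr_degs mnm_incr)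

text \<open>A general form of degree r would give degree r + 1 here, as the argument itself depends
  on x. For a contraction with X the part along x cancels.\<close>

lemma hom_PmLam_1:
  assumes "f \<in> PmLam r 1"
  shows "hom (int r) (\<lambda>x. f x (\<lambda>_. axis l 1 - x))"
  using assms unfolding PmLam_1
proof (rule hom_mform_eval, clarify)
  fix \<alpha> i j assume \<alpha>: "\<alpha> \<in> degs (int r - 1)"
  have "hom (int r) (\<lambda>x. axis l 1 $ j * (x $ i * mnm \<alpha> x) + (- axis l 1 $ i) * (x $ j * mnm \<alpha> x))"
    by (intro hom_add hom_scale hom_incr \<alpha>)
  then show "hom (int r) (\<lambda>x. mform 1 \<alpha> (whit1 i j) x (\<lambda>_. axis l 1 - x))"
    by (rule hom_cong) (simp add: mform_apply whit1_def algebra_simps)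
qed

lemma hom_PmLam_2:
  assumes "f \<in> PmLam r 2"
  shows "hom (int r) (\<lambda>x. f x (pr (axis l 1 - x) (axis m 1 - x)))"
  using assms unfolding PmLam_2
proof (rule hom_mform_eval, clarify)
  fix \<alpha> i j k assume \<alpha>: "\<alpha> \<in> degs (int r - 1)"
  let ?D = "\<lambda>i j. axis l 1 $ i * axis m 1 $ j - axis l 1 $ j * axis m 1 $ i :: real"
  have "hom (int r) (\<lambda>x. ?D j k * (x $ i * mnm \<alpha> x) + (- ?D i k) * (x $ j * mnm \<alpha> x) + ?D i j * (x $ k * mnm \<alpha> x))"
    by (intro hom_add hom_scale hom_incr \<alpha>)
  then show "hom (int r) (\<lambda>x. mform 2 \<alpha> (whit2 i j k) x (pr (axis l 1 - x) (axis m 1 - x)))"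
    by (rule hom_cong) (simp add: mform_2 whit2_def d2_def algebra_simps)
qed

lemma hom_divide_two:
  assumes "hom z p" "i \<noteq> j"
    and "\<And>x. x \<in> simplex3 \<Longrightarrow> x $ i = 0 \<or> x $ j = 0 \<Longrightarrow> p x = 0"
  obtains q where "hom (z - 2) q" "\<And>x. x \<in> simplex3 \<Longrightarrow> p x = x$i * (x$j * q x)"
proof -
  obtain q where q: "hom (z - 1) q" "\<And>x. x \<in> simplex3 \<Longrightarrow> p x = x$i * q x"
    using hom_divide_coordinate[OF assms(1), of i] assms(3) by metis
  have "q x = 0" if "x \<in> simplex3" "x $ j = 0" "\<And>l. l \<noteq> j \<Longrightarrow> 0 < x $ l" for x
    using q(2)[OF that(1)] assms(3)[OF that(1)] that(2) that(3)[OF assms(2)] by simp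
  then obtain q' where q': "hom (z - 1 - 1) q'" "\<And>x. x \<in> simplex3 \<Longrightarrow> q x = x$j * q' x"
    using hom_divide_coordinate[OF q(1), of j] by metis
  show ?thesis by (rule that[of q']) (use q q' in auto)
qed

text \<open>At an interior point the tangent space is spanned by the directions towards the vertices 1, 2, 3.\<close>

lemma PLam_1_zero_towards_vertices:
  assumes f: "f \<in> PLam r 1" and x: "x \<in> simplex3" "0 < x $ 0"
    and u: "\<And>l. l \<noteq> 0 \<Longrightarrow> f x (\<lambda>_. axis l 1 - x) = 0"
  shows "f x vs = 0"
proof -
  have "finite (degs (int r) \<times> vertices)" by (simp add: finite_degs)
  from span_family_coords[OF this f[unfolded PLam_1_basis]]
  obtain k where k: "f = (\<Sum>a\<in>degs (int r) \<times> vertices. k a *\<^sub>R e1 a)" ..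
  then have fk: "f = (\<Sum>\<gamma>\<in>degs (int r). \<Sum>l\<in>vertices. k (\<gamma>, l) *\<^sub>R e1 (\<gamma>, l))"
    by (simp only: sum.cartesian_product split_def prod.collapse)
  define b where "b l = (\<Sum>\<gamma>\<in>degs (int r). k (\<gamma>, l) * mnm \<gamma> x)" for l
  have ev: "f x vs = (if vs 0 \<in> tangent3 then b 1 * vs 0 $ 1 + b 2 * vs 0 $ 2 + b 3 * vs 0 $ 3 else 0)" for vs
    unfolding fk sum_vertices b_def using x
    by (simp add: e1_def mform_apply d1_def sum.distrib sum_distrib_left sum_distrib_right ac_simps)
  have s: "x $ 1 + x $ 2 + x $ 3 = 1 - x $ 0" using simplex3_sum[OF x(1)] by simp
  \<comment> \<open>The value towards vertex l is b l - \<beta>, so every b l equals \<beta>; then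
    \<beta> = \<beta> (1 - x $ 0).\<close>
  define \<beta> where "\<beta> = b 1 * x $ 1 + b 2 * x $ 2 + b 3 * x $ 3"
  have eq: "b 1 = \<beta>" "b 2 = \<beta>" "b 3 = \<beta>"
    using u[of 1] u[of 2] u[of 3] x by (simp_all add: ev axis_nth' \<beta>_def algebra_simps)
  have "\<beta> = \<beta> * (x $ 1 + x $ 2 + x $ 3)" using \<beta>_def unfolding eq by (simp add: algebra_simps)
  then have "\<beta> = 0" unfolding s using x(2) by (simp add: algebra_simps)
  then show ?thesis by (simp add: ev eq)
qed

lemma om_towards_vertices:
  assumes "x \<in> simplex3" "l \<noteq> 0"
  shows "om i x (pr (axis (cyc l) 1 - x) (axis (cyc (cyc l)) 1 - x)) = (if i = 0 then 0 else x $ l + (if i = l then x $ 0 else 0))"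
proof -
  have s: "x $ 0 = 1 - x $ 1 - x $ 2 - x $ 3" using simplex3_sum[OF assms(1)] by simp
  have "\<forall>l i. l \<noteq> 0 \<longrightarrow> om i x (pr (axis (cyc l) 1 - x) (axis (cyc (cyc l)) 1 - x)) =
      (if i = 0 then 0 else x $ l + (if i = l then x $ 0 else 0))"
    unfolding all_4 om_def d2_def by (simp add: axis_nth' s) (simp add: algebra_simps)
  then show ?thesis using assms by blast
qed

lemma PLam_2_zero_towards_vertices:
  assumes f: "f \<in> PLam r 2" and x: "x \<in> simplex3" "0 < x $ 0"
    and u: "\<And>l. l \<noteq> 0 \<Longrightarrow> f x (pr (axis (cyc l) 1 - x) (axis (cyc (cyc l)) 1 - x)) = 0"
  shows "f x vs = 0"
proof -
  have "finite (degs (int r) \<times> vertices)" by (simp add: finite_degs)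
  from span_family_coords[OF this f[unfolded PLam_2_basis]]
  obtain k where k: "f = (\<Sum>a\<in>degs (int r) \<times> vertices. k a *\<^sub>R e2 a)" ..
  then have fk: "f = (\<Sum>\<gamma>\<in>degs (int r). \<Sum>l\<in>vertices. k (\<gamma>, l) *\<^sub>R e2 (\<gamma>, l))"
    by (simp only: sum.cartesian_product split_def prod.collapse)
  define b where "b l = (\<Sum>\<gamma>\<in>degs (int r). k (\<gamma>, l) * mnm \<gamma> x)" for l
  have ev: "f x vs = b 1 * om 1 x vs + b 2 * om 2 x vs + b 3 * om 3 x vs" if "\<forall>j<2. vs j \<in> tangent3" for vs
    unfolding fk sum_vertices b_def using x that
    by (simp add: e2_def mform_apply sum.distrib sum_distrib_left sum_distrib_right ac_simps)
  have ev0: "f x vs = 0" if "\<not> (\<forall>j<2. vs j \<in> tangent3)"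
  proof -
    have c: "(x \<in> simplex3 \<and> (\<forall>j<2. vs j \<in> tangent3)) = False" using that by blast
    show ?thesis
      unfolding fk sum_fun_apply scaleR_fun_apply e2_def prod.case mform_apply c if_False by simp
  qed
  have t: "\<forall>j<2. pr (axis l 1 - x) (axis m 1 - x) j \<in> tangent3" for l m
    using x(1) by (simp add: pr_def)
  have s: "x $ 1 + x $ 2 + x $ 3 = 1 - x $ 0" using simplex3_sum[OF x(1)] by simp
  \<comment> \<open>Each direction pair gives x $ 0 * b l + x $ l * \<beta> = 0. Adding the three
    equations yields \<beta> = 0, as the coordinates add up to 1.\<close>
  define \<beta> where "\<beta> = b 1 + b 2 + b 3"
  have "\<forall>l. l \<noteq> 0 \<longrightarrow> x $ 0 * b l + x $ l * \<beta> = 0"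
  proof (intro allI impI)
    fix l :: 4 assume l: "l \<noteq> 0"
    have "b 1 * om 1 x (pr (axis (cyc l) 1 - x) (axis (cyc (cyc l)) 1 - x)) +
        b 2 * om 2 x (pr (axis (cyc l) 1 - x) (axis (cyc (cyc l)) 1 - x)) +
        b 3 * om 3 x (pr (axis (cyc l) 1 - x) (axis (cyc (cyc l)) 1 - x)) = 0"
      using u[OF l] ev[OF t] by simp
    moreover have "l = 1 \<or> l = 2 \<or> l = 3" using vertices_iff[of l] l by auto
    ultimately show "x $ 0 * b l + x $ l * \<beta> = 0"
      unfolding om_towards_vertices[OF x(1) l] by (auto simp: \<beta>_def algebra_simps)
  qed
  then have e: "x $ 0 * b 1 + x $ 1 * \<beta> = 0" "x $ 0 * b 2 + x $ 2 * \<beta> = 0" "x $ 0 * b 3 + x $ 3 * \<beta> = 0"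
    by (simp_all add: all_4)
  then have "x $ 0 * \<beta> + (x $ 1 + x $ 2 + x $ 3) * \<beta> = 0" by (simp add: \<beta>_def algebra_simps)
  then have "\<beta> = 0" unfolding s by (simp add: algebra_simps)
  then have "b 1 = 0" "b 2 = 0" "b 3 = 0" using e x(2) by auto
  then show ?thesis using ev[of vs] ev0 by (cases "\<forall>j<2. vs j \<in> tangent3") auto
qed

text \<open>The Whitney form of the edge from 0 to i has zero trace on faces 0 and i; the two
  further coordinates kill it on the others. The edges through vertex 0 suffice.\<close>

definition ew1 :: "(4 \<Rightarrow> nat) \<times> 4 \<Rightarrow> form" where
  "ew1 = (\<lambda>(\<alpha>, i). mform 1 (incr (cyc i) (incr (cyc (cyc i)) \<alpha>)) (whit1 0 i))"

text \<open>\<open>wh i\<close> has zero trace on all faces except face i, where the extra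
  coordinate vanishes.\<close>

definition ew2 :: "(4 \<Rightarrow> nat) \<times> 4 \<Rightarrow> form" where
  "ew2 = (\<lambda>(\<alpha>, i). mform 2 (incr i \<alpha>) (wh i))"

lemma ew1_eval:
  assumes "x \<in> simplex3" "l \<noteq> 0"
  shows "ew1 (\<alpha>, i) x (\<lambda>_. axis l 1 - x) = mnm \<alpha> x * (if i = l then x $ cyc l * x $ cyc (cyc l) * x $ 0 else 0)"
  using assms by (simp add: ew1_def mform_apply mnm_incr whit1_def axis_nth') (simp add: algebra_simps)

lemma ew2_eval:
  assumes "x \<in> simplex3" "l \<noteq> 0" "i \<noteq> 0"
  shows "ew2 (\<alpha>, i) x (pr (axis (cyc l) 1 - x) (axis (cyc (cyc l)) 1 - x)) = mnm \<alpha> x * (if i = l then x $ l * x $ 0 else 0)"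
  using assms by (simp add: ew2_def mform_2 mnm_incr wh_towards_vertices)

lemma ew1_in:
  assumes "\<alpha> \<in> degs (int r - 3)" "i \<noteq> 0"
  shows "ew1 (\<alpha>, i) \<in> PmLam0 r 1"
proof -
  have "incr (cyc i) (incr (cyc (cyc i)) \<alpha>) \<in> degs (int r - 1)"
    using assms by (simp add: incr_degs)
  then have "ew1 (\<alpha>, i) \<in> PmLam r 1"
    unfolding PmLam_1 by (intro span_base) (auto simp: ew1_def)
  moreover have "trace_free 1 (ew1 (\<alpha>, i))"
    unfolding trace_free_def
  proof clarify
    fix j and x :: "real^4" and vs assume "x $ j = 0" "\<forall>n<1::nat. vs n \<in> tangent3 \<and> vs n $ j = 0"
    then show "ew1 (\<alpha>, i) x vs = 0"
      using cases_cyc[OF assms(2), of j] by (auto simp: ew1_def mform_apply mnm_incr whit1_def)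
  qed
  ultimately show ?thesis by (simp add: PmLam0_def)
qed

lemma ew2_in:
  assumes "\<alpha> \<in> degs (int r - 2)" "i \<noteq> 0"
  shows "ew2 (\<alpha>, i) \<in> PmLam0 r 2"
proof -
  have "incr i \<alpha> \<in> degs (int r - 1)"
    using assms by (simp add: incr_degs)
  then have "ew2 (\<alpha>, i) \<in> PmLam r 2"
    unfolding PmLam_2 using assms(2) by (intro span_base) (auto simp: ew2_def wh_def)
  moreover have "trace_free 2 (ew2 (\<alpha>, i))"
    unfolding trace_free_def
  proof clarify
    fix j and x :: "real^4" and vs assume *: "x $ j = 0" "\<forall>n<2::nat. vs n \<in> tangent3 \<and> vs n $ j = 0"
    then have "vs 0 $ j = 0" "vs 1 $ j = 0" by auto
    then show "ew2 (\<alpha>, i) x vs = 0"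
      using cases_cyc[OF assms(2), of j] assms(2) *(1)
      by (auto simp: ew2_def mform_apply mnm_incr wh_def whit2_def d2_def)
  qed
  ultimately show ?thesis by (simp add: PmLam0_def)
qed

lemma inv_basis_PmLam0_1: "inv_basis_up_to_sign (PmLam0 r 1)"
proof (rule inv_basis_permuted_family)
  let ?D = "degs (int r - 3)"
  let ?A = "?D \<times> vertices"
  show fin: "finite ?A" by (simp add: finite_degs)
  show "act \<pi> v \<in> PmLam0 r 1" if "\<pi> permutes UNIV" "v \<in> PmLam0 r 1" for \<pi> v
    using act_stable_trace_free that by blast
  show "(rot (fst a), cyc (snd a)) \<in> ?A \<and> act cyc (ew1 a) = ew1 (rot (fst a), cyc (snd a))"
    if a: "a \<in> ?A" for a
    using rot_vertices[OF that] by (simp add: ew1_def case_prod_unfold act_cyc_mform act_forms rot_incr)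
  show "\<forall>a\<in>?A. k a = 0" if "(\<Sum>a\<in>?A. k a *\<^sub>R ew1 a) = 0" for k
  proof (rule independent_diagonal)
    fix x :: "real^4" and l :: 4 assume x: "x \<in> simplex3" "\<And>i. 0 < x $ i" and l: "l \<noteq> 0"
    have "x $ cyc l * x $ cyc (cyc l) * x $ 0 \<noteq> 0"
      using x(2)[of "cyc l"] x(2)[of "cyc (cyc l)"] x(2)[of 0] by simp
    then show "\<exists>vs w. w \<noteq> 0 \<and> (\<forall>\<gamma> i. i \<noteq> 0 \<longrightarrow> ew1 (\<gamma>, i) x vs = mnm \<gamma> x * (if i = l then w else 0))"
      using ew1_eval[OF x(1) l] by blast
  qed (simp only: that zero_fun_apply)
  show "span (ew1 ` ?A) = PmLam0 r 1"
  proof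
    show "span (ew1 ` ?A) \<subseteq> PmLam0 r 1"
    proof (rule span_minimal[OF _ subspace_forms0(3)], clarify)
      fix \<alpha> and i :: 4 assume "\<alpha> \<in> ?D" "i \<in> vertices"
      then show "ew1 (\<alpha>, i) \<in> PmLam0 r 1" by (intro ew1_in) (simp, rule vertices_iff[THEN iffD1])
    qed
    show "PmLam0 r 1 \<subseteq> span (ew1 ` ?A)"
    proof
      fix f assume "f \<in> PmLam0 r 1"
      then have f: "f \<in> PmLam r 1" and tf: "trace_free 1 f" by (auto simp: PmLam0_def)
      define u where "u l x = f x (\<lambda>_. axis l 1 - x)" for l x
      have "\<exists>\<kappa>. \<forall>x\<in>simplex3. u l x = x $ cyc l * x $ cyc (cyc l) * x $ 0 * (\<Sum>\<alpha>\<in>?D. \<kappa> \<alpha> * mnm \<alpha> x)"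
        if l: "l \<noteq> 0" for l
      proof -
        have h: "hom (int r) (u l)" unfolding u_def by (rule hom_PmLam_1[OF f])
        \<comment> \<open>The direction towards vertex l is tangent to every face that contains this
          vertex. So u l vanishes on three faces, and dividing by their coordinates leaves
          coefficients of degree r - 3.\<close>
        have z: "u l x = 0" if "x \<in> simplex3" "x $ j = 0" "j \<noteq> l" for x j
          unfolding u_def using tf[unfolded trace_free_def, rule_format, of x j] that by (simp add: axis_nth')
        obtain q where q: "hom (int r - 2) q" "\<And>x. x \<in> simplex3 \<Longrightarrow> u l x = x $ cyc l * (x $ cyc (cyc l) * q x)"
          using hom_divide_two[OF h, of "cyc l" "cyc (cyc l)"] z cyc_neq[OF l] by metis
        have "q x = 0" if x: "x \<in> simplex3" "x $ 0 = 0" "\<And>j. j \<noteq> 0 \<Longrightarrow> 0 < x $ j" for x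
        proof -
          have "0 < x $ cyc l" "0 < x $ cyc (cyc l)" using x(3) l by simp_all
          then show ?thesis using q(2)[OF x(1)] z[OF x(1,2)] l by simp
        qed
        then obtain p where p: "hom (int r - 2 - 1) p" "\<And>x. x \<in> simplex3 \<Longrightarrow> q x = x $ 0 * p x"
          using hom_divide_coordinate[OF q(1), of 0] by metis
        then obtain \<kappa> where "\<forall>x\<in>simplex3. p x = (\<Sum>\<alpha>\<in>?D. \<kappa> \<alpha> * mnm \<alpha> x)"
          unfolding hom_def by auto
        then show ?thesis using q(2) p(2) by (intro exI[of _ \<kappa>]) simp
      qed
      then have "\<forall>l. \<exists>\<kappa>. l \<noteq> 0 \<longrightarrow> (\<forall>x\<in>simplex3. u l x = x $ cyc l * x $ cyc (cyc l) * x $ 0 * (\<Sum>\<alpha>\<in>?D. \<kappa> \<alpha> * mnm \<alpha> x))"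
        by blast
      from choice[OF this] obtain \<kappa> where
        \<kappa>: "\<And>l x. l \<noteq> 0 \<Longrightarrow> x \<in> simplex3 \<Longrightarrow> u l x = x $ cyc l * x $ cyc (cyc l) * x $ 0 * (\<Sum>\<alpha>\<in>?D. \<kappa> l \<alpha> * mnm \<alpha> x)"
        by blast
      define g where "g = (\<Sum>a\<in>?A. \<kappa> (snd a) (fst a) *\<^sub>R ew1 a)"
      have gs: "g \<in> span (ew1 ` ?A)" unfolding g_def by (intro span_sum span_scale span_base imageI)
      then have "g \<in> PmLam r 1" using \<open>span (ew1 ` ?A) \<subseteq> PmLam0 r 1\<close> by (auto simp: PmLam0_def)
      then have fg: "f - g \<in> PLam r 1"
        using f PmLam_subset_PLam(1) subspace_diff[OF subspace_forms(1)] by blast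
      have g_eval: "g x (\<lambda>_. axis l 1 - x) = u l x" if x: "x \<in> simplex3" and l: "l \<noteq> 0" for x l
      proof -
        have "g x (\<lambda>_. axis l 1 - x) = (\<Sum>\<alpha>\<in>?D. \<Sum>i\<in>vertices. \<kappa> i \<alpha> * ew1 (\<alpha>, i) x (\<lambda>_. axis l 1 - x))"
          unfolding g_def by (simp only: sum.cartesian_product split_def prod.collapse sum_fun_apply scaleR_fun_apply real_scaleR_def)
        also have "\<dots> = (\<Sum>\<alpha>\<in>?D. \<kappa> l \<alpha> * (mnm \<alpha> x * (x $ cyc l * x $ cyc (cyc l) * x $ 0)))"
          unfolding sum_vertices_cyc[OF l] using cyc_neq[OF l] by (simp add: ew1_eval[OF x l])
        also have "\<dots> = u l x" unfolding \<kappa>[OF l x] by (simp add: sum_distrib_left ac_simps)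
        finally show ?thesis .
      qed
      have "f - g = 0"
      proof (rule zero_interior)
        fix x :: "real^4" and vs assume x: "x \<in> simplex3" "\<And>i. 0 < x $ i"
        show "(f - g) x vs = 0"
          by (rule PLam_1_zero_towards_vertices[OF fg x]) (simp add: g_eval[OF x(1)] u_def)
      qed (use fg in blast)
      then show "f \<in> span (ew1 ` ?A)" using gs by simp
    qed
  qed
qed

lemma inv_basis_PmLam0_2: "inv_basis_up_to_sign (PmLam0 r 2)"
proof (rule inv_basis_permuted_family)
  let ?D = "degs (int r - 2)"
  let ?A = "?D \<times> vertices"
  show fin: "finite ?A" by (simp add: finite_degs)
  show "act \<pi> v \<in> PmLam0 r 2" if "\<pi> permutes UNIV" "v \<in> PmLam0 r 2" for \<pi> v
    using act_stable_trace_free that by blast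
  show "(rot (fst a), cyc (snd a)) \<in> ?A \<and> act cyc (ew2 a) = ew2 (rot (fst a), cyc (snd a))"
    if a: "a \<in> ?A" for a
    using rot_vertices[OF that] by (simp add: ew2_def case_prod_unfold act_cyc_mform act_wh rot_incr)
  show "\<forall>a\<in>?A. k a = 0" if "(\<Sum>a\<in>?A. k a *\<^sub>R ew2 a) = 0" for k
  proof (rule independent_diagonal)
    fix x :: "real^4" and l :: 4 assume x: "x \<in> simplex3" "\<And>i. 0 < x $ i" and l: "l \<noteq> 0"
    have "x $ l * x $ 0 \<noteq> 0"
      using x(2)[of l] x(2)[of 0] by simp
    then show "\<exists>vs w. w \<noteq> 0 \<and> (\<forall>\<gamma> i. i \<noteq> 0 \<longrightarrow> ew2 (\<gamma>, i) x vs = mnm \<gamma> x * (if i = l then w else 0))"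
      using ew2_eval[OF x(1) l] by blast
  qed (simp only: that zero_fun_apply)
  show "span (ew2 ` ?A) = PmLam0 r 2"
  proof
    show "span (ew2 ` ?A) \<subseteq> PmLam0 r 2"
    proof (rule span_minimal[OF _ subspace_forms0(4)], clarify)
      fix \<alpha> and i :: 4 assume "\<alpha> \<in> ?D" "i \<in> vertices"
      then show "ew2 (\<alpha>, i) \<in> PmLam0 r 2" by (intro ew2_in) (simp, rule vertices_iff[THEN iffD1])
    qed
    show "PmLam0 r 2 \<subseteq> span (ew2 ` ?A)"
    proof
      fix f assume "f \<in> PmLam0 r 2"
      then have f: "f \<in> PmLam r 2" and tf: "trace_free 2 f" by (auto simp: PmLam0_def)
      define u where "u l x = f x (pr (axis (cyc l) 1 - x) (axis (cyc (cyc l)) 1 - x))" for l x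
      have "\<exists>\<kappa>. \<forall>x\<in>simplex3. u l x = x $ l * x $ 0 * (\<Sum>\<alpha>\<in>?D. \<kappa> \<alpha> * mnm \<alpha> x)"
        if l: "l \<noteq> 0" for l
      proof -
        have h: "hom (int r) (u l)" unfolding u_def by (rule hom_PmLam_2[OF f])
        \<comment> \<open>The faces l and 0 contain both vertices \<open>cyc l\<close> and
          \<open>cyc (cyc l)\<close>, so both directions are tangent to them; the quotient has
          degree r - 2.\<close>
        have z: "u l x = 0" if "x \<in> simplex3" "x $ j = 0" "j = l \<or> j = 0" for x j
        proof -
          have "cyc l \<noteq> j" "cyc (cyc l) \<noteq> j" using that(3) cyc_neq[OF l] l by auto
          then show ?thesis
            unfolding u_def using tf[unfolded trace_free_def, rule_format, of x j] that(1,2)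
            by (simp add: axis_nth' pr_def)
        qed
        obtain q where q: "hom (int r - 2) q" "\<And>x. x \<in> simplex3 \<Longrightarrow> u l x = x $ l * (x $ 0 * q x)"
          using hom_divide_two[OF h l] z by metis
        then obtain \<kappa> where "\<forall>x\<in>simplex3. q x = (\<Sum>\<alpha>\<in>?D. \<kappa> \<alpha> * mnm \<alpha> x)"
          unfolding hom_def by auto
        then show ?thesis using q(2) by (intro exI[of _ \<kappa>]) simp
      qed
      then have "\<forall>l. \<exists>\<kappa>. l \<noteq> 0 \<longrightarrow> (\<forall>x\<in>simplex3. u l x = x $ l * x $ 0 * (\<Sum>\<alpha>\<in>?D. \<kappa> \<alpha> * mnm \<alpha> x))"
        by blast
      from choice[OF this] obtain \<kappa> where
        \<kappa>: "\<And>l x. l \<noteq> 0 \<Longrightarrow> x \<in> simplex3 \<Longrightarrow> u l x = x $ l * x $ 0 * (\<Sum>\<alpha>\<in>?D. \<kappa> l \<alpha> * mnm \<alpha> x)"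
        by blast
      define g where "g = (\<Sum>a\<in>?A. \<kappa> (snd a) (fst a) *\<^sub>R ew2 a)"
      have gs: "g \<in> span (ew2 ` ?A)" unfolding g_def by (intro span_sum span_scale span_base imageI)
      then have "g \<in> PmLam r 2" using \<open>span (ew2 ` ?A) \<subseteq> PmLam0 r 2\<close> by (auto simp: PmLam0_def)
      then have fg: "f - g \<in> PLam r 2"
        using f PmLam_subset_PLam(2) subspace_diff[OF subspace_forms(2)] by blast
      have g_eval: "g x (pr (axis (cyc l) 1 - x) (axis (cyc (cyc l)) 1 - x)) = u l x" if x: "x \<in> simplex3" and l: "l \<noteq> 0" for x l
      proof -
        have "g x (pr (axis (cyc l) 1 - x) (axis (cyc (cyc l)) 1 - x)) =
            (\<Sum>\<alpha>\<in>?D. \<Sum>i\<in>vertices. \<kappa> i \<alpha> * ew2 (\<alpha>, i) x (pr (axis (cyc l) 1 - x) (axis (cyc (cyc l)) 1 - x)))"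
          unfolding g_def by (simp only: sum.cartesian_product split_def prod.collapse sum_fun_apply scaleR_fun_apply real_scaleR_def)
        also have "\<dots> = (\<Sum>\<alpha>\<in>?D. \<kappa> l \<alpha> * (mnm \<alpha> x * (x $ l * x $ 0)))"
          unfolding sum_vertices_cyc[OF l] using cyc_neq[OF l] l by (simp add: ew2_eval[OF x l])
        also have "\<dots> = u l x" unfolding \<kappa>[OF l x] by (simp add: sum_distrib_left ac_simps)
        finally show ?thesis .
      qed
      have "f - g = 0"
      proof (rule zero_interior)
        fix x :: "real^4" and vs assume x: "x \<in> simplex3" "\<And>i. 0 < x $ i"
        show "(f - g) x vs = 0"
          by (rule PLam_2_zero_towards_vertices[OF fg x]) (simp add: g_eval[OF x(1)] u_def)
      qed (use fg in blast)
      then show "f \<in> span (ew2 ` ?A)" using gs by simp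
    qed
  qed
qed

section \<open>Syzygies of the coordinates\<close>

text \<open>A base point in the support of the exponent. The index 0 is preferred, as a base point
  fixed by \<open>cyc\<close> causes no diagonal entries.\<close>

definition sel :: "(4 \<Rightarrow> nat) \<Rightarrow> 4" where
  "sel \<gamma> = (if \<gamma> 0 \<noteq> 0 then 0 else if \<gamma> 1 \<noteq> 0 then 1 else if \<gamma> 2 \<noteq> 0 then 2 else 3)"

lemma sel_nonzero: "\<gamma> i \<noteq> 0 \<Longrightarrow> \<gamma> (sel \<gamma>) \<noteq> 0"
proof -
  have "\<forall>i. \<gamma> i \<noteq> 0 \<longrightarrow> \<gamma> (sel \<gamma>) \<noteq> 0" unfolding all_4 by (simp add: sel_def)
  then show "\<gamma> i \<noteq> 0 \<Longrightarrow> ?thesis" by blast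
qed

text \<open>Both spaces for which the answer depends on r are spaces of linear syzygies of the
  coordinates: they are spanned by vectors \<open>\<kappa> \<gamma> i j\<close>, standing for
  \<open>\<lambda>\<^sup>\<gamma> (e\<^sub>j / \<lambda>\<^sub>j - e\<^sub>i / \<lambda>\<^sub>i)\<close>. Only the monomial
  \<open>(\<lambda>\<^sub>1 \<lambda>\<^sub>2 \<lambda>\<^sub>3)\<^sup>b\<close> contributes to the trace of the 3-cycle, and it contributes -1.\<close>

lemma inv_basis_syzygies:
  fixes \<kappa> :: "(4 \<Rightarrow> nat) \<Rightarrow> 4 \<Rightarrow> 4 \<Rightarrow> form" and n :: int
  assumes V: "V = span {\<kappa> \<gamma> i j | \<gamma> i j. \<gamma> \<in> degs n \<and> \<gamma> i \<noteq> 0 \<and> \<gamma> j \<noteq> 0}"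
    and trans: "\<And>\<gamma> i j k. \<gamma> \<in> degs n \<Longrightarrow> \<gamma> i \<noteq> 0 \<Longrightarrow> \<gamma> j \<noteq> 0 \<Longrightarrow> \<gamma> k \<noteq> 0 \<Longrightarrow> \<kappa> \<gamma> i j + \<kappa> \<gamma> j k = \<kappa> \<gamma> i k"
    and cyc: "\<And>\<gamma> i j. act cyc (\<kappa> \<gamma> i j) = \<kappa> (rot \<gamma>) (cyc i) (cyc j)"
    and L: "\<And>x l. x \<in> simplex3 \<Longrightarrow> (\<And>i. 0 < x $ i) \<Longrightarrow> l \<noteq> 0 \<Longrightarrow> \<exists>w vs. w \<noteq> 0 \<and> (\<forall>\<gamma> i j. \<gamma> i \<noteq> 0 \<longrightarrow> \<gamma> j \<noteq> 0 \<longrightarrow>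
       \<kappa> \<gamma> i j x vs = w * (mnm \<gamma> x * ((if j = l then 1 else 0) - (if i = l then 1 else 0))))"
    and stable: "\<And>\<pi> v. \<pi> permutes UNIV \<Longrightarrow> v \<in> V \<Longrightarrow> act \<pi> v \<in> V"
  shows "inv_basis_up_to_sign V \<longleftrightarrow> \<not> (3 dvd n \<and> 0 < n)"
proof -
  \<comment> \<open>For each exponent a star: the base point is joined to every other point of the
    support.\<close>
  define A where "A = {a \<in> degs n \<times> UNIV. fst a (snd a) \<noteq> 0 \<and> snd a \<noteq> sel (fst a)}"
  define e where "e = (\<lambda>(\<gamma>, i). \<kappa> \<gamma> (sel \<gamma>) i)"
  have fin: "finite A" by (simp add: A_def finite_degs)
  have refl0: "\<kappa> \<gamma> i i = 0" if "\<gamma> \<in> degs n" "\<gamma> i \<noteq> 0" for \<gamma> i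
    using trans[OF that that(2) that(2)] by simp
  have sel0: "e (\<gamma>, sel \<gamma>) = 0" if "\<gamma> \<in> degs n" "\<gamma> i \<noteq> 0" for \<gamma> i
    using refl0[of \<gamma> "sel \<gamma>"] that sel_nonzero[of \<gamma> i] by (simp add: e_def)
  have diff: "\<kappa> \<gamma> i j = e (\<gamma>, j) - e (\<gamma>, i)" if "\<gamma> \<in> degs n" "\<gamma> i \<noteq> 0" "\<gamma> j \<noteq> 0" for \<gamma> i j
    using trans[of \<gamma> "sel \<gamma>" i j] that sel_nonzero[of \<gamma> i] by (simp add: e_def algebra_simps)
  have sp: "span (e ` A) = V"
    unfolding V span_eq
  proof (intro conjI subsetI)
    fix f assume "f \<in> e ` A"
    then have "f \<in> {\<kappa> \<gamma> i j | \<gamma> i j. \<gamma> \<in> degs n \<and> \<gamma> i \<noteq> 0 \<and> \<gamma> j \<noteq> 0}"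
      using sel_nonzero by (auto simp: e_def A_def) blast
    then show "f \<in> span {\<kappa> \<gamma> i j | \<gamma> i j. \<gamma> \<in> degs n \<and> \<gamma> i \<noteq> 0 \<and> \<gamma> j \<noteq> 0}" by (rule span_base)
  next
    fix f assume "f \<in> {\<kappa> \<gamma> i j | \<gamma> i j. \<gamma> \<in> degs n \<and> \<gamma> i \<noteq> 0 \<and> \<gamma> j \<noteq> 0}"
    then obtain \<gamma> i j where f: "f = \<kappa> \<gamma> i j" and g: "\<gamma> \<in> degs n" "\<gamma> i \<noteq> 0" "\<gamma> j \<noteq> 0" by blast
    have "e (\<gamma>, m) \<in> span (e ` A)" if "\<gamma> m \<noteq> 0" for m
    proof (cases "m = sel \<gamma>")
      case True
      then show ?thesis using sel0[OF g(1,2)] by (simp add: span_zero)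
    next
      case False
      then show ?thesis using that g(1) by (intro span_base imageI) (simp add: A_def)
    qed
    then show "f \<in> span (e ` A)" unfolding f diff[OF g] using g by (intro span_diff) auto
  qed
  have ind: "\<forall>a\<in>A. k a = 0" if zero: "(\<Sum>a\<in>A. k a *\<^sub>R e a) = 0" for k
  proof
    fix a assume a: "a \<in> A"
    obtain \<gamma> l where al: "a = (\<gamma>, l)" by (cases a)
    have \<gamma>: "\<gamma> \<in> degs n" and l: "\<gamma> l \<noteq> 0" "l \<noteq> sel \<gamma>" using a by (auto simp: A_def al)
    have l0: "l \<noteq> 0" using l by (auto simp: sel_def)
    define k' where "k' \<gamma> i = (if (\<gamma>, i) \<in> A then k (\<gamma>, i) else 0)" for \<gamma> i
    define K where "K \<gamma> = (\<Sum>i\<in>UNIV. k' \<gamma> i * ((if i = l then 1 else 0) - (if sel \<gamma> = l then 1 else 0)))" for \<gamma>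
    have "K \<gamma> = 0"
    proof (rule mnm_independent[OF _ \<gamma>])
      fix x :: "real^4" assume x: "x \<in> simplex3" "\<And>i. 0 < x $ i"
      from L[OF x l0] obtain w vs where w: "w \<noteq> 0" and ev: "\<And>\<gamma> i j. \<gamma> i \<noteq> 0 \<Longrightarrow> \<gamma> j \<noteq> 0 \<Longrightarrow>
         \<kappa> \<gamma> i j x vs = w * (mnm \<gamma> x * ((if j = l then 1 else 0) - (if i = l then 1 else 0)))" by blast
      have eA: "e (\<gamma>, i) x vs = w * (mnm \<gamma> x * ((if i = l then 1 else 0) - (if sel \<gamma> = l then 1 else 0)))"
        if "(\<gamma>, i) \<in> A" for \<gamma> i
        using ev[of \<gamma> "sel \<gamma>" i] that sel_nonzero[of \<gamma> i] by (simp add: e_def A_def)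
      have "0 = (\<Sum>a\<in>A. k a * e a x vs)" using fun_cong[OF fun_cong[OF zero], of x vs] by simp
      also have "\<dots> = (\<Sum>a\<in>degs n \<times> UNIV. k' (fst a) (snd a) *
          (w * (mnm (fst a) x * ((if snd a = l then 1 else 0) - (if sel (fst a) = l then 1 else 0)))))"
        by (rule sum.mono_neutral_cong_left) (auto simp: finite_degs k'_def eA A_def)
      also have "\<dots> = (\<Sum>\<gamma>\<in>degs n. \<Sum>i\<in>UNIV. k' \<gamma> i *
          (w * (mnm \<gamma> x * ((if i = l then 1 else 0) - (if sel \<gamma> = l then 1 else 0)))))"
        by (simp only: sum.cartesian_product split_def)
      also have "\<dots> = w * (\<Sum>\<gamma>\<in>degs n. K \<gamma> * mnm \<gamma> x)"
        unfolding K_def sum_distrib_left sum_distrib_right by (intro sum.cong refl) (simp add: ac_simps)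
      finally show "(\<Sum>\<gamma>\<in>degs n. K \<gamma> * mnm \<gamma> x) = 0" using w by simp
    qed
    moreover have "K \<gamma> = k' \<gamma> l" unfolding K_def using l(2)
      by (simp add: if_distrib[of "\<lambda>c. _ * c"] cong: if_cong)
    ultimately show "k a = 0" using a by (simp add: k'_def al)
  qed
  \<comment> \<open>\<open>cyc\<close> moves the base point to \<open>cyc (sel \<gamma>)\<close>,
    which need not be the chosen one, hence the subtracted term. An index equal to the base point
    lies outside A and stands for the zero vector.\<close>
  define M :: "(4 \<Rightarrow> nat) \<times> 4 \<Rightarrow> (4 \<Rightarrow> nat) \<times> 4 \<Rightarrow> real" where
    "M b a = (if b = (rot (fst a), cyc (snd a)) then 1 else 0) - (if b = (rot (fst a), cyc (sel (fst a))) then 1 else 0)" for b a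
  have M: "act cyc (e a) = (\<Sum>b\<in>A. M b a *\<^sub>R e b)" if a: "a \<in> A" for a
  proof -
    obtain \<gamma> i where al: "a = (\<gamma>, i)" by (cases a)
    have \<gamma>: "rot \<gamma> \<in> degs n" and i: "\<gamma> i \<noteq> 0" using a by (auto simp: A_def al)
    have pick: "(\<Sum>b\<in>A. (if b = (rot \<gamma>, m) then 1 else 0) *\<^sub>R e b) = e (rot \<gamma>, m)" if m: "rot \<gamma> m \<noteq> 0" for m
    proof (cases "(rot \<gamma>, m) \<in> A")
      case True
      then show ?thesis using fin by (simp add: if_distrib[of "\<lambda>r. r *\<^sub>R _"] cong: if_cong)
    next
      case False
      then have "m = sel (rot \<gamma>)" using m \<gamma> by (simp add: A_def)
      then have "e (rot \<gamma>, m) = 0" using sel0[OF \<gamma> m] by simp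
      then show ?thesis using False by (auto intro!: sum.neutral)
    qed
    have nz: "rot \<gamma> (cyc i) \<noteq> 0" "rot \<gamma> (cyc (sel \<gamma>)) \<noteq> 0" using i sel_nonzero[of \<gamma> i] by simp_all
    have "act cyc (e a) = e (rot \<gamma>, cyc i) - e (rot \<gamma>, cyc (sel \<gamma>))"
      using diff[OF \<gamma> nz(2,1)] by (simp add: al e_def cyc)
    also have "\<dots> = (\<Sum>b\<in>A. M b a *\<^sub>R e b)"
      unfolding M_def al fst_conv snd_conv scaleR_diff_left sum_subtractf pick[OF nz(1)] pick[OF nz(2)] ..
    finally show ?thesis .
  qed
  \<comment> \<open>Second components in A are never 0, hence moved by \<open>cyc\<close>; the
    positive term cannot hit the diagonal.\<close>
  have diag: "M a a = (if fst a = rot (fst a) \<and> snd a = cyc (sel (fst a)) then - 1 else 0)" if a: "a \<in> A" for a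
  proof -
    have "snd a \<noteq> 0" using a by (auto simp: A_def sel_def)
    then have "cyc (snd a) \<noteq> snd a" by (rule cyc_neq)
    then show ?thesis by (auto simp: M_def prod_eq_iff)
  qed
  have "0 \<le> (\<Sum>a\<in>A. M a a) \<longleftrightarrow> \<not> (3 dvd n \<and> 0 < n)"
  proof
    assume nonneg: "0 \<le> (\<Sum>a\<in>A. M a a)"
    show "\<not> (3 dvd n \<and> 0 < n)"
    proof
      assume n: "3 dvd n \<and> 0 < n"
      define b where "b = nat (n div 3)"
      have b: "n = 3 * int b" "b > 0" using n by (auto simp: b_def)
      \<comment> \<open>The exponent (0, b, b, b) has base point 1, and \<open>cyc 1\<close> = 2, so
        the index 2 carries an entry -1.\<close>
      define \<gamma> :: "4 \<Rightarrow> nat" where "\<gamma> = (\<lambda>i. if i = 0 then 0 else b)"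
      have "\<gamma> \<in> degs n" by (simp add: degs_def sum_4' \<gamma>_def b)
      moreover have s: "sel \<gamma> = 1" using b by (simp add: sel_def \<gamma>_def)
      ultimately have a: "(\<gamma>, 2) \<in> A" using b by (simp add: A_def \<gamma>_def)
      have "\<forall>i. \<gamma> i = rot \<gamma> i" unfolding all_4 by (simp add: \<gamma>_def)
      then have r: "\<gamma> = rot \<gamma>" by auto
      have "M (\<gamma>, 2) (\<gamma>, 2) = -1" unfolding diag[OF a] using r s by simp
      moreover have "M a a \<le> 0" if "a \<in> A" for a using diag[OF that] by simp
      ultimately have "(\<Sum>a\<in>A. M a a) < (\<Sum>a\<in>A. 0)"
        using a fin by (intro sum_strict_mono_ex1) (auto intro!: bexI[of _ "(\<gamma>, 2)"])
      then show False using nonneg by simp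
    qed
  next
    assume n: "\<not> (3 dvd n \<and> 0 < n)"
    have "M a a = 0" if a: "a \<in> A" for a
    proof (rule ccontr)
      assume "M a a \<noteq> 0"
      then have r: "fst a = rot (fst a)" and s: "snd a = cyc (sel (fst a))"
        using diag[OF a] by (auto split: if_splits)
      define \<gamma> where "\<gamma> = fst a"
      have \<gamma>: "\<gamma> \<in> degs n" "\<gamma> (snd a) \<noteq> 0" "snd a \<noteq> sel \<gamma>" using a by (auto simp: A_def \<gamma>_def)
      have "\<gamma> 1 = \<gamma> 3" "\<gamma> 2 = \<gamma> 1"
        using fun_cong[OF r, of 1] fun_cong[OF r, of 2] by (simp_all add: \<gamma>_def)
      note eq = this
      have g0: "\<gamma> 0 = 0"
      proof (rule ccontr)
        assume "\<gamma> 0 \<noteq> 0"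
        then have "sel \<gamma> = 0" by (simp add: sel_def)
        then show False using s \<gamma>(3) by (simp add: \<gamma>_def)
      qed
      have "n = 3 * int (\<gamma> 1)" using \<gamma>(1) eq g0 by (simp add: degs_def sum_4')
      moreover have "\<gamma> 1 \<noteq> 0"
      proof
        assume "\<gamma> 1 = 0"
        then have "\<forall>i. \<gamma> i = 0" unfolding all_4 using eq g0 by simp
        then show False using \<gamma>(2) by simp
      qed
      ultimately show False using n by simp
    qed
    then show "0 \<le> (\<Sum>a\<in>A. M a a)" by simp
  qed
  with inv_basis_iff_family[OF fin sp ind stable M] show ?thesis by blast
qed

text \<open>If i = j the exponent below is wrong, but then the Whitney form vanishes.\<close>

definition kap1 :: "(4 \<Rightarrow> nat) \<Rightarrow> 4 \<Rightarrow> 4 \<Rightarrow> form" where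
  "kap1 \<gamma> i j = mform 1 (\<gamma>(i := \<gamma> i - 1, j := \<gamma> j - 1)) (whit1 i j)"

lemma whit1_refl: "whit1 i i = 0" "mform k \<alpha> 0 = 0"
  by (auto simp: whit1_def mform_apply fun_eq_iff)

lemma kap1_incr: "i \<noteq> j \<Longrightarrow> kap1 (incr i (incr j \<beta>)) i j = mform 1 \<beta> (whit1 i j)"
proof -
  assume "i \<noteq> j"
  then have "(incr i (incr j \<beta>))(i := incr i (incr j \<beta>) i - 1, j := incr i (incr j \<beta>) j - 1) = \<beta>"
    by (auto simp: incr_apply fun_eq_iff)
  then show ?thesis by (simp add: kap1_def)
qed

lemma ex_incr2:
  assumes "i \<noteq> j" "\<gamma> i \<noteq> 0" "\<gamma> j \<noteq> 0"
  obtains \<beta> where "\<gamma> = incr i (incr j \<beta>)"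
proof -
  obtain \<beta> where \<beta>: "\<gamma> = incr i \<beta>" using ex_incr[of \<gamma> i] assms by blast
  then have "\<beta> j \<noteq> 0" using assms by (simp add: incr_apply)
  then show ?thesis using ex_incr[of \<beta> j] \<beta> that by blast
qed

text \<open>Logarithmic differentials: in this form the syzygy property is a telescoping sum, at the
  price of dividing by coordinates.\<close>

lemma kap1_interior:
  assumes "x \<in> simplex3" "\<And>i. 0 < x $ i" "\<gamma> i \<noteq> 0" "\<gamma> j \<noteq> 0"
  shows "kap1 \<gamma> i j x vs = (if vs 0 \<in> tangent3 then mnm \<gamma> x * (vs 0 $ j / x $ j - vs 0 $ i / x $ i) else 0)"
proof (cases "i = j")
  case True
  then show ?thesis by (simp add: kap1_def whit1_refl)
next
  case False
  then obtain \<beta> where \<beta>: "\<gamma> = incr i (incr j \<beta>)" using ex_incr2 assms by metis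
  have "x $ i \<noteq> 0" "x $ j \<noteq> 0" using assms(2)[of i] assms(2)[of j] by auto
  then show ?thesis unfolding \<beta> kap1_incr[OF False]
    using assms(1) by (simp add: mform_apply whit1_def mnm_incr field_simps)
qed

lemma kap1_in:
  assumes "\<gamma> \<in> degs (int r + 1)" "\<gamma> i \<noteq> 0" "\<gamma> j \<noteq> 0"
  shows "kap1 \<gamma> i j \<in> PmLam r 1"
proof (cases "i = j")
  case True
  then show ?thesis using subspace_0[OF subspace_forms(3)] by (simp add: kap1_def whit1_refl)
next
  case False
  then obtain \<beta> where \<beta>: "\<gamma> = incr i (incr j \<beta>)" using ex_incr2 assms by metis
  have "\<beta> \<in> degs (int r - 1)" using assms(1) unfolding \<beta> by (simp add: incr_degs)
  then show ?thesis unfolding \<beta> kap1_incr[OF False] PmLam_1 by (intro span_base) blast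
qed

text \<open>The Whitney form itself has degree one in the coordinates, and writing it as a
  difference of logarithmic differentials costs two more factors than its coefficient of degree r -
  1. This is why the relevant degree is r + 1.\<close>

lemma inv_basis_PmLam_1: "inv_basis_up_to_sign (PmLam r 1) \<longleftrightarrow> \<not> (3 dvd (int r + 1))"
proof -
  have "inv_basis_up_to_sign (PmLam r 1) \<longleftrightarrow> \<not> (3 dvd (int r + 1) \<and> 0 < int r + 1)"
  proof (rule inv_basis_syzygies)
    let ?G = "{kap1 \<gamma> i j | \<gamma> i j. \<gamma> \<in> degs (int r + 1) \<and> \<gamma> i \<noteq> 0 \<and> \<gamma> j \<noteq> 0}"
    show "PmLam r 1 = span ?G"
    proof
      show "span ?G \<subseteq> PmLam r 1"
        by (rule span_minimal[OF _ subspace_forms(3)]) (use kap1_in in blast)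
      show "PmLam r 1 \<subseteq> span ?G"
        unfolding PmLam_1
      proof (rule span_minimal[OF _ subspace_span], clarify)
        fix \<alpha> i j assume \<alpha>: "\<alpha> \<in> degs (int r - 1)"
        show "mform 1 \<alpha> (whit1 i j) \<in> span ?G"
        proof (cases "i = j")
          case True
          then show ?thesis by (simp add: whit1_refl span_zero)
        next
          case False
          have "incr i (incr j \<alpha>) \<in> degs (int r + 1)" using \<alpha> by (simp add: incr_degs)
          moreover have "incr i (incr j \<alpha>) i \<noteq> 0" "incr i (incr j \<alpha>) j \<noteq> 0" by (auto simp: incr_apply)
          ultimately have "kap1 (incr i (incr j \<alpha>)) i j \<in> span ?G" by (intro span_base) blast
          then show ?thesis by (simp only: kap1_incr[OF False])
        qed
      qed
    qed
    show "act \<pi> v \<in> PmLam r 1" if "\<pi> permutes UNIV" "v \<in> PmLam r 1" for \<pi> v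
      using act_stable that by blast
    show "act cyc (kap1 \<gamma> i j) = kap1 (rot \<gamma>) (cyc i) (cyc j)" for \<gamma> i j
    proof -
      have c: "cyc (cyc m) = i \<longleftrightarrow> m = cyc i" for m i by (metis cyc_cyc_cyc)
      have "rot (\<gamma>(i := \<gamma> i - 1, j := \<gamma> j - 1)) = (rot \<gamma>)(cyc i := \<gamma> i - 1, cyc j := \<gamma> j - 1)"
        by (auto simp: rot_def inv_cyc fun_eq_iff c)
      then show ?thesis by (simp add: kap1_def act_cyc_mform act_forms)
    qed
    show "kap1 \<gamma> i j + kap1 \<gamma> j k = kap1 \<gamma> i k"
      if "\<gamma> \<in> degs (int r + 1)" "\<gamma> i \<noteq> 0" "\<gamma> j \<noteq> 0" "\<gamma> k \<noteq> 0" for \<gamma> i j k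
    proof -
      have "kap1 \<gamma> i j + kap1 \<gamma> j k - kap1 \<gamma> i k \<in> PLam r 1"
        using that kap1_in PmLam_subset_PLam(1)
        by (intro subspace_diff[OF subspace_forms(1)] subspace_add[OF subspace_forms(1)]) blast+
      then have "kap1 \<gamma> i j + kap1 \<gamma> j k - kap1 \<gamma> i k = 0"
        by (intro zero_interior) (use that in \<open>auto simp: kap1_interior algebra_simps\<close>)
      then show ?thesis by simp
    qed
    fix x :: "real^4" and l :: 4 assume x: "x \<in> simplex3" "\<And>i. 0 < x $ i"
    have nz: "x $ i \<noteq> 0" for i using x(2)[of i] by simp
    \<comment> \<open>The part of the direction along - x contributes - 1 + 1 to the two quotients;
      what remains is the weight 1 / x $ l.\<close>
    have "kap1 \<gamma> i j x (\<lambda>_. axis l 1 - x) = 1 / x $ l * (mnm \<gamma> x * ((if j = l then 1 else 0) - (if i = l then 1 else 0)))"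
      if "\<gamma> i \<noteq> 0" "\<gamma> j \<noteq> 0" for \<gamma> i j
      using nz[of i] nz[of j] x(1) by (simp add: kap1_interior[OF x that] axis_nth' field_simps)
    then show "\<exists>w vs. w \<noteq> 0 \<and> (\<forall>\<gamma> i j. \<gamma> i \<noteq> 0 \<longrightarrow> \<gamma> j \<noteq> 0 \<longrightarrow>
       kap1 \<gamma> i j x vs = w * (mnm \<gamma> x * ((if j = l then 1 else 0) - (if i = l then 1 else 0))))"
      using nz[of l] by (intro exI[of _ "1 / x $ l"] exI[of _ "\<lambda>_. axis l 1 - x"]) auto
  qed
  then show ?thesis by simp
qed

section \<open>Trace-free 2-forms as syzygies\<close>

lemma om_on_face:
  assumes "v \<in> tangent3" "w \<in> tangent3" "v $ m = 0" "w $ m = 0" "vs 0 = v" "vs 1 = w" "i \<noteq> m" "j \<noteq> m"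
  shows "om i x vs = om j x vs"
proof (cases "m = 0")
  case True
  have 0: "v $ 0 = 0" "w $ 0 = 0" using assms True by simp_all
  have v: "v $ 3 = - v $ 1 - v $ 2" "w $ 3 = - w $ 1 - w $ 2"
    using tangent3_sum[OF assms(1)] tangent3_sum[OF assms(2)] unfolding 0 by simp_all
  have "\<forall>i. i \<noteq> 0 \<longrightarrow> om i x vs = om 3 x vs"
    unfolding all_4 om_def d2_def assms(5,6) by (simp add: v algebra_simps)
  then show ?thesis using assms True by metis
next
  case False
  have "om i x vs = 0" if "i \<noteq> m" for i
  proof (cases "i = 0")
    case False
    then have "m = cyc i \<or> m = cyc (cyc i)" using cases_cyc[OF False, of m] \<open>m \<noteq> 0\<close> that by auto
    then show ?thesis using assms(3,4) by (auto simp: om_def d2_def assms(5) assms(6)[unfolded One_nat_def])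
  qed (simp add: om_0)
  then show ?thesis using assms(7,8) by simp
qed

text \<open>On face m all \<open>om i\<close> with i distinct from m have the same trace, and i and
  j avoid m whenever the monomial survives there. Conversely, vanishing on the faces confines the
  coefficients to the support of the monomial and makes them add up to zero when coordinate 0 is
  absent.\<close>

lemma PLam0_2_generators:
  "PLam0 r 2 = span {e2 (\<gamma>, j) - e2 (\<gamma>, i) | \<gamma> i j. \<gamma> \<in> degs (int r) \<and> \<gamma> i \<noteq> 0 \<and> \<gamma> j \<noteq> 0}"
    (is "_ = span ?G")
proof
  let ?D = "degs (int r)"
  show "span ?G \<subseteq> PLam0 r 2"
  proof (rule span_minimal[OF _ subspace_forms0(2)], rule subsetI)
    fix f assume "f \<in> ?G"
    then obtain \<gamma> i j where f: "f = e2 (\<gamma>, j) - e2 (\<gamma>, i)"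
      and \<gamma>: "\<gamma> \<in> ?D" "\<gamma> i \<noteq> 0" "\<gamma> j \<noteq> 0" by blast
    have "e2 (\<gamma>, m) \<in> PLam r 2" for m
      unfolding PLam_2 using \<gamma> by (intro span_base) (auto simp: e2_def om_def)
    then have "e2 (\<gamma>, j) - e2 (\<gamma>, i) \<in> PLam r 2" by (intro subspace_diff[OF subspace_forms(2)])
    moreover have "trace_free 2 (e2 (\<gamma>, j) - e2 (\<gamma>, i))"
      unfolding trace_free_def
    proof clarify
      fix m and x :: "real^4" and vs assume x: "x \<in> simplex3" "x $ m = 0"
        and vs: "\<forall>n<2::nat. vs n \<in> tangent3 \<and> vs n $ m = 0"
      show "(e2 (\<gamma>, j) - e2 (\<gamma>, i)) x vs = 0"
      proof (cases "\<gamma> m = 0")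
        case True
        then have "i \<noteq> m" "j \<noteq> m" using \<gamma> by auto
        then have "om j x vs = om i x vs"
          using vs by (intro om_on_face[of "vs 0" "vs 1" m]) auto
        then show ?thesis by (simp add: e2_def mform_apply, blast)
      next
        case False
        then show ?thesis using mnm_zero[OF x(2), of \<gamma>] by (simp add: e2_def mform_apply)
      qed
    qed
    ultimately show "f \<in> PLam0 r 2" by (simp add: PLam0_def f)
  qed
  show "PLam0 r 2 \<subseteq> span ?G"
  proof
    fix f assume "f \<in> PLam0 r 2"
    then have f: "f \<in> PLam r 2" and tf: "trace_free 2 f" by (auto simp: PLam0_def)
    have "finite (?D \<times> vertices)" by (simp add: finite_degs)
    from span_family_coords[OF this f[unfolded PLam_2_basis]]
    obtain k where k: "f = (\<Sum>a\<in>?D \<times> vertices. k a *\<^sub>R e2 a)" ..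
    then have fk: "f = (\<Sum>\<gamma>\<in>?D. \<Sum>l\<in>vertices. k (\<gamma>, l) *\<^sub>R e2 (\<gamma>, l))"
      by (simp only: sum.cartesian_product split_def prod.collapse)
    have ev: "f x vs = (\<Sum>\<gamma>\<in>?D. (\<Sum>l\<in>vertices. k (\<gamma>, l) * om l x vs) * mnm \<gamma> x)"
      if "x \<in> simplex3" "\<forall>j<2. vs j \<in> tangent3" for x vs
      unfolding fk sum_vertices using that by (simp add: e2_def mform_apply algebra_simps)
    have k1: "k (\<gamma>, l) = 0" if \<gamma>: "\<gamma> \<in> ?D" and l: "l \<noteq> 0" and \<gamma>l: "\<gamma> l = 0" for \<gamma> l
    proof (rule mnm_independent_face[OF _ \<gamma> \<gamma>l, of "\<lambda>\<gamma>. k (\<gamma>, l)"])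
      fix x :: "real^4" assume x: "x \<in> simplex3" "x $ l = 0"
      let ?vs = "pr (edge (cyc l)) (edge (cyc (cyc l)))"
      have "f x ?vs = 0"
        using tf[unfolded trace_free_def, rule_format, of x l ?vs] x cyc_neq[OF l] l
        by (simp add: edge_nth pr_def)
      moreover have "f x ?vs = (\<Sum>\<gamma>\<in>?D. (\<Sum>i\<in>vertices. k (\<gamma>, i) * om i x ?vs) * mnm \<gamma> x)"
        by (rule ev[OF x(1)]) (simp add: pr_def)
      ultimately show "(\<Sum>\<gamma>\<in>?D. k (\<gamma>, l) * mnm \<gamma> x) = 0"
        unfolding sum_vertices_cyc[OF l] om_edge[OF l] using cyc_neq[OF l] by simp
    qed
    have k2: "k (\<gamma>, 1) + k (\<gamma>, 2) + k (\<gamma>, 3) = 0" if \<gamma>: "\<gamma> \<in> ?D" and \<gamma>0: "\<gamma> 0 = 0" for \<gamma>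
    proof (rule mnm_independent_face[OF _ \<gamma> \<gamma>0, of "\<lambda>\<gamma>. k (\<gamma>, 1) + k (\<gamma>, 2) + k (\<gamma>, 3)"])
      fix x :: "real^4" assume x: "x \<in> simplex3" "x $ 0 = 0"
      \<comment> \<open>Two edges of face 0; all three \<open>om\<close> forms take the value 1 on
        them.\<close>
      let ?vs = "pr (axis 2 1 - axis 1 1) (axis 3 1 - axis 1 1) :: nat \<Rightarrow> real^4"
      have t: "\<forall>j<2. ?vs j \<in> tangent3 \<and> ?vs j $ 0 = 0"
        by (simp add: pr_def tangent3_def sum_4' axis_nth')
      have "f x ?vs = 0"
        using tf[unfolded trace_free_def, rule_format, of x 0 ?vs] x t by simp
      moreover have "f x ?vs = (\<Sum>\<gamma>\<in>?D. (\<Sum>i\<in>vertices. k (\<gamma>, i) * om i x ?vs) * mnm \<gamma> x)"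
        by (rule ev[OF x(1)]) (use t in simp)
      moreover have "om 1 x ?vs = 1" "om 2 x ?vs = 1" "om 3 x ?vs = 1"
        by (simp_all add: om_def d2_def axis_nth')
      ultimately show "(\<Sum>\<gamma>\<in>?D. (k (\<gamma>, 1) + k (\<gamma>, 2) + k (\<gamma>, 3)) * mnm \<gamma> x) = 0"
        unfolding sum_vertices by simp
    qed
    have "(\<Sum>l\<in>vertices. k (\<gamma>, l) *\<^sub>R e2 (\<gamma>, l)) \<in> span ?G" if \<gamma>: "\<gamma> \<in> ?D" for \<gamma>
    proof -
      have part: "k (\<gamma>, l) *\<^sub>R (e2 (\<gamma>, l) - e2 (\<gamma>, s)) \<in> span ?G" if "l \<in> vertices" "\<gamma> s \<noteq> 0" for l s
      proof (cases "\<gamma> l = 0")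
        case True
        have "l \<noteq> 0" using that(1) by (rule vertices_iff[THEN iffD1])
        then show ?thesis using k1[OF \<gamma> _ True] by (simp add: span_zero)
      next
        case False
        then show ?thesis using \<gamma> that by (intro span_scale span_base) blast
      qed
      show ?thesis
      proof (cases "\<exists>s. \<gamma> s \<noteq> 0")
        case False
        then have "(\<Sum>l\<in>vertices. k (\<gamma>, l) *\<^sub>R e2 (\<gamma>, l)) = 0"
          unfolding sum_vertices using k1[OF \<gamma>] by simp
        then show ?thesis by (simp only: span_zero)
      next
        case True
        \<comment> \<open>If coordinate 0 is present, s = 0 and the subtracted form is zero by
          \<open>om_0\<close>; otherwise the subtracted terms cancel by \<open>k2\<close>.\<close>
        then obtain s where s: "\<gamma> s \<noteq> 0" "\<gamma> 0 \<noteq> 0 \<Longrightarrow> s = 0" by (cases "\<gamma> 0 = 0") auto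
        have "(\<Sum>l\<in>vertices. k (\<gamma>, l) *\<^sub>R e2 (\<gamma>, l)) = (\<Sum>l\<in>vertices. k (\<gamma>, l) *\<^sub>R (e2 (\<gamma>, l) - e2 (\<gamma>, s)))"
        proof (cases "\<gamma> 0 = 0")
          case False
          have "e2 (\<gamma>, 0) = 0" by (simp add: e2_def om_0 whit1_refl)
          then show ?thesis using s(2)[OF False] by simp
        next
          case True
          have k3: "k (\<gamma>, 3) = - k (\<gamma>, 1) - k (\<gamma>, 2)" using k2[OF \<gamma> True] by simp
          show ?thesis unfolding sum_vertices k3 by (simp add: algebra_simps)
        qed
        then show ?thesis using span_sum[OF part[OF _ s(1)]] by (simp only:)
      qed
    qed
    then show "f \<in> span ?G" unfolding fk by (rule span_sum)
  qed
qed

lemma inv_basis_PLam0_2: "inv_basis_up_to_sign (PLam0 r 2) \<longleftrightarrow> \<not> (3 dvd r \<and> 0 < r)"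
proof -
  have "inv_basis_up_to_sign (PLam0 r 2) \<longleftrightarrow> \<not> (3 dvd int r \<and> 0 < int r)"
  proof (rule inv_basis_syzygies)
    show "PLam0 r 2 = span {e2 (\<gamma>, j) - e2 (\<gamma>, i) | \<gamma> i j. \<gamma> \<in> degs (int r) \<and> \<gamma> i \<noteq> 0 \<and> \<gamma> j \<noteq> 0}"
      by (rule PLam0_2_generators)
    show "act \<pi> v \<in> PLam0 r 2" if "\<pi> permutes UNIV" "v \<in> PLam0 r 2" for \<pi> v
      using act_stable_trace_free that by blast
    show "act cyc (e2 (\<gamma>, j) - e2 (\<gamma>, i)) = e2 (rot \<gamma>, cyc j) - e2 (rot \<gamma>, cyc i)" for \<gamma> i j
      by (simp add: linear_diff[OF linear_act] e2_def act_cyc_mform act_om)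
    show "e2 (\<gamma>, j) - e2 (\<gamma>, i) + (e2 (\<gamma>, k) - e2 (\<gamma>, j)) = e2 (\<gamma>, k) - e2 (\<gamma>, i)" for \<gamma> i j k
      by simp
    fix x :: "real^4" and l :: 4 assume x: "x \<in> simplex3" and l: "l \<noteq> 0"
    show "\<exists>w vs. w \<noteq> 0 \<and> (\<forall>\<gamma> i j. \<gamma> i \<noteq> 0 \<longrightarrow> \<gamma> j \<noteq> 0 \<longrightarrow>
       (e2 (\<gamma>, j) - e2 (\<gamma>, i)) x vs = w * (mnm \<gamma> x * ((if j = l then 1 else 0) - (if i = l then 1 else 0))))"
      by (intro exI[of _ 1] exI[of _ "pr (edge (cyc l)) (edge (cyc (cyc l)))"])
        (simp add: e2_edge[OF x l] right_diff_distrib)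
  qed
  then show ?thesis by (simp add: int_dvd_int_iff[symmetric])
qed

theorem theorem4p2:
  fixes r :: nat
  shows "inv_basis_up_to_sign (PLam r 1)
       \<and> (inv_basis_up_to_sign (PmLam r 1) \<longleftrightarrow> r \<notin> {3 * m + 2 | m. True})
       \<and> inv_basis_up_to_sign (PLam r 2)
       \<and> inv_basis_up_to_sign (PmLam r 2)
       \<and> inv_basis_up_to_sign (PLam0 r 1)
       \<and> inv_basis_up_to_sign (PmLam0 r 1)
       \<and> (inv_basis_up_to_sign (PLam0 r 2) \<longleftrightarrow> r \<notin> {3 * m + 3 | m. True})
       \<and> inv_basis_up_to_sign (PmLam0 r 2)"
proof -
  have "r \<notin> {3 * m + 2 | m. True} \<longleftrightarrow> \<not> 3 dvd (int r + 1)"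
    "r \<notin> {3 * m + 3 | m. True} \<longleftrightarrow> \<not> (3 dvd r \<and> 0 < r)"
    unfolding mem_Collect_eq by presburger+
  then show ?thesis
    by (simp only: inv_basis_PLam_1 inv_basis_PmLam_1 inv_basis_PLam_2 inv_basis_PmLam_2 inv_basis_PLam0_1
      inv_basis_PmLam0_1 inv_basis_PLam0_2 inv_basis_PmLam0_2 simp_thms)
qed

end
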